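(* Let $(G,g)$ be a Lie group equipped with a left-invariant Riemannian metric $g$, and let $K$ be a semisimple subgroup of $G$ generating a left-invariant conformal foliation $\mathcal{F}$ on $G$. If $K$ is normal in $G$, then $\mathcal{F}$ is Riemannian with minimal leaves.
   Context: A Riemannian Lie group $(G,g)$ is a Lie group $G$ with a left-invariant Riemannian metric $g$. A subgroup $K$ of $G$ means a Lie subgroup, with Lie algebra $\mathfrak{k}\subset\mathfrak{g}$; $K$ is semisimple if $\mathfrak{k}$ is semisimple. The left-invariant foliation $\mathcal{F}$ generated by $K$ is the foliation tangent to the left-invariant (integrable) distribution $\mathcal{V}$ on $G$ whose value at the identity is $\mathfrak{k}$. Let $\mathcal{H}$ be the orthogonal complement of $\mathcal{V}$ in $TG$ with respect to $g$; $\mathcal{V}$ and $\mathcal{H}$ also denote the orthogonal projections onto these subbundles. With $\nabla$ the Levi-Civita connection of $g$, the second fundamental forms are $$B^{\mathcal{V}}(V,W)=\tfrac12\,\mathcal{H}(\nabla_V W+\nabla_W V)\ \ (V,W\in\mathcal{V}),\qquad B^{\mathcal{H}}(X,Y)=\tfrac12\,\mathcal{V}(\nabla_X Y+\nabla_Y X)\ \ (X,Y\in\mathcal{H}).$$ The foliation $\mathcal{F}$ is conformal if there is a vertical vector field $V\in\mathcal{V}$ with $B^{\mathcal{H}}=g\otimes V$, i.e. $B^{\mathcal H}(X,Y)=g(X,Y)\,V$ for all $X,Y\in\mathcal H$; it is Riemannian if $V=0$, i.e. $B^{\mathcal{H}}=0$. It has minimal leaves (is minimal) if $\operatorname{trace}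 B^{\mathcal{V}}=0$. *)

theory Defs
  imports
    "HOL-Analysis.Analysis"
    "HOL-Algebra.Coset"
    "HOL-Library.Function_Algebras"
begin

section \<open>Pointwise vector space structure on functions\<close>

text \<open>Tangent vectors and vector fields below are functions, added and scaled pointwise.\<close>

instantiation "fun" :: (type, scaleR) scaleR
begin

definition scaleR_fun_def: "r *\<^sub>R f = (\<lambda>x. r *\<^sub>R f x)"

instance ..

end

instance "fun" :: (type, real_vector) real_vector
  by standard
    (auto simp: scaleR_fun_def plus_fun_def fun_eq_iff scaleR_add_right scaleR_add_left)


section \<open>Smooth maps between subsets of Euclidean spaces\<close>

text \<open>Continuous differentiability of order \<open>k\<close>, meaningful for open \<open>S\<close>.\<close>

primrec Ck_on ::
  "nat \<Rightarrow> 'a::euclidean_space set \<Rightarrow> ('a \<Rightarrow> 'b::euclidean_space) \<Rightarrow> bool" where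
  "Ck_on 0 S f \<longleftrightarrow> continuous_on S f"
| "Ck_on (Suc k) S f \<longleftrightarrow>
     (\<forall>x\<in>S. f differentiable (at x)) \<and> (\<forall>v. Ck_on k S (\<lambda>x. frechet_derivative f (at x) v))"

text \<open>On an arbitrary set, smooth means: locally the restriction of a smooth map defined on an
  open set. For a relatively open subset of a linear subspace this is the usual notion.\<close>

definition smooth_on :: "'a::euclidean_space set \<Rightarrow> ('a \<Rightarrow> 'b::euclidean_space) \<Rightarrow> bool" where
  "smooth_on S f \<longleftrightarrow>
     (\<forall>x\<in>S. \<exists>T h. open T \<and> x \<in> T \<and> (\<forall>k. Ck_on k T h) \<and> (\<forall>y\<in>S \<inter> T. h y = f y))"


section \<open>Smooth manifolds\<close>

text \<open>Charts take values in a linear subspace \<open>model\<close> of a Euclidean space rather than in the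
  whole type, so that every dimension, including 0, occurs. The point set is the
  \<open>topspace\<close> of the topology; a chart is a pair of its domain and its coordinate map.\<close>

record ('a, 'e) mfd =
  mtop :: "'a topology"
  model :: "'e set"
  atlas :: "('a set \<times> ('a \<Rightarrow> 'e)) set"

definition smooth_manifold :: "('a, 'e::euclidean_space) mfd \<Rightarrow> bool" where
  "smooth_manifold M \<longleftrightarrow>
     Hausdorff_space (mtop M) \<and> second_countable (mtop M) \<and> subspace (model M) \<and>
     (\<Union>(U, \<phi>)\<in>atlas M. U) = topspace (mtop M) \<and>
     (\<forall>(U, \<phi>)\<in>atlas M.
        openin (mtop M) U \<and> openin (top_of_set (model M)) (\<phi> ` U) \<and>
        homeomorphic_map (subtopology (mtop M) U) (top_of_set (\<phi> ` U)) \<phi>) \<and>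
     (\<forall>(U, \<phi>)\<in>atlas M. \<forall>(V, \<psi>)\<in>atlas M.
        smooth_on (\<phi> ` (U \<inter> V)) (\<psi> \<circ> inv_into U \<phi>))"

definition smooth_map ::
  "('a, 'e::euclidean_space) mfd \<Rightarrow> ('b, 'd::euclidean_space) mfd \<Rightarrow> ('a \<Rightarrow> 'b) \<Rightarrow> bool" where
  "smooth_map M N F \<longleftrightarrow>
     continuous_map (mtop M) (mtop N) F \<and>
     (\<forall>(U, \<phi>)\<in>atlas M. \<forall>(V, \<psi>)\<in>atlas N.
        smooth_on (\<phi> ` (U \<inter> F -` V)) (\<psi> \<circ> F \<circ> inv_into U \<phi>))"

text \<open>Immersion: the Jacobian in charts, as a linear map on the model space of the source, is
  injective at every point.\<close>

definition immersion ::
  "('a, 'e::euclidean_space) mfd \<Rightarrow> ('b, 'd::euclidean_space) mfd \<Rightarrow> ('a \<Rightarrow> 'b) \<Rightarrow> bool" where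
  "immersion M N F \<longleftrightarrow>
     smooth_map M N F \<and>
     (\<forall>(U, \<phi>)\<in>atlas M. \<forall>(V, \<psi>)\<in>atlas N. \<forall>p\<in>U \<inter> F -` V.
        \<exists>D. (\<psi> \<circ> F \<circ> inv_into U \<phi> has_derivative D) (at (\<phi> p) within \<phi> ` (U \<inter> F -` V)) \<and>
            inj_on D (model M))"

definition prod_mfd :: "('a, 'e) mfd \<Rightarrow> ('b, 'd) mfd \<Rightarrow> ('a \<times> 'b, 'e \<times> 'd) mfd" where
  "prod_mfd M N =
     \<lparr>mtop = prod_topology (mtop M) (mtop N), model = model M \<times> model N,
      atlas = {(U \<times> V, map_prod \<phi> \<psi>) | U \<phi> V \<psi>. (U, \<phi>) \<in> atlas M \<and> (V, \<psi>) \<in> atlas N}\<rparr>"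

text \<open>An open subset of a Euclidean space as a manifold.\<close>

definition euc_mfd :: "'e::euclidean_space set \<Rightarrow> ('e, 'e) mfd" where
  "euc_mfd S = \<lparr>mtop = top_of_set S, model = UNIV, atlas = {(S, \<lambda>x. x)}\<rparr>"


section \<open>Tangent vectors and vector fields\<close>

definition smooth_fun :: "('a, 'e::euclidean_space) mfd \<Rightarrow> ('a \<Rightarrow> real) set" where
  "smooth_fun M = {f. smooth_map M (euc_mfd UNIV) f}"

type_synonym 'a tvector = "('a \<Rightarrow> real) \<Rightarrow> real"
type_synonym 'a vfield = "'a \<Rightarrow> 'a tvector"

text \<open>A tangent vector is the velocity of a smooth curve, regarded as the directional derivative
  it defines on smooth functions. Tangent vectors are set to 0 on non-smooth arguments, and
  vector fields are set to 0 outside the manifold, so that HOL equality and the pointwise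
  operations are the intended ones.\<close>

definition velocity :: "('a, 'e::euclidean_space) mfd \<Rightarrow> (real \<Rightarrow> 'a) \<Rightarrow> 'a tvector" where
  "velocity M \<gamma> = (\<lambda>f. if f \<in> smooth_fun M then deriv (f \<circ> \<gamma>) 0 else 0)"

definition tangent_space :: "('a, 'e::euclidean_space) mfd \<Rightarrow> 'a \<Rightarrow> 'a tvector set" where
  "tangent_space M p =
     {velocity M \<gamma> | \<gamma>. \<exists>\<epsilon>>0. smooth_map (euc_mfd {-\<epsilon><..<\<epsilon>}) M \<gamma> \<and> \<gamma> 0 = p}"

text \<open>The differential of a smooth map into \<open>N\<close>.\<close>

definition pushforward ::
  "('b, 'd::euclidean_space) mfd \<Rightarrow> ('a \<Rightarrow> 'b) \<Rightarrow> 'a tvector \<Rightarrow> 'b tvector" where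
  "pushforward N F v = (\<lambda>f. if f \<in> smooth_fun N then v (f \<circ> F) else 0)"

definition vector_fields :: "('a, 'e::euclidean_space) mfd \<Rightarrow> 'a vfield set" where
  "vector_fields M =
     {X. (\<forall>p\<in>topspace (mtop M). X p \<in> tangent_space M p) \<and>
         (\<forall>p. p \<notin> topspace (mtop M) \<longrightarrow> X p = 0) \<and>
         (\<forall>f\<in>smooth_fun M. (\<lambda>p. X p f) \<in> smooth_fun M)}"

definition fun_smult :: "('a \<Rightarrow> real) \<Rightarrow> 'a vfield \<Rightarrow> 'a vfield" (infixr \<open>\<cdot>\<^sub>v\<close> 75) where
  "f \<cdot>\<^sub>v X = (\<lambda>p. f p *\<^sub>R X p)"

definition bracket :: "'a vfield \<Rightarrow> 'a vfield \<Rightarrow> 'a vfield" where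
  "bracket X Y = (\<lambda>p f. X p (\<lambda>q. Y q f) - Y p (\<lambda>q. X q f))"


section \<open>Riemannian metrics and the Levi-Civita connection\<close>

type_synonym 'a metric = "'a \<Rightarrow> 'a tvector \<Rightarrow> 'a tvector \<Rightarrow> real"

definition riemannian_metric :: "('a, 'e::euclidean_space) mfd \<Rightarrow> 'a metric \<Rightarrow> bool" where
  "riemannian_metric M g \<longleftrightarrow>
     (\<forall>p\<in>topspace (mtop M).
        (\<forall>u\<in>tangent_space M p. \<forall>v\<in>tangent_space M p. \<forall>w\<in>tangent_space M p. \<forall>a b.
           g p (a *\<^sub>R u + b *\<^sub>R v) w = a * g p u w + b * g p v w) \<and>
        (\<forall>u\<in>tangent_space M p. \<forall>v\<in>tangent_space M p. g p u v = g p v u) \<and>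
        (\<forall>u\<in>tangent_space M p. u \<noteq> 0 \<longrightarrow> g p u u > 0)) \<and>
     (\<forall>X\<in>vector_fields M. \<forall>Y\<in>vector_fields M. (\<lambda>p. g p (X p) (Y p)) \<in> smooth_fun M)"

definition affine_connection ::
  "('a, 'e::euclidean_space) mfd \<Rightarrow> ('a vfield \<Rightarrow> 'a vfield \<Rightarrow> 'a vfield) \<Rightarrow> bool" where
  "affine_connection M nabla \<longleftrightarrow>
     (\<forall>X\<in>vector_fields M. \<forall>Y\<in>vector_fields M.
        nabla X Y \<in> vector_fields M \<and>
        (\<forall>Z\<in>vector_fields M.
           nabla (X + Y) Z = nabla X Z + nabla Y Z \<and>
           nabla X (Y + Z) = nabla X Y + nabla X Z) \<and>
        (\<forall>f\<in>smooth_fun M.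
           nabla (f \<cdot>\<^sub>v X) Y = f \<cdot>\<^sub>v nabla X Y \<and>
           nabla X (f \<cdot>\<^sub>v Y) = (\<lambda>p. X p f) \<cdot>\<^sub>v Y + f \<cdot>\<^sub>v nabla X Y))"

definition levi_civita ::
  "('a, 'e::euclidean_space) mfd \<Rightarrow> 'a metric \<Rightarrow>
     ('a vfield \<Rightarrow> 'a vfield \<Rightarrow> 'a vfield) \<Rightarrow> bool" where
  "levi_civita M g nabla \<longleftrightarrow>
     affine_connection M nabla \<and>
     (\<forall>X\<in>vector_fields M. \<forall>Y\<in>vector_fields M.
        nabla X Y - nabla Y X = bracket X Y) \<and>
     (\<forall>X\<in>vector_fields M. \<forall>Y\<in>vector_fields M. \<forall>Z\<in>vector_fields M. \<forall>p\<in>topspace (mtop M).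
        X p (\<lambda>q. g q (Y q) (Z q)) = g p (nabla X Y p) (Z p) + g p (Y p) (nabla X Z p))"


section \<open>Distributions and second fundamental forms\<close>

type_synonym 'a distribution = "'a \<Rightarrow> 'a tvector set"

definition sections ::
  "('a, 'e::euclidean_space) mfd \<Rightarrow> 'a distribution \<Rightarrow> 'a vfield set" where
  "sections M D = {X \<in> vector_fields M. \<forall>p\<in>topspace (mtop M). X p \<in> D p}"

definition horizontal ::
  "('a, 'e::euclidean_space) mfd \<Rightarrow> 'a metric \<Rightarrow> 'a distribution \<Rightarrow> 'a distribution" where
  "horizontal M g D = (\<lambda>p. {v \<in> tangent_space M p. \<forall>w\<in>D p. g p v w = 0})"

definition orth_proj ::
  "('v::real_vector \<Rightarrow> 'v \<Rightarrow> real) \<Rightarrow> 'v set \<Rightarrow> 'v \<Rightarrow> 'v" where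
  "orth_proj b W u = (THE w. w \<in> W \<and> (\<forall>w'\<in>W. b (u - w) w' = 0))"

text \<open>The form with values in the distribution \<open>D\<close>: for \<open>X\<close>, \<open>Y\<close> vertical take \<open>D\<close> horizontal, and
  conversely.\<close>

definition sff ::
  "('a, 'e::euclidean_space) mfd \<Rightarrow> 'a metric \<Rightarrow> ('a vfield \<Rightarrow> 'a vfield \<Rightarrow> 'a vfield) \<Rightarrow>
     'a distribution \<Rightarrow> 'a vfield \<Rightarrow> 'a vfield \<Rightarrow> 'a vfield" where
  "sff M g nabla D X Y =
     (\<lambda>p. if p \<in> topspace (mtop M)
          then (1/2) *\<^sub>R orth_proj (g p) (D p) ((nabla X Y + nabla Y X) p) else 0)"

abbreviation vertical_sff where
  "vertical_sff M g nabla \<V> \<equiv> sff M g nabla (horizontal M g \<V>)"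

abbreviation horizontal_sff where
  "horizontal_sff M g nabla \<V> \<equiv> sff M g nabla \<V>"

text \<open>The argument \<open>\<V>\<close> is the distribution tangent to the foliation.\<close>

definition conformal_foliation ::
  "('a, 'e::euclidean_space) mfd \<Rightarrow> 'a metric \<Rightarrow> ('a vfield \<Rightarrow> 'a vfield \<Rightarrow> 'a vfield) \<Rightarrow>
     'a distribution \<Rightarrow> bool" where
  "conformal_foliation M g nabla \<V> \<longleftrightarrow>
     (\<exists>V\<in>sections M \<V>.
        \<forall>X\<in>sections M (horizontal M g \<V>). \<forall>Y\<in>sections M (horizontal M g \<V>).
          horizontal_sff M g nabla \<V> X Y = (\<lambda>p. g p (X p) (Y p)) \<cdot>\<^sub>v V)"

definition riemannian_foliation ::
  "('a, 'e::euclidean_space) mfd \<Rightarrow> 'a metric \<Rightarrow> ('a vfield \<Rightarrow> 'a vfield \<Rightarrow> 'a vfield) \<Rightarrow>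
     'a distribution \<Rightarrow> bool" where
  "riemannian_foliation M g nabla \<V> \<longleftrightarrow>
     (\<forall>X\<in>sections M (horizontal M g \<V>). \<forall>Y\<in>sections M (horizontal M g \<V>).
        horizontal_sff M g nabla \<V> X Y = 0)"

text \<open>The trace at \<open>p\<close> is computed with vertical fields \<open>W 0, \<dots>, W (n - 1)\<close> that form an
  orthonormal basis of \<open>\<V> p\<close> at the point \<open>p\<close>; since the form is tensorial the choice is
  immaterial.\<close>

definition minimal_foliation ::
  "('a, 'e::euclidean_space) mfd \<Rightarrow> 'a metric \<Rightarrow> ('a vfield \<Rightarrow> 'a vfield \<Rightarrow> 'a vfield) \<Rightarrow>
     'a distribution \<Rightarrow> bool" where
  "minimal_foliation M g nabla \<V> \<longleftrightarrow>
     (\<forall>p\<in>topspace (mtop M). \<forall>(n::nat) W.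
        (\<forall>i<n. W i \<in> sections M \<V>) \<and>
        (\<forall>i<n. \<forall>j<n. g p (W i p) (W j p) = (if i = j then 1 else 0)) \<and>
        span ((\<lambda>i. W i p) ` {..<n}) = \<V> p
        \<longrightarrow> (\<Sum>i<n. vertical_sff M g nabla \<V> (W i) (W i) p) = 0)"


section \<open>Semisimple Lie algebras\<close>

text \<open>A Lie algebra is given as a subspace \<open>L\<close> of a real vector space with its bracket \<open>br\<close>.
  Semisimple: the zero ideal is the only solvable ideal.\<close>

definition lie_ideal ::
  "('v::real_vector \<Rightarrow> 'v \<Rightarrow> 'v) \<Rightarrow> 'v set \<Rightarrow> 'v set \<Rightarrow> bool" where
  "lie_ideal br L I \<longleftrightarrow> subspace I \<and> I \<subseteq> L \<and> (\<forall>x\<in>L. \<forall>y\<in>I. br x y \<in> I)"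

primrec derived_series ::
  "('v::real_vector \<Rightarrow> 'v \<Rightarrow> 'v) \<Rightarrow> 'v set \<Rightarrow> nat \<Rightarrow> 'v set" where
  "derived_series br L 0 = L"
| "derived_series br L (Suc n) =
     span {br x y | x y. x \<in> derived_series br L n \<and> y \<in> derived_series br L n}"

definition solvable_lie_algebra :: "('v::real_vector \<Rightarrow> 'v \<Rightarrow> 'v) \<Rightarrow> 'v set \<Rightarrow> bool" where
  "solvable_lie_algebra br L \<longleftrightarrow> (\<exists>n. derived_series br L n = {0})"

definition semisimple_lie_algebra :: "('v::real_vector \<Rightarrow> 'v \<Rightarrow> 'v) \<Rightarrow> 'v set \<Rightarrow> bool" where
  "semisimple_lie_algebra br L \<longleftrightarrow>
     (\<forall>I. lie_ideal br L I \<and> solvable_lie_algebra br I \<longrightarrow> I = {0})"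


section \<open>Lie groups\<close>

definition lie_group ::
  "('a, 'b) monoid_scheme \<Rightarrow> ('a, 'e::euclidean_space) mfd \<Rightarrow> bool" where
  "lie_group G M \<longleftrightarrow>
     group G \<and> smooth_manifold M \<and> topspace (mtop M) = carrier G \<and>
     smooth_map (prod_mfd M M) M (\<lambda>(x, y). x \<otimes>\<^bsub>G\<^esub> y) \<and>
     smooth_map M M (\<lambda>x. inv\<^bsub>G\<^esub> x)"

definition left_invariant_metric ::
  "('a, 'b) monoid_scheme \<Rightarrow> ('a, 'e::euclidean_space) mfd \<Rightarrow> 'a metric \<Rightarrow> bool" where
  "left_invariant_metric G M g \<longleftrightarrow>
     (\<forall>a\<in>carrier G. \<forall>p\<in>carrier G. \<forall>u\<in>tangent_space M p. \<forall>v\<in>tangent_space M p.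
        g (a \<otimes>\<^bsub>G\<^esub> p) (pushforward M (\<lambda>x. a \<otimes>\<^bsub>G\<^esub> x) u) (pushforward M (\<lambda>x. a \<otimes>\<^bsub>G\<^esub> x) v)
          = g p u v)"

definition riemannian_lie_group ::
  "('a, 'b) monoid_scheme \<Rightarrow> ('a, 'e::euclidean_space) mfd \<Rightarrow> 'a metric \<Rightarrow> bool" where
  "riemannian_lie_group G M g \<longleftrightarrow>
     lie_group G M \<and> riemannian_metric M g \<and> left_invariant_metric G M g"

text \<open>The Lie algebra of left-invariant vector fields.\<close>

definition lie_algebra ::
  "('a, 'b) monoid_scheme \<Rightarrow> ('a, 'e::euclidean_space) mfd \<Rightarrow> 'a vfield set" where
  "lie_algebra G M =
     {X \<in> vector_fields M. \<forall>a\<in>carrier G. \<forall>p\<in>carrier G.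
        X (a \<otimes>\<^bsub>G\<^esub> p) = pushforward M (\<lambda>x. a \<otimes>\<^bsub>G\<^esub> x) (X p)}"

text \<open>A Lie subgroup (not necessarily closed) is a subgroup \<open>K\<close> with a manifold structure \<open>N\<close> of
  its own that makes it a Lie group and the inclusion an immersion; the topology of \<open>N\<close> may be
  finer than the subspace topology.\<close>

definition lie_subgroup ::
  "'a set \<Rightarrow> ('a, 'd::euclidean_space) mfd \<Rightarrow>
     ('a, 'b) monoid_scheme \<Rightarrow> ('a, 'e::euclidean_space) mfd \<Rightarrow> bool" where
  "lie_subgroup K N G M \<longleftrightarrow>
     subgroup K G \<and> lie_group (G\<lparr>carrier := K\<rparr>) N \<and> immersion N M (\<lambda>x. x)"

text \<open>The tangent space of the subgroup \<open>N\<close> at the identity, inside that of \<open>M\<close>.\<close>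

definition subgroup_tangent ::
  "('a, 'd::euclidean_space) mfd \<Rightarrow>
     ('a, 'b) monoid_scheme \<Rightarrow> ('a, 'e::euclidean_space) mfd \<Rightarrow> 'a tvector set" where
  "subgroup_tangent N G M = pushforward M (\<lambda>x. x) ` tangent_space N \<one>\<^bsub>G\<^esub>"

definition subgroup_lie_algebra ::
  "('a, 'd::euclidean_space) mfd \<Rightarrow>
     ('a, 'b) monoid_scheme \<Rightarrow> ('a, 'e::euclidean_space) mfd \<Rightarrow> 'a vfield set" where
  "subgroup_lie_algebra N G M = {X \<in> lie_algebra G M. X \<one>\<^bsub>G\<^esub> \<in> subgroup_tangent N G M}"

definition generated_distribution ::
  "('a, 'd::euclidean_space) mfd \<Rightarrow>
     ('a, 'b) monoid_scheme \<Rightarrow> ('a, 'e::euclidean_space) mfd \<Rightarrow> 'a distribution" where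
  "generated_distribution N G M =
     (\<lambda>p. pushforward M (\<lambda>x. p \<otimes>\<^bsub>G\<^esub> x) ` subgroup_tangent N G M)"

end

theory Submission
  imports Defs "Jordan_Normal_Form.Jordan_Normal_Form_Existence"
begin

hide_const (open) VectorSpace.subspace

text \<open>
  Let \<open>\<kk>\<close> be the Lie algebra of \<open>K\<close>, an ideal of the Lie algebra \<open>\<gg>\<close> of \<open>G\<close>, and let \<open>E\<close> be a
  left-invariant horizontal field and \<open>W\<close> in \<open>\<kk>\<close>. By the Koszul formula
  \<open>g(\<nabla>\<^sub>E E, W) = - g(E, [E, W]) = 0\<close>, since \<open>[E, W]\<close> is vertical; as the foliation is conformal,
  one nonzero \<open>E\<close> suffices to conclude that it is Riemannian. For an orthonormal basis \<open>V\<^sub>i\<close> of \<open>\<kk>\<close>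
  the same formula gives \<open>\<Sum> g(\<nabla>\<^sub>V\<^sub>i V\<^sub>i, E) = tr (ad E | \<kk>)\<close>, the trace of a derivation of a
  semisimple Lie algebra. Cartan's criterion shows that the Killing form is nondegenerate, so
  derivations are inner and inner derivations are traceless.

  That \<open>\<kk>\<close> is an ideal although \<open>K\<close> need not be closed uses second countability of \<open>K\<close>: a curve
  in \<open>G\<close> with values in \<open>K\<close> must return, along some sequence of times, in the topology of \<open>K\<close>, and
  hence is tangent to \<open>\<kk>\<close> there. Bracket-closure of vector fields is read off
  from the torsion-freeness of the given connection.\<close>

section \<open>Derivations in Jordan coordinates\<close>

text \<open>Tangent vectors here are functionals on globally defined smooth functions, and each must
  be exhibited as the velocity of a curve. No cut-off functions are used: sums of tangent vectors
  come from products of curves in the group, single vectors are extended to left-invariant fields,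
  and membership in \<open>\<kk>\<close> is tested against functions that annihilate it. The bracket
  is well behaved only on vector fields, so the algebra is done for a total bilinear product and
  transferred through a projection onto \<open>\<kk>\<close>.

  Cartan's criterion is reached without root spaces. Complex numbers enter only through matrices.
  For x in the derived algebra of the Killing radical, an auxiliary derivation with conjugated
  eigenvalues turns a vanishing trace into \<Sum> |\<lambda>|^2 = 0, so ad x is nilpotent; Engel's
  theorem then makes the radical solvable, and semisimplicity removes it.

  In the minimality part the given vertical fields are orthonormal at one point only and need not be
  left-invariant. The trace vector S is therefore paired with its own left-invariant extension,
  which turns g(S, S) into a trace of ad.\<close>

definition mprod :: "nat \<Rightarrow> (nat \<Rightarrow> nat \<Rightarrow> complex) \<Rightarrow> (nat \<Rightarrow> nat \<Rightarrow> complex) \<Rightarrow> nat \<Rightarrow> nat \<Rightarrow> complex"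
  where "mprod n A B = (\<lambda>i j. \<Sum>k<n. A i k * B k j)"

definition mtrace :: "nat \<Rightarrow> (nat \<Rightarrow> nat \<Rightarrow> complex) \<Rightarrow> complex"
  where "mtrace n A = (\<Sum>i<n. A i i)"

primrec mpow :: "nat \<Rightarrow> (nat \<Rightarrow> nat \<Rightarrow> complex) \<Rightarrow> nat \<Rightarrow> nat \<Rightarrow> nat \<Rightarrow> complex" where
  "mpow n A 0 = (\<lambda>i j. of_bool (i = j))"
| "mpow n A (Suc m) = mprod n A (mpow n A m)"

text \<open>Matrices are plain functions with the size \<open>n\<close> passed along. Only the
  summed index is cut off at \<open>n\<close>, so associativity holds for all \<open>i\<close> and
  \<open>j\<close>, while cancelling an identity matrix is done for indices below
  \<open>n\<close>.\<close>

lemma mprod_assoc: "mprod n (mprod n A B) C = mprod n A (mprod n B C)"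
proof (intro ext)
  fix i j
  have "mprod n (mprod n A B) C i j = (\<Sum>k<n. \<Sum>l<n. A i l * B l k * C k j)"
    by (simp add: mprod_def sum_distrib_right)
  also have "\<dots> = (\<Sum>l<n. \<Sum>k<n. A i l * B l k * C k j)"
    by (rule sum.swap)
  also have "\<dots> = mprod n A (mprod n B C) i j"
    by (simp add: mprod_def sum_distrib_left mult.assoc)
  finally show "mprod n (mprod n A B) C i j = mprod n A (mprod n B C) i j" .
qed

lemma mtrace_mprod_commute: "mtrace n (mprod n A B) = mtrace n (mprod n B A)"
  unfolding mtrace_def mprod_def
  by (subst sum.swap) (simp add: mult.commute)

lemma mprod_cong:
  "(\<And>k. k < n \<Longrightarrow> A i k = A' i k) \<Longrightarrow> (\<And>k. k < n \<Longrightarrow> B k j = B' k j) \<Longrightarrow>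
    mprod n A B i j = mprod n A' B' i j"
  by (simp add: mprod_def)

lemma sum_of_bool_mult:
  fixes f :: "nat \<Rightarrow> 'a::comm_ring_1"
  assumes "i < n"
  shows "(\<Sum>k<n. of_bool (i = k) * f k) = f i" "(\<Sum>k<n. f k * of_bool (k = i)) = f i"
    "(\<Sum>k<n. of_bool (k = i) * f k) = f i" "(\<Sum>k<n. f k * of_bool (i = k)) = f i"
proof -
  have "(\<Sum>k<n. of_bool (i = k) * f k) = (\<Sum>k<n. if i = k then f k else 0)"
    by (rule sum.cong) auto
  then show *: "(\<Sum>k<n. of_bool (i = k) * f k) = f i"
    using assms by (simp add: sum.delta')
  have e: "of_bool (k = i) = (of_bool (i = k) :: 'a)" for k by auto
  show "(\<Sum>k<n. f k * of_bool (k = i)) = f i" "(\<Sum>k<n. of_bool (k = i) * f k) = f i"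
    "(\<Sum>k<n. f k * of_bool (i = k)) = f i"
    using * by (simp_all only: e mult.commute[of "f _"])
qed

lemma mprod_of_bool:
  assumes "i < n" "j < n"
  shows "(\<And>k. k < n \<Longrightarrow> A i k = of_bool (i = k)) \<Longrightarrow> mprod n A B i j = B i j"
    and "(\<And>k. k < n \<Longrightarrow> B k j = of_bool (k = j)) \<Longrightarrow> mprod n A B i j = A i j"
  using assms by (simp_all add: mprod_def sum_of_bool_mult)

section \<open>Jordan form over the complex numbers\<close>

lemma jordan_matrix_entry:
  fixes n_as :: "(nat \<times> complex) list"
  assumes "i < sum_list (map fst n_as)" "j < sum_list (map fst n_as)"
    and "jordan_matrix n_as $$ (i, j) \<noteq> 0"
  shows "i \<le> j \<and> jordan_matrix n_as $$ (i, i) = jordan_matrix n_as $$ (j, j)"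
  using assms
proof (induction n_as arbitrary: i j)
  case (Cons na n_as)
  obtain m a where na: "na = (m, a)" by force
  let ?s = "sum_list (map fst n_as)"
  have dims: "i < m + ?s" "j < m + ?s" using Cons.prems by (auto simp: na)
  have ent: "jordan_matrix (na # n_as) $$ (i', j') =
      (if i' < m then if j' < m then jordan_block m a $$ (i', j') else 0
       else if j' < m then 0 else jordan_matrix n_as $$ (i' - m, j' - m))"
    if "i' < m + ?s" "j' < m + ?s" for i' j'
    using that unfolding na jordan_matrix_Cons by (auto simp: less_diff_conv2)
  show ?case
  proof (cases "i < m")
    case True
    then have "j < m" using Cons.prems(3) dims by (simp add: ent split: if_splits)
    then show ?thesis
      using True Cons.prems(3) dims by (auto simp: ent split: if_splits)
  next
    case False
    then have j: "\<not> j < m" using Cons.prems(3) dims by (simp add: ent split: if_splits)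
    have "i - m \<le> j - m \<and> jordan_matrix n_as $$ (i - m, i - m) = jordan_matrix n_as $$ (j - m, j - m)"
      using False j Cons.prems(3) dims by (intro Cons.IH) (auto simp: ent)
    then show ?thesis using False j dims by (auto simp: ent)
  qed
qed simp

text \<open>The characteristic polynomial splits over the complex numbers. Of the Jordan form only
  its shape is kept: the triangular order drives the induction in \<open>jordan_weights\<close>, and
  the equality of coupled diagonal values expresses that the blocks respect generalised
  eigenspaces.\<close>

lemma jordan_basis:
  fixes A :: "nat \<Rightarrow> nat \<Rightarrow> complex"
  obtains P Q J where
    "\<And>i j. i < n \<Longrightarrow> j < n \<Longrightarrow> mprod n P Q i j = of_bool (i = j)"
    "\<And>i j. i < n \<Longrightarrow> j < n \<Longrightarrow> mprod n Q P i j = of_bool (i = j)"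
    "\<And>i j. i < n \<Longrightarrow> j < n \<Longrightarrow> A i j = mprod n P (mprod n J Q) i j"
    "\<And>i j. i < n \<Longrightarrow> j < n \<Longrightarrow> J i j \<noteq> 0 \<Longrightarrow> i \<le> j \<and> J i i = J j j"
proof -
  let ?A = "mat n n (\<lambda>(i, j). A i j)"
  have A: "?A \<in> carrier_mat n n" by simp
  obtain as where "char_poly ?A = (\<Prod>a\<leftarrow>as. [:- a, 1:])"
    using char_poly_factorized[OF A] by blast
  then obtain n_as where "jordan_nf ?A n_as"
    using jordan_nf_exists[OF A] by blast
  then obtain P Q where w: "similar_mat_wit ?A (jordan_matrix n_as) P Q"
    unfolding jordan_nf_def similar_mat_def by blast
  let ?J = "jordan_matrix n_as"
  from w have c: "?J \<in> carrier_mat n n" "P \<in> carrier_mat n n" "Q \<in> carrier_mat n n"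
    and PQ: "P * Q = 1\<^sub>m n" and QP: "Q * P = 1\<^sub>m n" and eq: "?A = P * ?J * Q"
    unfolding similar_mat_wit_def Let_def by auto
  have n: "sum_list (map fst n_as) = n"
    using c(1) by (metis carrier_matD(1) jordan_matrix_dim(1))
  have mult: "(X * Y) $$ (i, j) = mprod n (\<lambda>i j. X $$ (i, j)) (\<lambda>i j. Y $$ (i, j)) i j"
    if "X \<in> carrier_mat n n" "Y \<in> carrier_mat n n" "i < n" "j < n" for X Y :: "complex mat" and i j
    using that by (auto simp: mprod_def scalar_prod_def atLeast0LessThan)
  show thesis
  proof
    fix i j assume ij: "i < n" "j < n"
    show "mprod n (\<lambda>i j. P $$ (i, j)) (\<lambda>i j. Q $$ (i, j)) i j = of_bool (i = j)"
      using mult[OF c(2,3) ij] unfolding PQ using ij by (simp add: of_bool_def)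
    show "mprod n (\<lambda>i j. Q $$ (i, j)) (\<lambda>i j. P $$ (i, j)) i j = of_bool (i = j)"
      using mult[OF c(3,2) ij] unfolding QP using ij by (simp add: of_bool_def)
    have "P * ?J * Q = P * (?J * Q)"
      using c by (intro assoc_mult_mat) auto
    then have "A i j = (P * (?J * Q)) $$ (i, j)"
      using eq ij by (metis (no_types, lifting) index_mat(1) old.prod.case)
    also have "\<dots> = mprod n (\<lambda>i j. P $$ (i, j)) (\<lambda>i j. (?J * Q) $$ (i, j)) i j"
      using c ij by (intro mult) auto
    also have "\<dots> = mprod n (\<lambda>i j. P $$ (i, j)) (mprod n (\<lambda>i j. ?J $$ (i, j)) (\<lambda>i j. Q $$ (i, j))) i j"
      using mult[OF c(1,3)] ij by (intro mprod_cong) auto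
    finally show "A i j = \<dots>" .
    show "i \<le> j \<and> ?J $$ (i, i) = ?J $$ (j, j)" if "?J $$ (i, j) \<noteq> 0"
      using jordan_matrix_entry[of i n_as j] that ij n by simp
  qed
qed

text \<open>With \<open>c i j k\<close> the structure constants of a bilinear product, \<open>sderiv n c A\<close> says
  that \<open>A\<close> is a derivation: \<open>A (e i * e j) - e i * A (e j) = A (e i) * e j\<close>.\<close>

definition sderiv :: "nat \<Rightarrow> (nat \<Rightarrow> nat \<Rightarrow> nat \<Rightarrow> complex) \<Rightarrow> (nat \<Rightarrow> nat \<Rightarrow> complex) \<Rightarrow> bool" where
  "sderiv n c A \<longleftrightarrow> (\<forall>i<n. \<forall>j<n. \<forall>k<n.
     (\<Sum>m<n. A k m * c i j m) - (\<Sum>m<n. c i m k * A m j) = (\<Sum>m<n. A m i * c m j k))"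

text \<open>Structure constants in the basis given by the columns of \<open>P\<close>, with
  \<open>Q\<close> in the role of its inverse. For fixed \<open>i\<close>,
  \<open>\<lambda>k j. c i j k\<close> is the matrix of left multiplication by the i-th basis
  vector: these two slots are conjugated, and the first index is transformed by
  \<open>P\<close>.\<close>

definition basis_change where
  "basis_change n P Q (c :: nat \<Rightarrow> nat \<Rightarrow> nat \<Rightarrow> complex) =
     (\<lambda>i j k. \<Sum>a<n. P a i * mprod n Q (mprod n (\<lambda>k j. c a j k) P) k j)"

text \<open>The derivation rule as a commutator identity [A, L_x] = L_(A x) for left multiplications
  L_x, the form to which matrix calculus applies.\<close>

lemma sderiv_mprod:
  "sderiv n c A \<longleftrightarrow> (\<forall>i<n. \<forall>j<n. \<forall>k<n.
     mprod n A (\<lambda>k j. c i j k) k j - mprod n (\<lambda>k j. c i j k) A k j = (\<Sum>m<n. A m i * c m j k))"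
  by (simp add: sderiv_def mprod_def)

section \<open>Change of basis for derivations\<close>

lemma mprod_cancel:
  assumes "\<And>i j. i < n \<Longrightarrow> j < n \<Longrightarrow> mprod n P Q i j = of_bool (i = j)"
  shows "mprod n X (mprod n P (mprod n Q Y)) = mprod n X Y"
proof (intro ext)
  fix i j
  have "mprod n (mprod n P Q) Y k j = Y k j" if "k < n" for k
    using that assms by (simp add: mprod_def[of n "mprod n P Q"] sum_of_bool_mult)
  then show "mprod n X (mprod n P (mprod n Q Y)) i j = mprod n X Y i j"
    unfolding mprod_assoc[symmetric, of n P Q Y] by (intro mprod_cong) auto
qed

lemma mprod_sum:
  "mprod n A (\<lambda>k j. \<Sum>a\<in>S. f a * B a k j) k j = (\<Sum>a\<in>S. f a * mprod n A (B a) k j)"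
  "mprod n (\<lambda>k j. \<Sum>a\<in>S. f a * B a k j) A k j = (\<Sum>a\<in>S. f a * mprod n (B a) A k j)"
  by (simp_all add: mprod_def sum_distrib_left sum_distrib_right mult_ac sum.swap[of _ S])

lemma mtrace_mprod_sum:
  "mtrace n (mprod n A (\<lambda>k j. \<Sum>a\<in>S. f a * B a k j)) = (\<Sum>a\<in>S. f a * mtrace n (mprod n A (B a)))"
  unfolding mtrace_def mprod_sum sum_distrib_left by (rule sum.swap)

lemma mprod_diff:
  "mprod n A (\<lambda>k j. B k j - C k j) k j = mprod n A B k j - mprod n A C k j"
  "mprod n (\<lambda>k j. B k j - C k j) A k j = mprod n B A k j - mprod n C A k j"
  by (simp_all add: mprod_def right_diff_distrib left_diff_distrib sum_subtractf)

lemma basis_change_inverse: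
  assumes "\<And>i j. i < n \<Longrightarrow> j < n \<Longrightarrow> mprod n P Q i j = of_bool (i = j)"
    and ijk: "i < n" "j < n" "k < n"
  shows "basis_change n Q P (basis_change n P Q c) i j k = c i j k"
proof -
  have inner: "mprod n P (mprod n (\<lambda>k j. basis_change n P Q c a j k) Q) k j =
      (\<Sum>b<n. P b a * c b j k)" for a
  proof -
    have "mprod n (\<lambda>k j. basis_change n P Q c a j k) Q =
      (\<lambda>k j. \<Sum>b<n. P b a * mprod n (mprod n Q (mprod n (\<lambda>k j. c b j k) P)) Q k j)"
      unfolding basis_change_def by (intro ext mprod_sum(2))
    then have "mprod n P (mprod n (\<lambda>k j. basis_change n P Q c a j k) Q) k j =
      (\<Sum>b<n. P b a * mprod n P (mprod n (mprod n Q (mprod n (\<lambda>k j. c b j k) P)) Q) k j)"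
      by (simp only: mprod_sum(1))
    also have "\<dots> = (\<Sum>b<n. P b a * c b j k)"
    proof (rule sum.cong[OF refl])
      fix b
      let ?C = "\<lambda>k j. c b j k"
      have "mprod n P (mprod n (mprod n Q (mprod n ?C P)) Q) k j =
          mprod n (mprod n P Q) (mprod n ?C (mprod n P Q)) k j"
        by (simp only: mprod_assoc)
      also have "\<dots> = mprod n ?C (mprod n P Q) k j"
        by (rule mprod_of_bool(1)) (use assms in auto)
      also have "\<dots> = ?C k j"
        by (rule mprod_of_bool(2)) (use assms in auto)
      finally show "P b a * mprod n P (mprod n (mprod n Q (mprod n ?C P)) Q) k j = P b a * c b j k"
        by simp
    qed
    finally show ?thesis .
  qed
  have "basis_change n Q P (basis_change n P Q c) i j k = (\<Sum>a<n. Q a i * (\<Sum>b<n. P b a * c b j k))"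
    unfolding basis_change_def[of n Q P] inner ..
  also have "\<dots> = (\<Sum>b<n. mprod n P Q b i * c b j k)"
    unfolding mprod_def sum_distrib_left sum_distrib_right
    by (subst sum.swap) (simp add: mult_ac)
  also have "\<dots> = c i j k"
    using ijk assms by (simp add: sum_of_bool_mult)
  finally show ?thesis .
qed

text \<open>\<open>A\<close> and \<open>J\<close> are related only by A P = P J and J Q = Q A, so
  the lemma serves in both directions: from a derivation to its Jordan form, and from the conjugated
  diagonal matrix back to the original basis.\<close>

lemma sderiv_basis_change:
  assumes "sderiv n c A"
    and AP: "\<And>i j. i < n \<Longrightarrow> j < n \<Longrightarrow> mprod n A P i j = mprod n P J i j"
    and JQ: "\<And>i j. i < n \<Longrightarrow> j < n \<Longrightarrow> mprod n J Q i j = mprod n Q A i j"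
  shows "sderiv n (basis_change n P Q c) J"
  unfolding sderiv_mprod
proof (intro allI impI)
  fix i j k assume ijk: "i < n" "j < n" "k < n"
  let ?C = "\<lambda>a k j. c a j k"
  have JQ': "mprod n J (mprod n Q X) k j = mprod n Q (mprod n A X) k j" for X
    unfolding mprod_assoc[symmetric] by (rule mprod_cong) (use JQ ijk in auto)
  have l: "mprod n J (\<lambda>k j. basis_change n P Q c i j k) k j =
      (\<Sum>a<n. P a i * mprod n Q (mprod n A (mprod n (?C a) P)) k j)"
    unfolding basis_change_def mprod_sum JQ' ..
  have AP': "mprod n X (mprod n P J) k j = mprod n X (mprod n A P) k j" for X
    by (rule mprod_cong) (use AP ijk in auto)
  have r: "mprod n (\<lambda>k j. basis_change n P Q c i j k) J k j =
      (\<Sum>a<n. P a i * mprod n Q (mprod n (?C a) (mprod n A P)) k j)"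
    unfolding basis_change_def mprod_sum mprod_assoc[symmetric]
    unfolding mprod_assoc[of n _ P J] AP' unfolding mprod_assoc ..
  have d: "mprod n Q (mprod n A (mprod n (?C a) P)) k j - mprod n Q (mprod n (?C a) (mprod n A P)) k j
      = (\<Sum>m<n. A m a * mprod n Q (mprod n (?C m) P) k j)" if a: "a < n" for a
  proof -
    have "mprod n Q (mprod n A (mprod n (?C a) P)) k j - mprod n Q (mprod n (?C a) (mprod n A P)) k j
      = mprod n Q (mprod n (\<lambda>k j. mprod n A (?C a) k j - mprod n (?C a) A k j) P) k j"
    proof -
      have "mprod n (\<lambda>k j. mprod n A (?C a) k j - mprod n (?C a) A k j) P =
          (\<lambda>k j. mprod n A (mprod n (?C a) P) k j - mprod n (?C a) (mprod n A P) k j)"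
        unfolding mprod_diff mprod_assoc ..
      then show ?thesis by (simp only: mprod_diff(1))
    qed
    also have "\<dots> = mprod n Q (mprod n (\<lambda>k j. \<Sum>m<n. A m a * ?C m k j) P) k j"
      using assms(1) a ijk unfolding sderiv_mprod by (intro mprod_cong) auto
    also have "\<dots> = (\<Sum>m<n. A m a * mprod n Q (mprod n (?C m) P) k j)"
      unfolding mprod_sum ..
    finally show ?thesis .
  qed
  have "mprod n J (\<lambda>k j. basis_change n P Q c i j k) k j -
      mprod n (\<lambda>k j. basis_change n P Q c i j k) J k j =
      (\<Sum>a<n. P a i * (\<Sum>m<n. A m a * mprod n Q (mprod n (?C m) P) k j))"
    unfolding l r sum_subtractf[symmetric] right_diff_distrib[symmetric]
    by (intro sum.cong refl) (simp add: d)
  also have "\<dots> = (\<Sum>m<n. mprod n A P m i * mprod n Q (mprod n (?C m) P) k j)"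
    unfolding mprod_def[of n A P] sum_distrib_left sum_distrib_right
    by (subst sum.swap) (simp add: mult_ac)
  also have "\<dots> = (\<Sum>m<n. mprod n P J m i * mprod n Q (mprod n (?C m) P) k j)"
    using AP ijk by simp
  also have "\<dots> = (\<Sum>a<n. J a i * (\<Sum>m<n. P m a * mprod n Q (mprod n (?C m) P) k j))"
    unfolding mprod_def[of n P J] sum_distrib_left sum_distrib_right
    by (subst sum.swap) (simp add: mult_ac)
  finally show "mprod n J (\<lambda>k j. basis_change n P Q c i j k) k j -
      mprod n (\<lambda>k j. basis_change n P Q c i j k) J k j = (\<Sum>m<n. J m i * basis_change n P Q c m j k)"
    unfolding basis_change_def .
qed

text \<open>Products of generalised eigenvectors have the sum of the eigenvalues. In the derivation
  rule at (i, j, k) the off-diagonal terms involve constants with smaller i, smaller j or larger k,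
  hence of smaller measure, and with the same diagonal values of \<open>J\<close>. If the weights
  failed to add up, the induction hypothesis would make these terms vanish and leave (J_kk - J_ii -
  J_jj) c_ijk = 0.\<close>

lemma jordan_weights:
  assumes "sderiv n c J"
    and J: "\<And>i j. i < n \<Longrightarrow> j < n \<Longrightarrow> J i j \<noteq> 0 \<Longrightarrow> i \<le> j \<and> J i i = J j j"
    and "i < n" "j < n" "k < n" "c i j k \<noteq> 0"
  shows "J k k = J i i + J j j"
  using assms(3-6)
proof (induction "i + j + (n - k)" arbitrary: i j k rule: less_induct)
  case less
  show ?case
  proof (rule ccontr)
    assume ne: "J k k \<noteq> J i i + J j j"
    have a: "J k m * c i j m = (if m = k then J k k * c i j k else 0)" if "m < n" for m
    proof (cases "m = k \<or> J k m = 0")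
      case False
      then have "k < m" "J k k = J m m" using J[of k m] that less.prems by auto
      then have "\<not> c i j m \<noteq> 0"
        using less.hyps[OF _ less.prems(1,2) that] ne that by (auto simp: diff_less_mono2)
      then show ?thesis using False by simp
    qed auto
    have b: "c i m k * J m j = (if m = j then c i j k * J j j else 0)" if "m < n" for m
    proof (cases "m = j \<or> J m j = 0")
      case False
      then have "m < j" "J m m = J j j" using J[of m j] that less.prems by auto
      then have "\<not> c i m k \<noteq> 0"
        using less.hyps[OF _ less.prems(1) that less.prems(3)] ne by auto
      then show ?thesis using False by simp
    qed auto
    have d: "J m i * c m j k = (if m = i then J i i * c i j k else 0)" if "m < n" for m
    proof (cases "m = i \<or> J m i = 0")
      case False
      then have "m < i" "J m m = J i i" using J[of m i] that less.prems by auto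
      then have "\<not> c m j k \<noteq> 0"
        using less.hyps[OF _ that less.prems(2,3)] ne by auto
      then show ?thesis using False by simp
    qed auto
    have "(\<Sum>m<n. J k m * c i j m) - (\<Sum>m<n. c i m k * J m j) = (\<Sum>m<n. J m i * c m j k)"
      using assms(1) less.prems unfolding sderiv_def by blast
    then have "J k k * c i j k - c i j k * J j j = J i i * c i j k"
    proof -
      have "(\<Sum>m<n. J k m * c i j m) = (\<Sum>m<n. if m = k then J k k * c i j k else 0)"
        by (intro sum.cong refl a) auto
      moreover have "(\<Sum>m<n. c i m k * J m j) = (\<Sum>m<n. if m = j then c i j k * J j j else 0)"
        by (intro sum.cong refl b) auto
      moreover have "(\<Sum>m<n. J m i * c m j k) = (\<Sum>m<n. if m = i then J i i * c i j k else 0)"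
        by (intro sum.cong refl d) auto
      ultimately show ?thesis
        using \<open>_ = (\<Sum>m<n. J m i * c m j k)\<close> less.prems(1-3) by simp
    qed
    then have "(J k k - J j j - J i i) * c i j k = 0"
      by (simp add: algebra_simps)
    then show False using ne less.prems by (auto simp: diff_eq_eq add.commute)
  qed
qed

lemma mpow_strict_upper:
  assumes J: "\<And>i j. i < n \<Longrightarrow> j < n \<Longrightarrow> J i j \<noteq> 0 \<Longrightarrow> i < j"
    and "i < n" "j < n" "j < i + m"
  shows "mpow n J m i j = 0"
  using assms(2-)
proof (induction m arbitrary: i)
  case (Suc m)
  have "J i k * mpow n J m k j = 0" if "k < n" for k
    using Suc J[of i k] that by (cases "J i k = 0") auto
  then have "mprod n J (mpow n J m) i j = 0"
    unfolding mprod_def by (intro sum.neutral) auto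
  then show ?case by simp
qed simp

text \<open>The semisimple part of a derivation \<open>A\<close>, with its eigenvalues replaced by
  their complex conjugates, is again a derivation \<open>D\<close>, and
  \<open>tr (A D) = \<Sum> \<bar>\<lambda>\<bar>\<^sup>2\<close>.\<close>

lemma conjugate_derivation:
  assumes "sderiv n c A"
  obtains D where "sderiv n c D"
    and "mtrace n (mprod n A D) = 0 \<Longrightarrow> \<forall>i<n. \<forall>j<n. mpow n A n i j = 0"
proof -
  obtain P Q J where PQ: "\<And>i j. i < n \<Longrightarrow> j < n \<Longrightarrow> mprod n P Q i j = of_bool (i = j)"
    and QP: "\<And>i j. i < n \<Longrightarrow> j < n \<Longrightarrow> mprod n Q P i j = of_bool (i = j)"
    and A: "\<And>i j. i < n \<Longrightarrow> j < n \<Longrightarrow> A i j = mprod n P (mprod n J Q) i j"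
    and J: "\<And>i j. i < n \<Longrightarrow> j < n \<Longrightarrow> J i j \<noteq> 0 \<Longrightarrow> i \<le> j \<and> J i i = J j j"
    using jordan_basis[of n A] by blast
  let ?c = "basis_change n P Q c"
  let ?E = "\<lambda>i j. if i = j then cnj (J i i) else 0"
  define D where "D = mprod n P (mprod n ?E Q)"
  have AP: "mprod n A P i j = mprod n P J i j" if "i < n" "j < n" for i j
  proof -
    have "mprod n A P i j = mprod n (mprod n P (mprod n J Q)) P i j"
      using A that by (intro mprod_cong) auto
    also have "\<dots> = mprod n (mprod n P J) (mprod n Q P) i j"
      by (simp only: mprod_assoc)
    also have "\<dots> = mprod n P J i j"
      using QP that by (intro mprod_of_bool) auto
    finally show ?thesis .
  qed
  have JQ: "mprod n J Q i j = mprod n Q A i j" if "i < n" "j < n" for i j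
  proof -
    have "mprod n Q A i j = mprod n Q (mprod n P (mprod n J Q)) i j"
      using A that by (intro mprod_cong) auto
    also have "\<dots> = mprod n (mprod n Q P) (mprod n J Q) i j"
      by (simp only: mprod_assoc)
    also have "\<dots> = mprod n J Q i j"
      using QP that by (intro mprod_of_bool) auto
    finally show ?thesis by simp
  qed
  have "sderiv n ?c J"
    using sderiv_basis_change[OF assms AP JQ] .
  then have w: "J k k = J i i + J j j" if "i < n" "j < n" "k < n" "?c i j k \<noteq> 0" for i j k
    using jordan_weights[of n ?c J] J that by blast
  have "sderiv n ?c ?E"
    unfolding sderiv_def
  proof (intro allI impI)
    fix i j k assume ijk: "i < n" "j < n" "k < n"
    have "(\<Sum>m<n. ?E k m * ?c i j m) = cnj (J k k) * ?c i j k"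
      using ijk by (simp add: if_distrib[of "\<lambda>x. x * _"] cong: if_cong)
    moreover have "(\<Sum>m<n. ?c i m k * ?E m j) = ?c i j k * cnj (J j j)"
      using ijk by (simp add: if_distrib[of "\<lambda>x. _ * x"] cong: if_cong)
    moreover have "(\<Sum>m<n. ?E m i * ?c m j k) = cnj (J i i) * ?c i j k"
      using ijk by (simp add: if_distrib[of "\<lambda>x. x * _"] cong: if_cong)
    \<comment> \<open>Conjugation is additive, so the weight relation survives it; where the
      structure constant is zero both sides vanish.\<close>
    ultimately show "(\<Sum>m<n. ?E k m * ?c i j m) - (\<Sum>m<n. ?c i m k * ?E m j) = (\<Sum>m<n. ?E m i * ?c m j k)"
      using w[OF ijk] by (cases "?c i j k = 0") (auto simp: algebra_simps)
  qed
  then have "sderiv n (basis_change n Q P ?c) D"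
  proof (rule sderiv_basis_change)
    fix i j assume ij: "i < n" "j < n"
    show "mprod n ?E Q i j = mprod n Q D i j"
      unfolding D_def mprod_assoc[symmetric, of n Q P]
      using QP ij by (intro mprod_of_bool(1)[symmetric]) auto
    have "mprod n D P i j = mprod n (mprod n P ?E) (mprod n Q P) i j"
      unfolding D_def by (simp only: mprod_assoc)
    also have "\<dots> = mprod n P ?E i j"
      using QP ij by (intro mprod_of_bool(2)) auto
    finally show "mprod n D P i j = mprod n P ?E i j" .
  qed
  then have 1: "sderiv n c D"
    unfolding sderiv_def by (simp add: basis_change_inverse[OF PQ])
  have tr: "mtrace n (mprod n A D) = (\<Sum>i<n. J i i * cnj (J i i))"
  proof -
    have "mtrace n (mprod n A D) = mtrace n (mprod n (mprod n P (mprod n J Q)) D)"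
      unfolding mtrace_def using A by (intro sum.cong refl mprod_cong) auto
    also have "\<dots> = mtrace n (mprod n P (mprod n J (mprod n ?E Q)))"
      using mprod_cancel[of n Q P, OF QP] by (simp only: D_def mprod_assoc)
    also have "\<dots> = mtrace n (mprod n (mprod n J (mprod n ?E Q)) P)"
      by (rule mtrace_mprod_commute)
    also have "\<dots> = mtrace n (mprod n (mprod n J ?E) (mprod n Q P))"
      by (simp only: mprod_assoc)
    also have "\<dots> = mtrace n (mprod n J ?E)"
      unfolding mtrace_def using QP by (intro sum.cong refl mprod_of_bool(2)) auto
    also have "\<dots> = (\<Sum>i<n. J i i * cnj (J i i))"
      unfolding mtrace_def mprod_def
      by (intro sum.cong refl) (simp add: if_distrib[of "\<lambda>x. _ * x"] cong: if_cong)
    finally show ?thesis .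
  qed
  have 2: "mpow n A n i j = 0" if tr0: "mtrace n (mprod n A D) = 0" and ij: "i < n" "j < n" for i j
  proof -
    \<comment> \<open>The trace is the sum of the squared moduli of the eigenvalues. Once it
      vanishes all eigenvalues do, and the Jordan form is strictly upper triangular.\<close>
    have "complex_of_real (\<Sum>i<n. (cmod (J i i))\<^sup>2) = 0"
      using tr0 unfolding tr by (simp add: complex_norm_square[symmetric])
    then have "(\<Sum>i<n. (cmod (J i i))\<^sup>2) = 0"
      by (simp only: of_real_eq_0_iff)
    then have "\<forall>i\<in>{..<n}. (cmod (J i i))\<^sup>2 = 0"
      by (subst (asm) sum_nonneg_eq_0_iff) auto
    then have J0: "J i i = 0" if "i < n" for i using that by auto
    have strict: "k < l" if "k < n" "l < n" "J k l \<noteq> 0" for k l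
      using J[OF that] that J0[of k] by (cases "k = l") auto
    have "mpow n A m i j = mprod n P (mprod n (mpow n J m) Q) i j" if "i < n" for i m
      using that
    proof (induction m arbitrary: i)
      case 0
      have "mprod n (mpow n J 0) Q k j = Q k j" if "k < n" for k
        using that by (simp add: mprod_def sum_of_bool_mult)
      then have "mprod n P (mprod n (mpow n J 0) Q) i j = mprod n P Q i j"
        by (intro mprod_cong) auto
      then show ?case using PQ 0 ij by simp
    next
      case (Suc m)
      have "mpow n A (Suc m) i j = mprod n (mprod n P (mprod n J Q)) (mprod n P (mprod n (mpow n J m) Q)) i j"
        using Suc A by (auto intro!: mprod_cong)
      then show ?case
        by (simp add: mprod_assoc mprod_cancel[OF QP])
    qed
    then have "mpow n A n i j = mprod n P (mprod n (mpow n J n) Q) i j" using ij by blast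
    moreover have "mprod n (mpow n J n) Q k j = 0" if "k < n" for k
      unfolding mprod_def using mpow_strict_upper[of n J k _ n, OF strict] that by simp
    ultimately show ?thesis by (simp add: mprod_def[of n P])
  qed
  show thesis by (rule that[OF 1]) (use 2 in blast)
qed

section \<open>Killing form\<close>

lemma dim_le_span:
  fixes A :: "'v::real_vector set"
  assumes "A \<subseteq> span F" "finite F"
  shows "dim A \<le> card F"
proof -
  obtain B where "B \<subseteq> A" "independent B" "A \<subseteq> span B" "card B = dim A"
    using real_vector.basis_exists[of A] by metis
  then show ?thesis
    using real_vector.independent_span_bound[of F B] assms by auto
qed

text \<open>The ambient real vector space may have infinite dimension, where \<open>dim\<close> can
  default to 0; the finite set \<open>F\<close> keeps the dimensions meaningful.\<close>

lemma dim_less: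
  fixes A :: "'v::real_vector set"
  assumes "subspace A" "A \<subset> C" "C \<subseteq> span F" "finite F"
  shows "dim A < dim C"
proof -
  obtain B where B: "B \<subseteq> A" "independent B" "A \<subseteq> span B" "card B = dim A"
    using real_vector.basis_exists[of A] by metis
  have spB: "span B = A"
    using B assms(1) by (metis real_vector.span_minimal subset_antisym)
  obtain B' where B': "B \<subseteq> B'" "B' \<subseteq> C" "independent B'" "C \<subseteq> span B'"
    using real_vector.maximal_independent_subset_extend[of B C] B assms(2) by blast
  have fin: "finite B'"
    using real_vector.independent_span_bound[of F B'] B' assms by auto
  have "B \<noteq> B'"
    using spB B' assms(2) by auto
  then have "card B < card B'"
    using fin B' by (simp add: psubset_card_mono psubset_eq)
  moreover have "dim C = card B'"
    using B' real_vector.dim_eq_card[of B' C] by (metis real_vector.span_eq real_vector.span_superset subset_trans)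
  ultimately show ?thesis using B by simp
qed

text \<open>Product and coordinate functionals are total linear maps on the ambient type, with
  products in the span of \<open>b\<close>, so that facts about \<open>linear\<close> apply without
  side conditions. A bracket that behaves well on a subspace only is brought into this form in
  \<open>derivation_trace_zero\<close>.\<close>

locale lie_product =
  fixes br :: "'v::real_vector \<Rightarrow> 'v \<Rightarrow> 'v" and b :: "nat \<Rightarrow> 'v"
    and co :: "nat \<Rightarrow> 'v \<Rightarrow> real" and n :: nat
  assumes linear_br: "linear (br x)"
    and anti: "br x y = - br y x"
    and jacobi: "br x (br y z) = br (br x y) z + br y (br x z)"
    and linear_co: "linear (co i)"
    and co_b: "i < n \<Longrightarrow> j < n \<Longrightarrow> co i (b j) = of_bool (i = j)"
    and br_in: "br x y \<in> span (b ` {..<n})"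
begin

definition "L = span (b ` {..<n})"

lemma subspace_L: "subspace L"
  by (simp add: L_def)

lemma br_L: "br x y \<in> L"
  using br_in by (simp add: L_def)

lemma b_L: "i < n \<Longrightarrow> b i \<in> L"
  by (simp add: L_def real_vector.span_base)

lemma linear_br_left: "linear (\<lambda>x. br x y)"
proof -
  have "(\<lambda>x. br x y) = (\<lambda>x. - br y x)" using anti by blast
  then show ?thesis using linear_compose_neg[OF linear_br[of y]] by simp
qed

lemmas br_simps =
  linear_add[OF linear_br] linear_scale[OF linear_br] linear_0[OF linear_br]
  linear_neg[OF linear_br] linear_diff[OF linear_br]
  linear_add[OF linear_br_left] linear_scale[OF linear_br_left] linear_0[OF linear_br_left]
  linear_neg[OF linear_br_left] linear_diff[OF linear_br_left]

lemma expand: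
  assumes "x \<in> L"
  shows "x = (\<Sum>k<n. co k x *\<^sub>R b k)"
proof -
  have "x \<in> span (b ` {..<n})" using assms by (simp add: L_def)
  then show ?thesis
  proof (induction rule: real_vector.span_induct_alt)
    case base
    show ?case by (simp add: linear_0[OF linear_co])
  next
    case (step c v y)
    obtain i where i: "i < n" "v = b i" using step(1) by auto
    have "(\<Sum>k<n. co k (c *\<^sub>R v + y) *\<^sub>R b k) = (\<Sum>k<n. (c * co k v) *\<^sub>R b k) + (\<Sum>k<n. co k y *\<^sub>R b k)"
      by (simp add: linear_add[OF linear_co] linear_scale[OF linear_co] scaleR_add_left sum.distrib)
    also have "(\<Sum>k<n. (c * co k v) *\<^sub>R b k) = (\<Sum>k<n. if k = i then c *\<^sub>R b i else 0)"
      using i by (intro sum.cong) (auto simp: co_b)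
    finally show ?case using step i by simp
  qed
qed

lemma L_eqI: "x \<in> L \<Longrightarrow> y \<in> L \<Longrightarrow> (\<And>i. i < n \<Longrightarrow> co i x = co i y) \<Longrightarrow> x = y"
proof -
  assume *: "x \<in> L" "y \<in> L" "\<And>i. i < n \<Longrightarrow> co i x = co i y"
  have "x = (\<Sum>k<n. co k x *\<^sub>R b k)" using expand[OF *(1)] .
  also have "\<dots> = (\<Sum>k<n. co k y *\<^sub>R b k)" using *(3) by simp
  also have "\<dots> = y" using expand[OF *(2)] by (rule sym)
  finally show ?thesis .
qed

lemma linear_expand:
  assumes "linear f" "x \<in> L"
  shows "f x = (\<Sum>k<n. co k x *\<^sub>R f (b k))"
proof -
  have "f x = f (\<Sum>k<n. co k x *\<^sub>R b k)" using expand[OF assms(2)] by (rule arg_cong)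
  then show ?thesis using assms(1) by (simp add: linear_sum linear_scale)
qed

lemma linear_eq_0_L:
  assumes "linear f" "\<And>i. i < n \<Longrightarrow> f (b i) = 0" "x \<in> L"
  shows "f x = 0"
  using linear_expand[OF assms(1,3)] assms(2) by simp

definition tr :: "('v \<Rightarrow> 'v) \<Rightarrow> real" where "tr f = (\<Sum>i<n. co i (f (b i)))"

definition "kap x y = tr (\<lambda>z. br x (br y z))"

text \<open>The radical of the Killing form \<open>kap\<close>, not the largest solvable ideal; its
  solvability is the content of \<open>rad_solvable\<close>.\<close>

definition "rad = {x \<in> L. \<forall>y\<in>L. kap x y = 0}"

text \<open>The only place where real maps become complex: the matrix of \<open>f\<close> on
  \<open>L\<close>, whose j-th column holds the coordinates of \<open>f (b j)\<close>.\<close>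

definition mt :: "('v \<Rightarrow> 'v) \<Rightarrow> nat \<Rightarrow> nat \<Rightarrow> complex"
  where "mt f = (\<lambda>k j. complex_of_real (co k (f (b j))))"

definition "sc i j k = complex_of_real (co k (br (b i) (b j)))"

lemma mt_comp:
  assumes "linear f" "g (b j) \<in> L"
  shows "mprod n (mt f) (mt g) i j = mt (\<lambda>x. f (g x)) i j"
  by (simp add: mt_def mprod_def linear_expand[OF assms] linear_sum[OF linear_co]
      linear_scale[OF linear_co] mult.commute)

lemma mtrace_mt: "mtrace n (mt f) = of_real (tr f)"
  by (simp add: mtrace_def mt_def tr_def)

lemma mtrace_cong: "(\<And>i. i < n \<Longrightarrow> A i i = B i i) \<Longrightarrow> mtrace n A = mtrace n B"
  by (simp add: mtrace_def)

section \<open>Traces and invariance of the Killing form\<close>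

lemma tr_commute:
  assumes "linear f" "linear g" "\<And>x. f x \<in> L" "\<And>x. g x \<in> L"
  shows "tr (\<lambda>x. f (g x)) = tr (\<lambda>x. g (f x))"
proof -
  have "complex_of_real (tr (\<lambda>x. f (g x))) = mtrace n (mprod n (mt f) (mt g))"
    unfolding mtrace_mt[symmetric] using assms mt_comp by (intro mtrace_cong) simp
  also have "\<dots> = mtrace n (mprod n (mt g) (mt f))"
    by (rule mtrace_mprod_commute)
  also have "\<dots> = complex_of_real (tr (\<lambda>x. g (f x)))"
    unfolding mtrace_mt[symmetric] using assms mt_comp by (intro mtrace_cong) simp
  finally show ?thesis by simp
qed

lemma tr_add: "tr (\<lambda>x. f x + g x) = tr f + tr g"
  by (simp add: tr_def linear_add[OF linear_co] sum.distrib)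

lemma tr_diff: "tr (\<lambda>x. f x - g x) = tr f - tr g"
  by (simp add: tr_def linear_diff[OF linear_co] sum_subtractf)

lemma tr_scale: "tr (\<lambda>x. r *\<^sub>R f x) = r * tr f"
  by (simp add: tr_def linear_scale[OF linear_co] sum_distrib_left)

lemma linear_br_br: "linear (\<lambda>z. br x (br y z))"
  using linear_compose[OF linear_br[of y] linear_br[of x]] by (simp add: comp_def)

lemma br_br: "br (br x y) z = br x (br y z) - br y (br x z)"
  using jacobi[of x y z] by simp

lemma kap_linear_left: "linear (\<lambda>x. kap x y)"
  by (rule linearI) (simp_all add: kap_def br_simps tr_add tr_scale)

lemma kap_linear_right: "linear (kap x)"
  by (rule linearI) (simp_all add: kap_def br_simps tr_add tr_scale)

text \<open>After both commutators are expanded, the two sides differ by a single cyclic shift under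
  the trace.\<close>

lemma kap_invariant: "kap (br x y) z = kap x (br y z)"
proof -
  have "tr (\<lambda>u. br y (br x (br z u))) = tr (\<lambda>u. br x (br z (br y u)))"
    by (rule tr_commute[OF linear_br linear_br_br]) (simp_all add: br_L)
  then show ?thesis
    by (simp add: kap_def br_br br_simps tr_diff)
qed

lemma rad_ideal: "x \<in> rad \<Longrightarrow> br y x \<in> rad"
proof -
  assume x: "x \<in> rad"
  have "kap (br y x) z = 0" if "z \<in> L" for z
  proof -
    have "kap (br y x) z = - kap (br x y) z"
      by (subst anti) (simp add: linear_neg[OF kap_linear_left])
    also have "\<dots> = 0"
      using x br_L by (simp add: kap_invariant rad_def)
    finally show ?thesis .
  qed
  then show "br y x \<in> rad" by (simp add: rad_def br_L)
qed

lemma subspace_rad: "subspace rad"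
  using subspace_L unfolding rad_def real_vector.subspace_def
  by (auto simp: linear_0[OF kap_linear_left] linear_add[OF kap_linear_left]
      linear_scale[OF kap_linear_left])

lemma sderiv_mt:
  assumes "linear f" "\<And>x. f x \<in> L" "\<And>x y. f (br x y) = br (f x) y + br x (f y)"
  shows "sderiv n sc (mt f)"
  unfolding sderiv_def
proof (intro allI impI)
  fix i j k assume ijk: "i < n" "j < n" "k < n"
  have "(\<Sum>m<n. mt f k m * sc i j m) = complex_of_real (co k (f (br (b i) (b j))))"
    by (subst linear_expand[OF assms(1) br_L])
      (simp add: mt_def sc_def linear_sum[OF linear_co] linear_scale[OF linear_co] mult.commute)
  moreover have "(\<Sum>m<n. sc i m k * mt f m j) = complex_of_real (co k (br (b i) (f (b j))))"
    by (subst linear_expand[OF linear_br assms(2)])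
      (simp add: mt_def sc_def linear_sum[OF linear_co] linear_scale[OF linear_co] mult.commute)
  moreover have "(\<Sum>m<n. mt f m i * sc m j k) = complex_of_real (co k (br (f (b i)) (b j)))"
    by (subst linear_expand[OF linear_br_left assms(2)])
      (simp add: mt_def sc_def linear_sum[OF linear_co] linear_scale[OF linear_co] mult.commute)
  ultimately show "(\<Sum>m<n. mt f k m * sc i j m) - (\<Sum>m<n. sc i m k * mt f m j) = (\<Sum>m<n. mt f m i * sc m j k)"
    by (simp add: assms(3) linear_add[OF linear_co])
qed

text \<open>For \<open>x = [y, z]\<close> the trace is \<open>tr (ad y [ad z, D]) = - tr (ad y (ad (D z)))\<close>, a value
  of the complexified Killing form at \<open>y\<close>.\<close>

lemma mtrace_rad_commutator:
  assumes D: "sderiv n sc D" and y: "y \<in> rad" and z: "z \<in> L"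
  shows "mtrace n (mprod n (mt (br (br y z))) D) = 0"
proof -
  let ?Y = "mt (br y)" and ?Z = "mt (br z)"
  have Z: "?Z = (\<lambda>k j. \<Sum>i<n. of_real (co i z) * sc i j k)"
    by (intro ext) (simp add: mt_def sc_def linear_expand[OF linear_br_left z]
        linear_sum[OF linear_co] linear_scale[OF linear_co])
  have "mt (br (br y z)) = (\<lambda>k j. mprod n ?Y ?Z k j - mprod n ?Z ?Y k j)"
    unfolding mt_comp[OF linear_br br_L] by (intro ext) (simp add: mt_def br_br linear_diff[OF linear_co])
  then have "mtrace n (mprod n (mt (br (br y z))) D) =
      mtrace n (mprod n (mprod n ?Y ?Z) D) - mtrace n (mprod n (mprod n ?Z ?Y) D)"
    by (simp add: mprod_diff mtrace_def sum_subtractf)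
  also have "mtrace n (mprod n (mprod n ?Z ?Y) D) = mtrace n (mprod n ?Y (mprod n D ?Z))"
    unfolding mprod_assoc by (subst mtrace_mprod_commute) (simp only: mprod_assoc)
  also have "mtrace n (mprod n (mprod n ?Y ?Z) D) - mtrace n (mprod n ?Y (mprod n D ?Z))
      = - mtrace n (mprod n ?Y (\<lambda>k j. mprod n D ?Z k j - mprod n ?Z D k j))"
    by (simp add: mprod_assoc mprod_diff mtrace_def sum_subtractf)
  \<comment> \<open>The commutator [D, ad z] is ad (D z). It is written out with structure constants
    because \<open>D\<close> has complex entries, so that D z lies in the complexification
    only.\<close>
  also have "mtrace n (mprod n ?Y (\<lambda>k j. mprod n D ?Z k j - mprod n ?Z D k j)) =
      mtrace n (mprod n ?Y (\<lambda>k j. \<Sum>i<n. of_real (co i z) * (\<Sum>m<n. D m i * sc m j k)))"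
  proof (intro mtrace_cong mprod_cong refl)
    fix j k assume jk: "j < n" "k < n"
    have "mprod n D ?Z k j - mprod n ?Z D k j = (\<Sum>i<n. of_real (co i z) *
        (mprod n D (\<lambda>k j. sc i j k) k j - mprod n (\<lambda>k j. sc i j k) D k j))"
      unfolding Z mprod_sum by (simp add: sum_subtractf right_diff_distrib)
    also have "\<dots> = (\<Sum>i<n. of_real (co i z) * (\<Sum>m<n. D m i * sc m j k))"
      using D jk unfolding sderiv_mprod by (intro sum.cong) auto
    finally show "mprod n D ?Z k j - mprod n ?Z D k j = \<dots>" .
  qed
  also have "\<dots> = (\<Sum>i<n. of_real (co i z) * (\<Sum>m<n. D m i * mtrace n (mprod n ?Y (\<lambda>k j. sc m j k))))"
    unfolding mtrace_mprod_sum ..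
  also have "\<dots> = 0"
  proof -
    have "mtrace n (mprod n ?Y (\<lambda>k j. sc m j k)) = 0" if "m < n" for m
    proof -
      have "(\<lambda>k j. sc m j k) = mt (br (b m))" by (simp add: sc_def mt_def)
      then have "mtrace n (mprod n ?Y (\<lambda>k j. sc m j k)) = of_real (kap y (b m))"
        unfolding kap_def mtrace_mt[symmetric]
        by (simp add: mt_comp[OF linear_br br_L] cong: mtrace_cong)
      then show ?thesis using y b_L[OF that] by (simp add: rad_def)
    qed
    then show ?thesis by simp
  qed
  finally show ?thesis by simp
qed

lemma mpow_mt:
  assumes "linear f" "\<And>x. f x \<in> L" "i < n" "j < n"
  shows "mpow n (mt f) m i j = of_real (co i ((f ^^ m) (b j)))"
  using assms(3)
proof (induction m arbitrary: i)
  case 0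
  then show ?case using assms(4) by (simp add: co_b)
next
  case (Suc m)
  have L: "(f ^^ m) (b j) \<in> L" for m
    using assms(2) b_L[OF assms(4)] by (cases m) auto
  have "mpow n (mt f) (Suc m) i j = mprod n (mt f) (mt (f ^^ m)) i j"
    using Suc by (simp, intro mprod_cong) (auto simp: mt_def)
  then show ?case
    using mt_comp[of f "f ^^ m" j, OF assms(1) L] by (simp add: mt_def)
qed

lemma linear_funpow: "linear f \<Longrightarrow> linear (f ^^ m)" for f :: "'v \<Rightarrow> 'v"
  by (induction m) (auto simp: linear_id linear_compose)

text \<open>ad x is a derivation, so \<open>conjugate_derivation\<close> supplies a \<open>D\<close>
  for which tr (ad x D) = 0 forces nilpotency. That trace vanishes on commutators from the radical
  for every derivation \<open>D\<close>, hence on their span with this \<open>D\<close> kept fixed.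
  The exponent \<open>n\<close> does not depend on \<open>x\<close>, as Engel's theorem below
  expects.\<close>

lemma rad_nilpotent:
  assumes "x \<in> span {br y z | y z. y \<in> rad \<and> z \<in> rad}" "u \<in> L"
  shows "(br x ^^ n) u = 0"
proof -
  have "sderiv n sc (mt (br x))"
    by (rule sderiv_mt[OF linear_br br_L jacobi])
  then obtain D where D: "sderiv n sc D"
    and nil: "mtrace n (mprod n (mt (br x)) D) = 0 \<Longrightarrow>
      \<forall>i<n. \<forall>j<n. mpow n (mt (br x)) n i j = 0"
    by (rule conjugate_derivation) blast
  have "mtrace n (mprod n (mt (br x)) D) = 0"
    using assms(1)
  proof (induction rule: real_vector.span_induct_alt)
    case base
    then show ?case
      by (simp add: mtrace_def mprod_def mt_def br_simps linear_0[OF linear_co])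
  next
    case (step c v w)
    have "mt (br (c *\<^sub>R v + w)) = (\<lambda>k j. of_real c * mt (br v) k j + mt (br w) k j)"
      by (simp add: mt_def br_simps linear_add[OF linear_co] linear_scale[OF linear_co])
    then have "mtrace n (mprod n (mt (br (c *\<^sub>R v + w))) D) =
        of_real c * mtrace n (mprod n (mt (br v)) D) + mtrace n (mprod n (mt (br w)) D)"
      by (simp add: mtrace_def mprod_def sum_distrib_left distrib_right sum.distrib mult.assoc)
    then show ?case
      using step mtrace_rad_commutator[OF D] by (auto simp: rad_def)
  qed
  then have 0: "co i ((br x ^^ n) (b j)) = 0" if "i < n" "j < n" for i j
    using nil that mpow_mt[OF linear_br br_L that] by fastforce
  have pL: "(br x ^^ n) v \<in> L" if "v \<in> L" for v
    using that br_L by (cases n) auto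
  have "(br x ^^ n) (b j) = 0" if "j < n" for j
    by (rule L_eqI) (use that 0 pL b_L subspace_L real_vector.subspace_0 in \<open>auto simp: linear_0[OF linear_co]\<close>)
  then show ?thesis
    using linear_eq_0_L[OF linear_funpow[OF linear_br]] assms(2) by blast
qed

end

section \<open>Nilpotent and semisimple Lie algebras\<close>

lemma sum_fun_apply: "(\<Sum>i\<in>A. f i) x = (\<Sum>i\<in>A. f i x)"
  by (induction A rule: infinite_finite_induct) (simp_all add: plus_fun_def zero_fun_def)

context lie_product
begin

section \<open>Engel's theorem\<close>

lemma br_self: "br v v = 0"
proof -
  have "2 *\<^sub>R br v v = 0"
    using anti[of v v] unfolding scaleR_2 eq_neg_iff_add_eq_0 .
  then show ?thesis by simp
qed

text \<open>Not the lower central series of \<open>S\<close>: operators from \<open>S\<close> act on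
  all of \<open>L\<close>. Thus \<open>low S q \<subseteq> {0}\<close> says that any
  \<open>q\<close> operators ad s with s in \<open>S\<close> compose to zero on
  \<open>L\<close>.\<close>

primrec low :: "'v set \<Rightarrow> nat \<Rightarrow> 'v set" where
  "low S 0 = L"
| "low S (Suc k) = span {br s u | s u. s \<in> S \<and> u \<in> low S k}"

lemma subspace_low: "subspace (low S k)"
  by (cases k) (simp_all add: subspace_L)

lemma low_br: "s \<in> S \<Longrightarrow> u \<in> low S k \<Longrightarrow> br s u \<in> low S (Suc k)"
  by (auto intro: real_vector.span_base)

lemma span_image_subset:
  assumes "linear f" "subspace W" "\<And>x. x \<in> X \<Longrightarrow> f x \<in> W" "x \<in> span X"
  shows "f x \<in> W"
  using assms(4)
proof (induction rule: real_vector.span_induct_alt)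
  case base
  then show ?case using assms by (simp add: linear_0 real_vector.subspace_0)
next
  case (step c v y)
  then show ?case
    using assms by (simp add: linear_add linear_scale real_vector.subspace_add real_vector.subspace_scale)
qed

lemma low_Suc_subset: "low S (Suc k) \<subseteq> low S k"
proof (induction k)
  case 0
  show ?case unfolding low.simps using br_L subspace_L by (intro real_vector.span_minimal) auto
next
  case (Suc k)
  have "{br s u | s u. s \<in> S \<and> u \<in> low S (Suc k)} \<subseteq> {br s u | s u. s \<in> S \<and> u \<in> low S k}"
    using Suc by blast
  then show ?case
    unfolding low.simps(2)[of S "Suc k"] low.simps(2)[of S k] by (rule real_vector.span_mono)
qed

lemma low_normalizer:
  assumes "\<And>s. s \<in> S \<Longrightarrow> br v s \<in> S" "x \<in> low S k"
  shows "br v x \<in> low S k"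
  using assms(2)
proof (induction k arbitrary: x)
  case 0
  then show ?case by (simp add: br_L)
next
  case (Suc k)
  show ?case
  proof (rule span_image_subset[OF linear_br subspace_low])
    show "x \<in> span {br s u | s u. s \<in> S \<and> u \<in> low S k}" using Suc.prems by simp
    fix y assume "y \<in> {br s u | s u. s \<in> S \<and> u \<in> low S k}"
    then obtain s u where su: "y = br s u" "s \<in> S" "u \<in> low S k" by blast
    have "br v y = br (br v s) u + br s (br v u)" unfolding su by (rule jacobi)
    moreover have "br (br v s) u \<in> low S (Suc k)" "br s (br v u) \<in> low S (Suc k)"
      using su assms(1) Suc.IH by (blast intro: low_br)+
    ultimately show "br v y \<in> low S (Suc k)"
      by (simp add: real_vector.span_add)
  qed
qed

text \<open>A product of \<open>q\<close> operators from \<open>S + \<real> v\<close> lies deep in the lower series of \<open>S\<close>: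
  modulo \<open>low S (Suc k)\<close> the algebra \<open>S\<close> kills \<open>low S k\<close>, so only the nilpotent
  \<open>ad v\<close> acts there.\<close>

lemma low_extend:
  assumes S: "subspace S" and inv: "\<And>s. s \<in> S \<Longrightarrow> br v s \<in> S"
    and nil: "\<And>u. u \<in> L \<Longrightarrow> (br v ^^ m) u = 0"
  shows "\<exists>q. low (span (insert v S)) q \<subseteq> low S k"
proof (induction k)
  case 0
  show ?case by (intro exI[of _ 0]) simp
next
  case (Suc k)
  let ?S' = "span (insert v S)"
  obtain q where q: "low ?S' q \<subseteq> low S k" using Suc by blast
  \<comment> \<open>A chain from \<open>low S k\<close> at j = 0 into \<open>low S (Suc k)\<close>
    at j = m; every further operator from \<open>?S'\<close> advances one step in it.\<close>
  define E where "E j = span (low S (Suc k) \<union> (br v ^^ j) ` low S k)" for j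
  have E_sub: "subspace (E j)" for j by (simp add: E_def)
  have base: "x \<in> E j" if "x \<in> low S (Suc k) \<union> (br v ^^ j) ` low S k" for x j
    using that unfolding E_def by (rule real_vector.span_base)
  have step: "br s x \<in> E (Suc j)" if "s \<in> ?S'" "x \<in> E j" for s x j
  proof (rule span_image_subset[OF linear_br E_sub _ that(2)[unfolded E_def]])
    fix y assume y: "y \<in> low S (Suc k) \<union> (br v ^^ j) ` low S k"
    show "br s y \<in> E (Suc j)"
    proof (rule span_image_subset[OF linear_br_left E_sub _ that(1)])
      fix t assume t: "t \<in> insert v S"
      have pw: "(br v ^^ j) u \<in> low S k" if "u \<in> low S k" for u
        using that by (induction j) (auto intro: low_normalizer[OF inv])
      show "br t y \<in> E (Suc j)"
      proof (cases "y \<in> low S (Suc k)")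
        case True
        have "br t y \<in> low S (Suc k)"
        proof (cases "t \<in> S")
          case True
          then show ?thesis using \<open>y \<in> low S (Suc k)\<close> low_Suc_subset[of S "Suc k"] low_br by blast
        next
          case False
          then show ?thesis using t True low_normalizer[OF inv] by blast
        qed
        then show ?thesis using base by blast
      next
        case False
        then obtain u where u: "u \<in> low S k" "y = (br v ^^ j) u" using y by blast
        show ?thesis
        proof (cases "t \<in> S")
          case True
          then have "br t y \<in> low S (Suc k)" unfolding u(2) using pw[OF u(1)] by (rule low_br)
          then show ?thesis using base by blast
        next
          case False
          then have "br t y = (br v ^^ Suc j) u" using t u by simp
          then have "br t y \<in> (br v ^^ Suc j) ` low S k" using u(1) by blast
          then show ?thesis by (intro base UnI2)
        qed
      qed
    qed
  qed
  have "low ?S' (q + j) \<subseteq> E j" for j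
  proof (induction j)
    case 0
    then show ?case using q base[of _ 0] by auto
  next
    case (Suc j)
    have "{br s u | s u. s \<in> ?S' \<and> u \<in> low ?S' (q + j)} \<subseteq> E (Suc j)"
      using step Suc by blast
    then show ?case using E_sub by (simp add: real_vector.span_minimal)
  qed
  moreover have "E m \<subseteq> low S (Suc k)"
  proof -
    have "low S k \<subseteq> L"
      by (induction k) (use low_Suc_subset in \<open>auto simp del: low.simps(2) simp: low.simps(1)\<close>)
    then have "(br v ^^ m) ` low S k \<subseteq> {0}" using nil by auto
    then show ?thesis
      unfolding E_def using subspace_low[of S "Suc k"] real_vector.subspace_0[OF subspace_low[of S "Suc k"]]
      by (intro real_vector.span_minimal) auto
  qed
  ultimately show ?case by blast
qed

text \<open>Among the subalgebras of \<open>J\<close> that act nilpotently as a whole, one of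
  greatest dimension is taken. If it were proper, some element of \<open>J\<close> outside it would
  normalise it, and by \<open>low_extend\<close> adjoining that element would give a larger such
  subalgebra.\<close>

lemma engel:
  assumes J: "subspace J" "J \<subseteq> L" "\<And>x y. x \<in> J \<Longrightarrow> y \<in> J \<Longrightarrow> br x y \<in> J"
    and nil: "\<And>x u. x \<in> J \<Longrightarrow> u \<in> L \<Longrightarrow> (br x ^^ m) u = 0"
  shows "\<exists>q. low J q \<subseteq> {0}"
proof -
  define good where "good S \<longleftrightarrow> subspace S \<and> S \<subseteq> J \<and> (\<forall>x\<in>S. \<forall>y\<in>S. br x y \<in> S) \<and>
    (\<exists>q. low S q \<subseteq> {0})" for S
  have Lspan: "X \<subseteq> span (b ` {..<n})" if "X \<subseteq> J" for X
    using that J(2) by (simp add: L_def)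
  have good0: "good {0}"
    unfolding good_def
  proof (intro conjI)
    have "low {0} (Suc 0) \<subseteq> {0}"
      using real_vector.span_minimal[of "{br s u | s u. s \<in> {0} \<and> u \<in> L}" "{0}"]
      by (auto simp: br_simps)
    then show "\<exists>q. low {0} q \<subseteq> {0}" by blast
    show "subspace {0::'v}" by (simp add: real_vector.subspace_single_0)
    show "{0} \<subseteq> J" using J(1) real_vector.subspace_0 by auto
  qed (auto simp: br_simps)
  have bound: "dim S < Suc n" if "good S" for S
  proof -
    have "S \<subseteq> J" using that unfolding good_def by blast
    then have "dim S \<le> card (b ` {..<n})"
      using Lspan by (intro dim_le_span) auto
    then show ?thesis using card_image_le[of "{..<n}" b] by simp
  qed
  have "\<exists>S. good S \<and> (\<forall>S'. good S' \<longrightarrow> dim S' \<le> dim S)"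
    by (rule ex_has_greatest_nat[of good "{0}" dim "Suc n"]) (use good0 bound in auto)
  then obtain S where S: "good S \<and> (\<forall>S'. good S' \<longrightarrow> dim S' \<le> dim S)" ..
  from S have good_S: "good S" ..
  from S have max: "\<forall>S'. good S' \<longrightarrow> dim S' \<le> dim S" ..
  have S': "subspace S" "S \<subseteq> J" "\<forall>x\<in>S. \<forall>y\<in>S. br x y \<in> S" "\<exists>q. low S q \<subseteq> {0}"
    using good_S unfolding good_def by simp_all
  have "S = J"
  proof (rule ccontr)
    assume "S \<noteq> J"
    then obtain v0 where v0: "v0 \<in> J - S" using S'(2) by auto
    obtain q where q: "low S q \<subseteq> {0}" using S'(4) ..
    \<comment> \<open>Without a normalising element, a vector outside \<open>S\<close> could be
      bracketed with \<open>S\<close> again and again without entering \<open>S\<close>. It would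
      survive in every \<open>low S k\<close>, although \<open>low S q\<close> contains only
      0.\<close>
    have "\<exists>v\<in>J - S. \<forall>s\<in>S. br s v \<in> S"
    proof (rule ccontr)
      assume neg: "\<not> (\<exists>v\<in>J - S. \<forall>s\<in>S. br s v \<in> S)"
      have "\<exists>v\<in>J - S. v \<in> low S k" for k
      proof (induction k)
        case 0
        then show ?case using v0 J(2) by auto
      next
        case (Suc k)
        then obtain v where v: "v \<in> J - S" "v \<in> low S k" by blast
        then obtain s where s: "s \<in> S" "br s v \<notin> S" using neg by blast
        have "br s v \<in> J - S" using s v J(3)[of s v] S'(2) by auto
        then show ?case using low_br[OF s(1) v(2)] by blast
      qed
      then obtain v where "v \<in> J - S" "v \<in> low S q" by blast
      then show False using q real_vector.subspace_0[OF S'(1)] by auto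
    qed
    then obtain v where v: "v \<in> J" "v \<notin> S" and sv: "\<And>s. s \<in> S \<Longrightarrow> br s v \<in> S" by blast
    have vs: "br v s \<in> S" if "s \<in> S" for s
      using sv[OF that] anti[of v s] real_vector.subspace_neg[OF S'(1)] by simp
    let ?S = "span (insert v S)"
    have "good ?S"
      unfolding good_def
    proof (intro conjI ballI)
      show "subspace ?S" by simp
      show "?S \<subseteq> J" using v(1) S'(2) J(1) by (intro real_vector.span_minimal) auto
      obtain p where "low ?S p \<subseteq> low S q"
        using low_extend[of S v m q, OF S'(1) vs nil[OF v(1)]] by blast
      then show "\<exists>q. low ?S q \<subseteq> {0}" using q by blast
      fix x y assume x: "x \<in> ?S" and y: "y \<in> ?S"
      show "br x y \<in> ?S"
      proof (rule span_image_subset[OF linear_br _ _ y])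
        fix t assume t: "t \<in> insert v S"
        show "br x t \<in> ?S"
        proof (rule span_image_subset[OF linear_br_left _ _ x])
          fix w assume w: "w \<in> insert v S"
          have "br w t \<in> insert 0 S" using w t vs sv S'(3) br_self by auto
          then show "br w t \<in> ?S"
            by (auto intro: real_vector.span_base real_vector.span_zero)
        qed simp
      qed simp
    qed
    then have "dim ?S \<le> dim S" using max by blast
    moreover have "dim S < dim ?S"
    proof (rule dim_less)
      show "subspace S" by (rule S'(1))
      have "v \<in> ?S" "S \<subseteq> ?S" by (auto intro: real_vector.span_base)
      then show "S \<subset> ?S" using v(2) by blast
      show "?S \<subseteq> span (b ` {..<n})"
        using Lspan \<open>good ?S\<close> unfolding good_def by blast
    qed simp
    ultimately show False by simp
  qed
  then show ?thesis using S'(4) by simp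
qed

text \<open>A perfect \<open>J\<close> satisfies J = [J, J], so by induction it lies in every
  \<open>low J k\<close>; Engel's theorem makes one of these zero.\<close>

lemma perfect_nilpotent_zero:
  assumes "J \<subseteq> L" "J = span {br x y | x y. x \<in> J \<and> y \<in> J}"
    and "\<And>x u. x \<in> J \<Longrightarrow> u \<in> L \<Longrightarrow> (br x ^^ m) u = 0"
  shows "J = {0}"
proof -
  have sub: "subspace J" by (subst assms(2)) simp
  have "J \<subseteq> low J k" for k
  proof (induction k)
    case 0
    then show ?case using assms(1) by simp
  next
    case (Suc k)
    have "span {br x y | x y. x \<in> J \<and> y \<in> J} \<subseteq> low J (Suc k)"
      unfolding low.simps using Suc by (intro real_vector.span_mono) blast
    then show ?case using assms(2) by simp
  qed
  moreover have "br x y \<in> J" if "x \<in> J" "y \<in> J" for x y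
    by (subst assms(2)) (use that in \<open>auto intro: real_vector.span_base\<close>)
  then have "\<exists>q. low J q \<subseteq> {0}"
    using engel[OF sub assms(1) _ assms(3)] by blast
  ultimately show ?thesis using sub real_vector.subspace_0 by blast
qed

section \<open>Solvability of the Killing radical\<close>

lemma derived_series_subset: "subspace I \<Longrightarrow> (\<And>x y. x \<in> I \<Longrightarrow> y \<in> I \<Longrightarrow> br x y \<in> I) \<Longrightarrow>
    derived_series br I (Suc k) \<subseteq> derived_series br I k"
proof (induction k)
  case 0
  then show ?case unfolding derived_series.simps by (intro real_vector.span_minimal) auto
next
  case (Suc k)
  let ?D = "derived_series br I"
  have "{br x y | x y. x \<in> ?D (Suc k) \<and> y \<in> ?D (Suc k)} \<subseteq> {br x y | x y. x \<in> ?D k \<and> y \<in> ?D k}"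
    using Suc by blast
  then show ?case
    unfolding derived_series.simps(2)[of _ _ "Suc k"] derived_series.simps(2)[of _ _ k]
    by (rule real_vector.span_mono)
qed

text \<open>For reasons of dimension the derived series becomes stationary. The stationary term is
  perfect and contained in the derived algebra of the radical, where every ad x is nilpotent, so it
  is zero.\<close>

lemma rad_solvable: "solvable_lie_algebra br rad"
proof -
  let ?D = "derived_series br rad"
  have dec: "?D (Suc k) \<subseteq> ?D k" for k
    by (rule derived_series_subset[OF subspace_rad]) (rule rad_ideal)
  have sub: "subspace (?D k)" for k
    by (cases k) (simp_all add: subspace_rad)
  have in_rad: "?D k \<subseteq> rad" for k
    by (induction k) (use dec in \<open>auto simp del: derived_series.simps(2)\<close>)
  then have inL: "?D k \<subseteq> span (b ` {..<n})" for k
    unfolding rad_def L_def by blast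
  have "\<exists>k. ?D (Suc k) = ?D k"
  proof (rule ccontr)
    assume "\<not> ?thesis"
    then have "?D (Suc k) \<subset> ?D k" for k using dec[of k] by blast
    then have less: "dim (?D (Suc k)) < dim (?D k)" for k
      using dim_less[OF sub _ inL] by blast
    have "dim (?D k) + k \<le> dim (?D 0)" for k
    proof (induction k)
      case (Suc k)
      then show ?case using less[of k] by linarith
    qed simp
    from this[of "Suc (dim (?D 0))"] show False by simp
  qed
  then obtain k where k: "?D (Suc k) = ?D k" by blast
  have "?D k = {0}"
  proof (rule perfect_nilpotent_zero)
    show "?D k \<subseteq> L" using inL by (simp add: L_def)
    show "?D k = span {br x y | x y. x \<in> ?D k \<and> y \<in> ?D k}" using k by simp
    fix x u assume x: "x \<in> ?D k" and u: "u \<in> L"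
    have "x \<in> span {br x y | x y. x \<in> ?D k \<and> y \<in> ?D k}" using x k by simp
    also have "\<dots> \<subseteq> span {br y z | y z. y \<in> rad \<and> z \<in> rad}"
      using in_rad by (intro real_vector.span_mono) blast
    finally show "(br x ^^ n) u = 0" using u by (rule rad_nilpotent)
  qed
  then show ?thesis unfolding solvable_lie_algebra_def by blast
qed

text \<open>Pairing with the basis maps \<open>L\<close> into the n-tuples, encoded as functions
  that vanish from \<open>n\<close> on. A zero radical makes this map injective, and equal
  dimensions make it surjective, so every functional is hit.\<close>

lemma kap_represents:
  assumes "rad = {0}" "linear \<phi>"
  obtains a where "a \<in> L" "\<And>y. y \<in> L \<Longrightarrow> kap a y = \<phi> y"
proof -
  define F :: "(nat \<Rightarrow> real) set" where "F = (\<lambda>i j. of_bool (i = j)) ` {..<n}"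
  define \<Phi> :: "'v \<Rightarrow> nat \<Rightarrow> real" where "\<Phi> x = (\<lambda>i. if i < n then kap x (b i) else 0)" for x
  have lin: "linear \<Phi>"
    by (rule linearI) (auto simp: \<Phi>_def fun_eq_iff scaleR_fun_def plus_fun_def
        linear_add[OF kap_linear_left] linear_scale[OF kap_linear_left])
  have F: "(\<lambda>i. if i < n then f i else 0) \<in> span F" for f :: "nat \<Rightarrow> real"
  proof -
    have "(\<lambda>i. if i < n then f i else 0) = (\<Sum>i<n. f i *\<^sub>R (\<lambda>j. of_bool (i = j)))"
    proof
      fix j
      have "(\<Sum>i<n. f i *\<^sub>R (\<lambda>j. of_bool (i = j) :: real)) j = (\<Sum>i<n. if i = j then f i else 0)"
        by (subst sum_fun_apply) (auto simp: scaleR_fun_def intro!: sum.cong)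
      then show "(if j < n then f j else 0) = (\<Sum>i<n. f i *\<^sub>R (\<lambda>j. of_bool (i = j) :: real)) j"
        by simp
    qed
    moreover have "(\<Sum>i<n. f i *\<^sub>R (\<lambda>j. of_bool (i = j) :: real)) \<in> span F"
      by (intro real_vector.span_sum real_vector.span_scale real_vector.span_base) (auto simp: F_def)
    ultimately show ?thesis by simp
  qed
  have ind_b: "independent (b ` {..<n})" and inj_b: "inj_on b {..<n}"
  proof -
    show "inj_on b {..<n}"
      using co_b by (intro inj_onI) (metis lessThan_iff of_bool_eq_1_iff)
    show "independent (b ` {..<n})"
    proof (rule real_vector.independent_if_scalars_zero)
      show "finite (b ` {..<n})" by simp
      fix f x assume s: "(\<Sum>x\<in>b ` {..<n}. f x *\<^sub>R x) = 0" and "x \<in> b ` {..<n}"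
      then obtain i where i: "i < n" "x = b i" by auto
      have "0 = co i (\<Sum>x\<in>b ` {..<n}. f x *\<^sub>R x)" by (simp add: s linear_0[OF linear_co])
      also have "\<dots> = (\<Sum>k<n. f (b k) * of_bool (i = k))"
        using i by (simp add: sum.reindex[OF \<open>inj_on b {..<n}\<close>] linear_sum[OF linear_co]
            linear_scale[OF linear_co] co_b)
      also have "\<dots> = f x" using i by (simp add: sum_of_bool_mult)
      finally show "f x = 0" by simp
    qed
  qed
  have injL: "inj_on \<Phi> L"
  proof (rule inj_onI)
    fix x y assume xy: "x \<in> L" "y \<in> L" "\<Phi> x = \<Phi> y"
    have "kap (x - y) (b i) = 0" if "i < n" for i
      using fun_cong[OF xy(3), of i] that by (simp add: \<Phi>_def linear_diff[OF kap_linear_left])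
    then have "kap (x - y) z = 0" if "z \<in> L" for z
      using linear_expand[OF kap_linear_right that] by simp
    then have "x - y \<in> rad"
      using xy subspace_L by (simp add: rad_def real_vector.subspace_diff)
    then show "x = y" using assms(1) by simp
  qed
  have ind: "independent (\<Phi> ` b ` {..<n})"
    using injL by (intro linear_independent_injective_image[OF lin ind_b]) (simp add: L_def)
  have card: "card (\<Phi> ` b ` {..<n}) = n"
    using inj_b injL real_vector.span_superset[of "b ` {..<n}"]
    by (simp add: card_image inj_on_subset L_def)
  have sF: "\<Phi> ` b ` {..<n} \<subseteq> span F"
    using F by (auto simp: \<Phi>_def)
  have finF: "finite F"
    unfolding F_def by (rule finite_imageI) (rule finite_lessThan)
  have cardF: "card F \<le> n"
    unfolding F_def by (rule order_trans[OF card_image_le[OF finite_lessThan]]) simp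
  \<comment> \<open>Otherwise the images of the basis together with this tuple would be n + 1
    independent vectors in the span of the at most n unit tuples \<open>F\<close>.\<close>
  have "(\<lambda>i. if i < n then \<phi> (b i) else 0) \<in> span (\<Phi> ` b ` {..<n})" (is "?f \<in> span ?B")
  proof (rule ccontr)
    assume f: "?f \<notin> span ?B"
    have nB: "?f \<notin> ?B"
      using f by (rule contrapos_nn) (rule real_vector.span_base)
    then have "independent (insert ?f ?B)"
      using ind f by (simp add: real_vector.independent_insert)
    moreover have "insert ?f ?B \<subseteq> span F" by (rule insert_subsetI[OF F sF])
    ultimately have "card (insert ?f ?B) \<le> card F"
      using real_vector.independent_span_bound[OF finF] by simp
    then show False using nB card cardF by simp
  qed
  then have "(\<lambda>i. if i < n then \<phi> (b i) else 0) \<in> \<Phi> ` L"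
    by (simp add: L_def linear_span_image[OF lin])
  then obtain a where a: "a \<in> L" "\<Phi> a = (\<lambda>i. if i < n then \<phi> (b i) else 0)" by auto
  have "kap a (b i) = \<phi> (b i)" if "i < n" for i
    using fun_cong[OF a(2), of i] that by (simp add: \<Phi>_def)
  then have "kap a y = \<phi> y" if "y \<in> L" for y
    using linear_expand[OF kap_linear_right that] linear_expand[OF assms(2) that] by simp
  then show thesis using that a(1) by blast
qed

section \<open>Traces of derivations\<close>

lemma semisimple_rad:
  assumes "semisimple_lie_algebra br L"
  shows "rad = {0}"
proof -
  have "lie_ideal br L rad"
    unfolding lie_ideal_def using subspace_rad rad_ideal by (auto simp: rad_def)
  then show ?thesis using assms rad_solvable unfolding semisimple_lie_algebra_def by blast
qed

text \<open>Let \<open>z\<close> represent the functional y \<mapsto> tr (ad y). It vanishes on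
  brackets, so invariance puts every [z, x] into the radical, which is zero. Then ad z = 0, and the
  functional represented by \<open>z\<close> is zero.\<close>

lemma tr_br_zero:
  assumes "rad = {0}" "y \<in> L"
  shows "tr (br y) = 0"
proof -
  have "linear (\<lambda>y. tr (br y))"
    by (rule linearI) (simp_all add: tr_def br_simps linear_add[OF linear_co]
        linear_scale[OF linear_co] sum.distrib sum_distrib_left)
  then obtain z where z: "z \<in> L" "\<And>y. y \<in> L \<Longrightarrow> kap z y = tr (br y)"
    using kap_represents[OF assms(1)] by blast
  have "br z x \<in> rad" for x
  proof -
    have "kap (br z x) y = 0" if "y \<in> L" for y
    proof -
      have "tr (\<lambda>u. br x (br y u)) = tr (\<lambda>u. br y (br x u))"
        by (rule tr_commute[OF linear_br linear_br]) (simp_all add: br_L)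
      moreover have "tr (br (br x y)) = tr (\<lambda>u. br x (br y u) - br y (br x u))"
        by (simp add: tr_def br_br)
      ultimately show ?thesis
        using z(2)[OF br_L] by (simp add: kap_invariant tr_diff)
    qed
    then show ?thesis by (simp add: rad_def br_L)
  qed
  then have "br z x = 0" for x using assms(1) by blast
  then have "kap z y = 0" by (simp add: kap_def tr_def linear_0[OF linear_co])
  then show ?thesis using z(2)[OF assms(2)] by simp
qed

text \<open>The element \<open>a\<close> represents y \<mapsto> tr (D ad y), so E = D - ad a
  satisfies tr (E ad y) = 0 for all y in \<open>L\<close>. Since ad (E x) = [E, ad x], cyclicity
  gives kap (E x) y = tr (E ad [x, y]) = 0, and E x lies in the zero radical.\<close>

lemma derivation_inner:
  assumes "rad = {0}" "linear D" "\<And>x. D x \<in> L" "\<And>x y. D (br x y) = br (D x) y + br x (D y)"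
  obtains a where "a \<in> L" "\<And>x. x \<in> L \<Longrightarrow> D x = br a x"
proof -
  have "linear (\<lambda>y. tr (\<lambda>u. D (br y u)))"
    by (rule linearI) (simp_all add: br_simps linear_add[OF assms(2)] linear_scale[OF assms(2)] tr_add tr_scale)
  then obtain a where a: "a \<in> L" "\<And>y. y \<in> L \<Longrightarrow> kap a y = tr (\<lambda>u. D (br y u))"
    using kap_represents[OF assms(1)] by blast
  define E where "E x = D x - br a x" for x
  have E: "linear E" "E x \<in> L" for x
    unfolding E_def
    by (auto intro!: linear_compose_sub assms(2) linear_br real_vector.subspace_diff subspace_L assms(3) br_L)
  have der: "E (br x y) = br (E x) y + br x (E y)" for x y
    using jacobi[of a x y] by (simp add: E_def assms(4) br_simps)
  have E0: "tr (\<lambda>u. E (br y u)) = 0" if "y \<in> L" for y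
    using a(2)[OF that] by (simp add: E_def tr_diff kap_def)
  have "E x \<in> rad" for x
  proof -
    have "kap (E x) y = 0" if "y \<in> L" for y
    proof -
      have lin: "linear (\<lambda>u. E (br y u))"
        using linear_compose[OF linear_br[of y] E(1)] by (simp add: comp_def)
      have "tr (\<lambda>u. br x (E (br y u))) = tr (\<lambda>u. E (br y (br x u)))"
        by (rule tr_commute[OF linear_br lin]) (simp_all add: br_L E)
      moreover have "br (E x) (br y u) = E (br x (br y u)) - br x (E (br y u))" for u
        using der[of x "br y u"] by simp
      moreover have "tr (\<lambda>u. E (br (br x y) u)) = 0"
        using E0 br_L by blast
      ultimately show ?thesis
        by (simp add: kap_def tr_diff br_br linear_diff[OF E(1)])
    qed
    then show ?thesis by (simp add: rad_def E)
  qed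
  then have "E x = 0" for x using assms(1) by blast
  then have "D x = br a x" for x using E_def by (metis eq_iff_diff_eq_0)
  then show thesis using that a(1) by blast
qed

lemma tr_derivation:
  assumes "semisimple_lie_algebra br L" "linear D" "\<And>x. D x \<in> L"
    and "\<And>x y. D (br x y) = br (D x) y + br x (D y)"
  shows "tr D = 0"
proof -
  have rad: "rad = {0}" using semisimple_rad assms(1) .
  then obtain a where a: "a \<in> L" "\<And>x. x \<in> L \<Longrightarrow> D x = br a x"
    by (rule derivation_inner[OF _ assms(2-4)]) blast
  then have "tr D = tr (br a)" by (simp add: tr_def b_L)
  then show ?thesis using tr_br_zero[OF rad a(1)] by simp
qed

end

text \<open>The bracket laws are available on \<open>L\<close> only, as for the bracket of vector
  fields. Composing bracket and derivation with the projection \<open>P\<close> onto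
  \<open>L\<close> gives total maps with unchanged values on \<open>L\<close>, to which
  \<open>tr_derivation\<close> applies; the diagonal of \<open>d\<close> is the trace.\<close>

lemma derivation_trace_zero:
  fixes br :: "'v::real_vector \<Rightarrow> 'v \<Rightarrow> 'v" and L :: "'v set" and b :: "nat \<Rightarrow> 'v"
  assumes inj: "inj_on b {..<n}" and ind: "independent (b ` {..<n})" and L: "L = span (b ` {..<n})"
    and br_closed: "\<And>x y. x \<in> L \<Longrightarrow> y \<in> L \<Longrightarrow> br x y \<in> L"
    and br_add: "\<And>x y z. x \<in> L \<Longrightarrow> y \<in> L \<Longrightarrow> z \<in> L \<Longrightarrow> br x (y + z) = br x y + br x z"
    and br_scale: "\<And>x y r. x \<in> L \<Longrightarrow> y \<in> L \<Longrightarrow> br x (r *\<^sub>R y) = r *\<^sub>R br x y"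
    and anti: "\<And>x y. x \<in> L \<Longrightarrow> y \<in> L \<Longrightarrow> br x y = - br y x"
    and jacobi: "\<And>x y z. x \<in> L \<Longrightarrow> y \<in> L \<Longrightarrow> z \<in> L \<Longrightarrow>
        br x (br y z) = br (br x y) z + br y (br x z)"
    and semisimple: "semisimple_lie_algebra br L"
    and D_L: "\<And>x. x \<in> L \<Longrightarrow> D x \<in> L"
    and D_add: "\<And>x y. x \<in> L \<Longrightarrow> y \<in> L \<Longrightarrow> D (x + y) = D x + D y"
    and D_scale: "\<And>x r. x \<in> L \<Longrightarrow> D (r *\<^sub>R x) = r *\<^sub>R D x"
    and D_br: "\<And>x y. x \<in> L \<Longrightarrow> y \<in> L \<Longrightarrow> D (br x y) = br (D x) y + br x (D y)"
    and D_b: "\<And>i. i < n \<Longrightarrow> D (b i) = (\<Sum>j<n. d i j *\<^sub>R b j)"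
  shows "(\<Sum>i<n. d i i) = 0"
proof -
  have subL: "subspace L" by (simp add: L)
  \<comment> \<open>Coordinate functionals of the basis, extended linearly from \<open>L\<close> to
    the whole type.\<close>
  define co where "co i = real_vector.construct (b ` {..<n}) (\<lambda>v. of_bool (b i = v) :: real)" for i
  have lin_co: "linear (co i)" for i
    unfolding co_def by (rule linear_construct[OF ind])
  have co_b: "co i (b j) = of_bool (i = j)" if "i < n" "j < n" for i j
    using that inj by (auto simp: co_def construct_basis[OF ind] inj_on_eq_iff)
  define P where "P x = (\<Sum>k<n. co k x *\<^sub>R b k)" for x
  have linP: "linear P"
    by (rule linearI) (simp_all add: P_def linear_add[OF lin_co] linear_scale[OF lin_co]
        scaleR_add_left sum.distrib scaleR_sum_right)
  have PL: "P x \<in> L" for x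
    unfolding P_def L by (intro real_vector.span_sum real_vector.span_scale real_vector.span_base) auto
  have Pb: "P (b i) = b i" if "i < n" for i
  proof -
    have "P (b i) = (\<Sum>k<n. if k = i then b i else 0)"
      unfolding P_def using that by (intro sum.cong) (auto simp: co_b)
    also have "\<dots> = b i"
      using that sum.delta[of "{..<n}" i "\<lambda>k. b i"] by simp
    finally show ?thesis .
  qed
  have P: "P x = x" if "x \<in> L" for x
    using that unfolding L
    by (rule linear_eq_on[OF linP linear_id[unfolded id_def], simplified]) (auto simp: Pb)
  define br' where "br' x y = br (P x) (P y)" for x y
  have br'_eq: "br' x y = br x y" if "x \<in> L" "y \<in> L" for x y
    using that by (simp add: br'_def P)
  have br'_closed: "br' x y \<in> L" for x y
    by (simp add: br'_def br_closed PL)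
  interpret lie_product br' b co n
  proof (rule lie_product.intro)
    show "linear (br' x)" for x
      by (rule linearI) (simp_all add: br'_def linear_add[OF linP] linear_scale[OF linP] br_add br_scale PL)
    show "br' x y = - br' y x" for x y
      unfolding br'_def by (rule anti) (auto simp: PL)
    show "br' x (br' y z) = br' (br' x y) z + br' y (br' x z)" for x y z
      unfolding br'_def by (simp add: P PL br_closed jacobi[symmetric])
    show "br' x y \<in> span (b ` {..<n})" for x y using br'_closed by (simp add: L)
  qed (fact lin_co, fact co_b)
  have LL: "lie_product.L b n = L" by (simp add: L L_def)
  have "semisimple_lie_algebra br' L"
    unfolding semisimple_lie_algebra_def
  proof (intro allI impI, elim conjE)
    fix I assume I: "lie_ideal br' L I" and sol: "solvable_lie_algebra br' I"
    have sub: "subspace I" "I \<subseteq> L" using I by (auto simp: lie_ideal_def)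
    have ideal: "lie_ideal br L I"
      using I br'_eq unfolding lie_ideal_def by (metis subsetD)
    \<comment> \<open>Semisimplicity speaks only of ideals inside \<open>L\<close> and their derived
      series, so it does not notice the change of bracket off \<open>L\<close>.\<close>
    have "derived_series br' I k = derived_series br I k \<and> derived_series br I k \<subseteq> L" for k
    proof (induction k)
      case 0
      then show ?case using sub by simp
    next
      case (Suc k)
      let ?D = "derived_series br I k"
      have "{br' x y | x y. x \<in> ?D \<and> y \<in> ?D} = {br x y | x y. x \<in> ?D \<and> y \<in> ?D}"
        using Suc br'_eq by (metis (no_types, lifting) subsetD)
      moreover have "span {br x y | x y. x \<in> ?D \<and> y \<in> ?D} \<subseteq> L"
        using Suc br_closed subL by (intro real_vector.span_minimal) auto
      ultimately show ?case using Suc by simp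
    qed
    then have "solvable_lie_algebra br I"
      using sol by (simp add: solvable_lie_algebra_def)
    then show "I = {0}" using ideal semisimple unfolding semisimple_lie_algebra_def by blast
  qed
  then have ss: "semisimple_lie_algebra br' (lie_product.L b n)" by (simp add: LL)
  have "tr (\<lambda>x. D (P x)) = 0"
  proof (rule tr_derivation[OF ss])
    show "linear (\<lambda>x. D (P x))"
      by (rule linearI) (simp_all add: linear_add[OF linP] linear_scale[OF linP] D_add D_scale PL)
    show "D (P x) \<in> lie_product.L b n" for x
      using D_L PL by (simp add: LL)
    show "D (P (br' x y)) = br' (D (P x)) y + br' x (D (P y))" for x y
      by (simp add: br'_def P PL br_closed D_br D_L)
  qed
  moreover have "co i (D (P (b i))) = d i i" if "i < n" for i
    using that by (simp add: Pb D_b linear_sum[OF lin_co] linear_scale[OF lin_co] co_b sum_of_bool_mult)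
  ultimately show ?thesis by (simp add: tr_def)
qed

section \<open>Calculus of smooth maps\<close>

lemma Ck_on_subset: "Ck_on k S f \<Longrightarrow> T \<subseteq> S \<Longrightarrow> Ck_on k T f"
  by (induction k arbitrary: f) (auto intro: continuous_on_subset)

text \<open>Congruence at order \<open>k\<close> is an assumption because \<open>Ck_on_cong\<close>
  is itself proved by induction through this rule; \<open>Ck_on_Suc_intro\<close> then discharges
  it.\<close>

lemma Ck_on_SucI:
  fixes f :: "'a::euclidean_space \<Rightarrow> 'b::euclidean_space"
  assumes "\<And>x. x \<in> S \<Longrightarrow> (f has_derivative f' x) (at x)"
    and "\<And>v. Ck_on k S (\<lambda>x. f' x v)"
    and cong: "\<And>g h :: 'a \<Rightarrow> 'b. (\<And>x. x \<in> S \<Longrightarrow> g x = h x) \<Longrightarrow> Ck_on k S g \<Longrightarrow> Ck_on k S h"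
  shows "Ck_on (Suc k) S f"
proof -
  have d: "f' x = frechet_derivative f (at x)" if "x \<in> S" for x
    using assms(1)[OF that] by (rule frechet_derivative_at)
  have "Ck_on k S (\<lambda>x. frechet_derivative f (at x) v)" for v
    by (rule cong[of "\<lambda>x. f' x v"]) (use d assms(2) in auto)
  then show ?thesis using assms(1) by (auto simp: differentiable_def)
qed

lemma Ck_on_cong:
  fixes f g :: "'a::euclidean_space \<Rightarrow> 'b::euclidean_space"
  assumes "open S" "\<And>x. x \<in> S \<Longrightarrow> f x = g x" "Ck_on k S f"
  shows "Ck_on k S g"
  using assms(2,3)
proof (induction k arbitrary: f g)
  case 0
  then show ?case by (auto cong: continuous_on_cong)
next
  case (Suc k)
  show ?case
  proof (rule Ck_on_SucI)
    fix x assume x: "x \<in> S"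
    have "(f has_derivative frechet_derivative f (at x)) (at x)"
      using Suc.prems(2) x by (simp add: frechet_derivative_works)
    then show "(g has_derivative frechet_derivative f (at x)) (at x)"
      by (rule has_derivative_transform_within_open[OF _ assms(1) x Suc.prems(1)])
  next
    show "Ck_on k S (\<lambda>x. frechet_derivative f (at x) v)" for v
      using Suc.prems by simp
    show "Ck_on k S h" if "\<And>x. x \<in> S \<Longrightarrow> f' x = h x" "Ck_on k S f'" for f' h :: "'a \<Rightarrow> 'b"
      using that by (rule Suc.IH)
  qed
qed

lemma Ck_on_Suc_intro:
  assumes "open S" "\<And>x. x \<in> S \<Longrightarrow> (f has_derivative f' x) (at x)" "\<And>v. Ck_on k S (\<lambda>x. f' x v)"
  shows "Ck_on (Suc k) S f"
  using assms(2,3) by (rule Ck_on_SucI) (assumption | rule Ck_on_cong[OF assms(1)])+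

lemma Ck_on_Suc_deriv:
  "Ck_on (Suc k) S f \<Longrightarrow> x \<in> S \<Longrightarrow> (f has_derivative frechet_derivative f (at x)) (at x)"
  by (simp add: frechet_derivative_works)

lemma Ck_on_SucD: "Ck_on (Suc k) S f \<Longrightarrow> Ck_on k S f"
proof (induction k arbitrary: f)
  case 0
  then have "f differentiable_on S"
    unfolding differentiable_on_def by (simp add: differentiable_at_withinI)
  then show ?case by (simp add: differentiable_imp_continuous_on)
next
  case (Suc k)
  then show ?case by auto
qed

lemma Ck_on_bounded_linear:
  assumes "bounded_linear h" "open S"
  shows "Ck_on k S f \<Longrightarrow> Ck_on k S (\<lambda>x. h (f x))"
proof (induction k arbitrary: f)
  case 0
  then show ?case using assms(1) by (simp add: bounded_linear.continuous_on)
next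
  case (Suc k)
  show ?case
  proof (rule Ck_on_Suc_intro[OF assms(2), where f' = "\<lambda>x v. h (frechet_derivative f (at x) v)"])
    show "((\<lambda>x. h (f x)) has_derivative (\<lambda>v. h (frechet_derivative f (at x) v))) (at x)" if "x \<in> S" for x
      by (rule bounded_linear.has_derivative[OF assms(1) Ck_on_Suc_deriv[OF Suc.prems that]])
  qed (use Suc in auto)
qed

lemma Ck_on_const: "open S \<Longrightarrow> Ck_on k S (\<lambda>x. c)"
proof (induction k arbitrary: c)
  case (Suc k)
  show ?case
    by (rule Ck_on_Suc_intro[OF Suc.prems, where f' = "\<lambda>x v. 0"]) (use Suc in auto)
qed simp

lemma Ck_on_id: "open S \<Longrightarrow> Ck_on k S (\<lambda>x. x)"
proof (cases k)
  case (Suc j)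
  assume "open S"
  then show ?thesis
    unfolding Suc by (intro Ck_on_Suc_intro[where f' = "\<lambda>x v. v"]) (auto intro: Ck_on_const)
qed (auto intro: continuous_on_id)

lemma Ck_on_add: "open S \<Longrightarrow> Ck_on k S f \<Longrightarrow> Ck_on k S g \<Longrightarrow> Ck_on k S (\<lambda>x. f x + g x)"
proof (induction k arbitrary: f g)
  case 0
  then show ?case by (auto intro: continuous_on_add)
next
  case (Suc k)
  show ?case
  proof (rule Ck_on_Suc_intro[OF Suc.prems(1),
        where f' = "\<lambda>x v. frechet_derivative f (at x) v + frechet_derivative g (at x) v"])
    show "((\<lambda>x. f x + g x) has_derivative
        (\<lambda>v. frechet_derivative f (at x) v + frechet_derivative g (at x) v)) (at x)" if "x \<in> S" for x
      using Suc.prems that by (intro has_derivative_add Ck_on_Suc_deriv)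
  qed (use Suc in auto)
qed

lemma Ck_on_sum:
  "open S \<Longrightarrow> (\<And>i. i \<in> A \<Longrightarrow> Ck_on k S (f i)) \<Longrightarrow> Ck_on k S (\<lambda>x. \<Sum>i\<in>A. f i x)"
  by (induction A rule: infinite_finite_induct) (auto intro: Ck_on_const Ck_on_add)

lemma Ck_on_scaleR:
  fixes f :: "'a::euclidean_space \<Rightarrow> real"
  shows "open S \<Longrightarrow> Ck_on k S f \<Longrightarrow> Ck_on k S g \<Longrightarrow> Ck_on k S (\<lambda>x. f x *\<^sub>R g x)"
proof (induction k arbitrary: f g)
  case 0
  then show ?case by (auto intro: continuous_on_scaleR)
next
  case (Suc k)
  have fg: "Ck_on k S f" "Ck_on k S g" using Suc.prems Ck_on_SucD by blast+
  show ?case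
  proof (rule Ck_on_Suc_intro[OF Suc.prems(1),
        where f' = "\<lambda>x v. f x *\<^sub>R frechet_derivative g (at x) v + frechet_derivative f (at x) v *\<^sub>R g x"])
    show "((\<lambda>x. f x *\<^sub>R g x) has_derivative
        (\<lambda>v. f x *\<^sub>R frechet_derivative g (at x) v + frechet_derivative f (at x) v *\<^sub>R g x)) (at x)"
      if "x \<in> S" for x
      using Suc.prems that by (intro has_derivative_scaleR Ck_on_Suc_deriv)
    show "Ck_on k S (\<lambda>x. f x *\<^sub>R frechet_derivative g (at x) v + frechet_derivative f (at x) v *\<^sub>R g x)" for v
      using Suc fg by (intro Ck_on_add Suc.IH) auto
  qed
qed

lemma Ck_on_compose:
  assumes "open S" "open T" "f ` S \<subseteq> T" "Ck_on k S f" "Ck_on k T g"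
  shows "Ck_on k S (\<lambda>x. g (f x))"
  using assms(3-5)
proof (induction k arbitrary: g)
  case 0
  then show ?case by (auto intro: continuous_on_compose2)
next
  case (Suc k)
  let ?f' = "\<lambda>x. frechet_derivative f (at x)" and ?g' = "\<lambda>y. frechet_derivative g (at y)"
  have f: "Ck_on k S f" using Suc.prems Ck_on_SucD by blast
  have g': "(g has_derivative ?g' (f x)) (at (f x))" if "x \<in> S" for x
    using Suc.prems that by (intro Ck_on_Suc_deriv[where S = T]) auto
  have f': "(f has_derivative ?f' x) (at x)" if "x \<in> S" for x
    using Suc.prems that by (intro Ck_on_Suc_deriv[where S = S]) auto
  \<comment> \<open>The recursion controls derivatives in fixed directions only, whereas the chain
    rule evaluates the derivative of \<open>g\<close> in a direction that varies with
    \<open>x\<close>. Expanding that direction in the basis leaves scalar coefficients times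
    derivatives in fixed directions.\<close>
  have eq: "?g' (f x) (?f' x v) = (\<Sum>b\<in>Basis. (?f' x v \<bullet> b) *\<^sub>R ?g' (f x) b)" if "x \<in> S" for x v
  proof -
    interpret bounded_linear "?g' (f x)"
      using g'[OF that] by (rule has_derivative_bounded_linear)
    have "?g' (f x) (?f' x v) = ?g' (f x) (\<Sum>b\<in>Basis. (?f' x v \<bullet> b) *\<^sub>R b)"
      by (simp only: euclidean_representation)
    then show ?thesis by (simp add: sum scaleR)
  qed
  show ?case
  proof (rule Ck_on_Suc_intro[OF assms(1),
        where f' = "\<lambda>x v. \<Sum>b\<in>Basis. (?f' x v \<bullet> b) *\<^sub>R ?g' (f x) b"])
    show "((\<lambda>x. g (f x)) has_derivative (\<lambda>v. \<Sum>b\<in>Basis. (?f' x v \<bullet> b) *\<^sub>R ?g' (f x) b)) (at x)"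
      if "x \<in> S" for x
      using has_derivative_compose[OF f'[OF that] g'[OF that]] by (simp add: eq[OF that])
    show "Ck_on k S (\<lambda>x. \<Sum>b\<in>Basis. (?f' x v \<bullet> b) *\<^sub>R ?g' (f x) b)" for v
      using Suc.prems f
      by (intro Ck_on_sum Ck_on_scaleR assms Ck_on_bounded_linear[OF bounded_linear_inner_left] Suc.IH) auto
  qed
qed

lemma Ck_on_Pair:
  assumes "open S" "Ck_on k S f" "Ck_on k S g"
  shows "Ck_on k S (\<lambda>x. (f x, g x))"
proof -
  have "Ck_on k S (\<lambda>x. (f x, 0) + (0, g x))"
    using assms by (intro Ck_on_add Ck_on_bounded_linear[of "\<lambda>x. (x, 0)"]
        Ck_on_bounded_linear[of "\<lambda>x. (0, x)"] bounded_linear_Pair bounded_linear_ident bounded_linear_zero)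
  then show ?thesis by simp
qed

lemma Ck_on_local:
  assumes "\<And>x. x \<in> S \<Longrightarrow> \<exists>T. open T \<and> x \<in> T \<and> Ck_on k T f"
  shows "Ck_on k S f"
  using assms
proof (induction k arbitrary: f)
  case 0
  have "isCont f x" if "x \<in> S" for x
    using 0[OF that] by (auto simp: continuous_on_eq_continuous_at)
  then show ?case by (simp add: continuous_at_imp_continuous_on)
next
  case (Suc k)
  have "\<exists>T. open T \<and> x \<in> T \<and> Ck_on k T (\<lambda>x. frechet_derivative f (at x) v)" if "x \<in> S" for x v
    using Suc.prems[OF that] by auto
  then have "Ck_on k S (\<lambda>x. frechet_derivative f (at x) v)" for v
    by (rule Suc.IH)
  moreover have "f differentiable (at x)" if "x \<in> S" for x
    using Suc.prems[OF that] by auto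
  ultimately show ?case by simp
qed

section \<open>Smoothness on arbitrary sets\<close>

lemma smooth_on_open:
  assumes "open S"
  shows "smooth_on S f \<longleftrightarrow> (\<forall>k. Ck_on k S f)"
proof
  assume sm: "smooth_on S f"
  show "\<forall>k. Ck_on k S f"
  proof (intro allI Ck_on_local)
    fix k x assume "x \<in> S"
    then obtain T h where T: "open T" "x \<in> T" "\<forall>k. Ck_on k T h" "\<forall>y\<in>S \<inter> T. h y = f y"
      using sm unfolding smooth_on_def by blast
    have "Ck_on k (S \<inter> T) f"
      by (rule Ck_on_cong[of _ h]) (use T assms Ck_on_subset[of k T h "S \<inter> T"] in auto)
    then show "\<exists>T. open T \<and> x \<in> T \<and> Ck_on k T f"
      using T assms \<open>x \<in> S\<close> by (intro exI[of _ "S \<inter> T"]) auto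
  qed
next
  assume "\<forall>k. Ck_on k S f"
  then show "smooth_on S f" unfolding smooth_on_def using assms by blast
qed

lemma smooth_on_subset: "smooth_on S f \<Longrightarrow> T \<subseteq> S \<Longrightarrow> smooth_on T f"
proof -
  assume sm: "smooth_on S f" and sub: "T \<subseteq> S"
  show "smooth_on T f"
    unfolding smooth_on_def
  proof
    fix x assume "x \<in> T"
    then have "x \<in> S" using sub by auto
    then obtain A h where A: "open A" "x \<in> A" "\<forall>k. Ck_on k A h" "\<forall>y\<in>S \<inter> A. h y = f y"
      using sm unfolding smooth_on_def by blast
    then have "\<forall>y\<in>T \<inter> A. h y = f y" using sub by auto
    then show "\<exists>A h. open A \<and> x \<in> A \<and> (\<forall>k. Ck_on k A h) \<and> (\<forall>y\<in>T \<inter> A. h y = f y)"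
      using A by (intro exI[of _ A] exI[of _ h]) simp
  qed
qed

lemma smooth_on_cong: "(\<And>x. x \<in> S \<Longrightarrow> f x = g x) \<Longrightarrow> smooth_on S f \<Longrightarrow> smooth_on S g"
proof -
  assume eq: "\<And>x. x \<in> S \<Longrightarrow> f x = g x" and sm: "smooth_on S f"
  show "smooth_on S g"
    unfolding smooth_on_def
  proof
    fix x assume "x \<in> S"
    then obtain T h where "open T" "x \<in> T" "\<forall>k. Ck_on k T h" "\<forall>y\<in>S \<inter> T. h y = f y"
      using sm unfolding smooth_on_def by blast
    then show "\<exists>T h. open T \<and> x \<in> T \<and> (\<forall>k. Ck_on k T h) \<and> (\<forall>y\<in>S \<inter> T. h y = g y)"
      using eq by (intro exI[of _ T] exI[of _ h]) simp
  qed
qed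

lemma smooth_on_local:
  assumes "\<And>x. x \<in> S \<Longrightarrow> \<exists>U. open U \<and> x \<in> U \<and> smooth_on (S \<inter> U) f"
  shows "smooth_on S f"
  unfolding smooth_on_def
proof
  fix x assume x: "x \<in> S"
  then obtain U where U: "open U" "x \<in> U" "smooth_on (S \<inter> U) f" using assms by blast
  then obtain T h where T: "open T" "x \<in> T" "\<forall>k. Ck_on k T h" "\<forall>y\<in>S \<inter> U \<inter> T. h y = f y"
    using x unfolding smooth_on_def by blast
  have "\<forall>k. Ck_on k (U \<inter> T) h" using T(3) by (auto intro: Ck_on_subset)
  then show "\<exists>T h. open T \<and> x \<in> T \<and> (\<forall>k. Ck_on k T h) \<and> (\<forall>y\<in>S \<inter> T. h y = f y)"
    using U T by (intro exI[of _ "U \<inter> T"] exI[of _ h]) auto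
qed

lemma smooth_on_compose:
  assumes f: "smooth_on S f" and g: "smooth_on T g" and "f ` S \<subseteq> T"
  shows "smooth_on S (\<lambda>x. g (f x))"
  unfolding smooth_on_def
proof
  fix x assume x: "x \<in> S"
  obtain A h where A: "open A" "x \<in> A" "\<forall>k. Ck_on k A h" "\<forall>y\<in>S \<inter> A. h y = f y"
    using f x unfolding smooth_on_def by blast
  have "f x \<in> T" using x assms(3) by auto
  then obtain B k where B: "open B" "f x \<in> B" "\<forall>j. Ck_on j B k" "\<forall>y\<in>T \<inter> B. k y = g y"
    using g unfolding smooth_on_def by blast
  have "continuous_on A h" using A(3) by (metis Ck_on.simps(1))
  then have o: "open (A \<inter> h -` B)" using A(1) B(1) by (rule continuous_open_preimage)
  have "Ck_on j (A \<inter> h -` B) (\<lambda>x. k (h x))" for j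
  proof (rule Ck_on_compose[OF o B(1)])
    show "Ck_on j (A \<inter> h -` B) h" using A(3) by (auto intro: Ck_on_subset)
    show "Ck_on j B k" using B(3) by simp
  qed auto
  moreover have "x \<in> A \<inter> h -` B" using A B x by auto
  moreover have "\<forall>y\<in>S \<inter> (A \<inter> h -` B). k (h y) = g (f y)"
    using A(4) B(4) assms(3) by auto
  ultimately show "\<exists>T h. open T \<and> x \<in> T \<and> (\<forall>k. Ck_on k T h) \<and> (\<forall>y\<in>S \<inter> T. h y = g (f y))"
    using o by (intro exI[of _ "A \<inter> h -` B"] exI[of _ "\<lambda>x. k (h x)"]) auto
qed

lemma smooth_on_Pair:
  assumes f: "smooth_on S f" and g: "smooth_on S g"
  shows "smooth_on S (\<lambda>x. (f x, g x))"
  unfolding smooth_on_def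
proof
  fix x assume x: "x \<in> S"
  obtain A h where A: "open A" "x \<in> A" "\<forall>k. Ck_on k A h" "\<forall>y\<in>S \<inter> A. h y = f y"
    using f x unfolding smooth_on_def by blast
  obtain B k where B: "open B" "x \<in> B" "\<forall>j. Ck_on j B k" "\<forall>y\<in>S \<inter> B. k y = g y"
    using g x unfolding smooth_on_def by blast
  have "Ck_on j (A \<inter> B) (\<lambda>x. (h x, k x))" for j
    using A B by (intro Ck_on_Pair) (auto intro: Ck_on_subset)
  then show "\<exists>T h. open T \<and> x \<in> T \<and> (\<forall>k. Ck_on k T h) \<and> (\<forall>y\<in>S \<inter> T. h y = (f y, g y))"
    using A B by (intro exI[of _ "A \<inter> B"] exI[of _ "\<lambda>x. (h x, k x)"]) auto
qed

lemma smooth_on_const: "smooth_on S (\<lambda>x. c)"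
  using smooth_on_open[of UNIV "\<lambda>x. c"] Ck_on_const[of UNIV] smooth_on_subset[of UNIV] by blast

lemma smooth_on_bounded_linear: "bounded_linear f \<Longrightarrow> smooth_on S f"
  using smooth_on_open[of UNIV f] Ck_on_bounded_linear[of f UNIV _ "\<lambda>x. x"] Ck_on_id[of UNIV]
    smooth_on_subset[of UNIV f S] by auto

lemma smooth_on_id: "smooth_on S (\<lambda>x. x)"
  by (rule smooth_on_bounded_linear[OF bounded_linear_ident])

lemma smooth_on_add:
  assumes "smooth_on S f" "smooth_on S g"
  shows "smooth_on S (\<lambda>x. f x + g x)"
proof -
  have "bounded_linear (\<lambda>p. fst p + snd p)"
    by (intro bounded_linear_add bounded_linear_fst bounded_linear_snd)
  from smooth_on_compose[OF smooth_on_Pair[OF assms] smooth_on_bounded_linear[OF this, of UNIV]]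
  show ?thesis by simp
qed

lemma smooth_on_mult:
  fixes f g :: "'a::euclidean_space \<Rightarrow> real"
  assumes "smooth_on S f" "smooth_on S g"
  shows "smooth_on S (\<lambda>x. f x * g x)"
proof -
  have "Ck_on k UNIV (\<lambda>p::real \<times> real. fst p *\<^sub>R snd p)" for k
    using Ck_on_bounded_linear[OF bounded_linear_fst, of UNIV k "\<lambda>x. x"]
      Ck_on_bounded_linear[OF bounded_linear_snd, of UNIV k "\<lambda>x. x"]
    by (intro Ck_on_scaleR) (auto intro: Ck_on_id)
  then have "smooth_on UNIV (\<lambda>p::real \<times> real. fst p * snd p)"
    by (simp add: smooth_on_open)
  from smooth_on_compose[OF smooth_on_Pair[OF assms] this] show ?thesis by simp
qed

lemma smooth_on_continuous_on: "smooth_on S f \<Longrightarrow> continuous_on S f"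
  unfolding continuous_on_eq_continuous_within
proof
  fix x assume sm: "smooth_on S f" and x: "x \<in> S"
  obtain A h where A: "open A" "x \<in> A" "\<forall>k. Ck_on k A h" "\<forall>y\<in>S \<inter> A. h y = f y"
    using sm x unfolding smooth_on_def by blast
  have "continuous_on A h" using A(3) by (metis Ck_on.simps(1))
  then have c: "continuous (at x within S) h"
    using A by (metis continuous_at_imp_continuous_at_within continuous_on_eq_continuous_at)
  obtain d where d: "0 < d" "\<And>y. dist y x < d \<Longrightarrow> y \<in> A"
    using A(1,2) unfolding open_dist by blast
  show "continuous (at x within S) f"
    by (rule continuous_transform_within[OF c d(1) x]) (use A(4) d(2) in auto)
qed

section \<open>The category of charted spaces\<close>

text \<open>The part of \<open>smooth_manifold\<close> that makes smooth maps a category; unlike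
  manifolds it is trivially stable under products.\<close>

definition charted :: "('a, 'e::euclidean_space) mfd \<Rightarrow> bool" where
  "charted M \<longleftrightarrow>
     (\<Union>(U, \<phi>)\<in>atlas M. U) = topspace (mtop M) \<and>
     (\<forall>(U, \<phi>)\<in>atlas M. openin (mtop M) U \<and>
        homeomorphic_map (subtopology (mtop M) U) (top_of_set (\<phi> ` U)) \<phi>) \<and>
     (\<forall>(U, \<phi>)\<in>atlas M. \<forall>(V, \<psi>)\<in>atlas M. smooth_on (\<phi> ` (U \<inter> V)) (\<psi> \<circ> inv_into U \<phi>))"

lemma chartedI:
  assumes "(\<Union>(U, \<phi>)\<in>atlas M. U) = topspace (mtop M)"
    and "\<And>U \<phi>. (U, \<phi>) \<in> atlas M \<Longrightarrow> openin (mtop M) U"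
    and "\<And>U \<phi>. (U, \<phi>) \<in> atlas M \<Longrightarrow>
      homeomorphic_map (subtopology (mtop M) U) (top_of_set (\<phi> ` U)) \<phi>"
    and "\<And>U \<phi> V \<psi>. (U, \<phi>) \<in> atlas M \<Longrightarrow> (V, \<psi>) \<in> atlas M \<Longrightarrow>
      smooth_on (\<phi> ` (U \<inter> V)) (\<psi> \<circ> inv_into U \<phi>)"
  shows "charted M"
  using assms unfolding charted_def by auto

lemma smooth_manifold_charted: "smooth_manifold M \<Longrightarrow> charted M"
  unfolding smooth_manifold_def charted_def by (auto simp: case_prod_beta)

context
  fixes M :: "('a, 'e::euclidean_space) mfd"
  assumes M: "charted M"
begin

lemma chart_at:
  assumes "p \<in> topspace (mtop M)"
  obtains U \<phi> where "(U, \<phi>) \<in> atlas M" "p \<in> U"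
  using M assms unfolding charted_def by blast

context
  fixes U \<phi> assumes chart: "(U, \<phi>) \<in> atlas M"
begin

lemma chart_open: "openin (mtop M) U"
  and chart_homeomorphic: "homeomorphic_map (subtopology (mtop M) U) (top_of_set (\<phi> ` U)) \<phi>"
  using M chart unfolding charted_def by blast+

lemma chart_subset: "U \<subseteq> topspace (mtop M)"
  using chart_open by (rule openin_subset)

lemma chart_inj: "inj_on \<phi> U"
  using homeomorphic_imp_injective_map[OF chart_homeomorphic] chart_subset
  by (simp add: Int_absorb1)

lemma chart_inv: "p \<in> U \<Longrightarrow> inv_into U \<phi> (\<phi> p) = p"
  using chart_inj by simp

lemma chart_image_open:
  assumes "openin (mtop M) W" "W \<subseteq> U"
  obtains T where "open T" "\<phi> ` W = \<phi> ` U \<inter> T"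
proof -
  have "openin (subtopology (mtop M) U) W"
    using assms by (simp add: openin_subset_topspace_eq openin_open_subtopology[OF chart_open])
  then have "openin (top_of_set (\<phi> ` U)) (\<phi> ` W)"
    using homeomorphic_map_openness_eq[OF chart_homeomorphic] by blast
  then show thesis using that unfolding openin_open by blast
qed

lemma chart_preimage_open:
  assumes "open T"
  shows "openin (mtop M) {p \<in> U. \<phi> p \<in> T}"
proof -
  have "openin (top_of_set (\<phi> ` U)) (\<phi> ` U \<inter> T)" using assms by auto
  from openin_continuous_map_preimage[OF homeomorphic_imp_continuous_map[OF chart_homeomorphic] this]
  have "openin (subtopology (mtop M) U) {p \<in> U. \<phi> p \<in> T}"
    using chart_subset by (simp add: Int_absorb1 cong: conj_cong)
  then show ?thesis by (simp add: openin_open_subtopology[OF chart_open])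
qed

end

lemma chart_transition:
  "(U, \<phi>) \<in> atlas M \<Longrightarrow> (V, \<psi>) \<in> atlas M \<Longrightarrow> smooth_on (\<phi> ` (U \<inter> V)) (\<psi> \<circ> inv_into U \<phi>)"
  using M unfolding charted_def by blast

end

lemma smooth_map_chart:
  "smooth_map M N F \<Longrightarrow> (U, \<phi>) \<in> atlas M \<Longrightarrow> (V, \<psi>) \<in> atlas N \<Longrightarrow>
    smooth_on (\<phi> ` (U \<inter> F -` V)) (\<psi> \<circ> F \<circ> inv_into U \<phi>)"
  unfolding smooth_map_def by blast

lemma smooth_map_continuous: "smooth_map M N F \<Longrightarrow> continuous_map (mtop M) (mtop N) F"
  unfolding smooth_map_def by blast

lemma smooth_map_in: "smooth_map M N F \<Longrightarrow> p \<in> topspace (mtop M) \<Longrightarrow> F p \<in> topspace (mtop N)"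
  using smooth_map_continuous continuous_map_image_subset_topspace by fastforce

lemma smooth_map_cong:
  assumes M: "charted M" and sm: "smooth_map M N F"
    and eq: "\<And>p. p \<in> topspace (mtop M) \<Longrightarrow> F p = G p"
  shows "smooth_map M N G"
  unfolding smooth_map_def
proof (intro conjI ballI; clarify?)
  show "continuous_map (mtop M) (mtop N) G"
    by (rule continuous_map_eq[OF smooth_map_continuous[OF sm] eq])
  fix U \<phi> V \<psi> assume c: "(U, \<phi>) \<in> atlas M" "(V, \<psi>) \<in> atlas N"
  have U: "p \<in> U \<Longrightarrow> F p = G p" for p using chart_subset[OF M c(1)] eq by blast
  have "U \<inter> F -` V = U \<inter> G -` V" using U by auto
  then have "smooth_on (\<phi> ` (U \<inter> G -` V)) (\<psi> \<circ> F \<circ> inv_into U \<phi>)"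
    using smooth_map_chart[OF sm c] by simp
  then show "smooth_on (\<phi> ` (U \<inter> G -` V)) (\<psi> \<circ> G \<circ> inv_into U \<phi>)"
    by (rule smooth_on_cong[rotated]) (auto simp: chart_inv[OF M c(1)] U)
qed

text \<open>Between a chart of the source and one of the target the middle point may run through
  several charts of \<open>N\<close>. Smoothness is therefore checked locally, on the open set
  \<open>T\<close> over which \<open>F\<close> stays in a single chart.\<close>

lemma smooth_map_compose:
  assumes M: "charted M" and N: "charted N"
    and F: "smooth_map M N F" and H: "smooth_map N P H"
  shows "smooth_map M P (\<lambda>p. H (F p))"
  unfolding smooth_map_def
proof (intro conjI ballI; clarify?)
  show "continuous_map (mtop M) (mtop P) (\<lambda>p. H (F p))"
    using continuous_map_compose[OF smooth_map_continuous[OF F] smooth_map_continuous[OF H]]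
    by (simp add: comp_def)
  fix U \<phi> W \<zeta> assume c: "(U, \<phi>) \<in> atlas M" "(W, \<zeta>) \<in> atlas P"
  let ?S = "\<phi> ` (U \<inter> (\<lambda>p. H (F p)) -` W)"
  show "smooth_on ?S (\<zeta> \<circ> (\<lambda>p. H (F p)) \<circ> inv_into U \<phi>)"
  proof (rule smooth_on_local)
    fix x assume "x \<in> ?S"
    then obtain p where p: "p \<in> U" "H (F p) \<in> W" "x = \<phi> p" by auto
    have "F p \<in> topspace (mtop N)"
      using smooth_map_in[OF F] chart_subset[OF M c(1)] p(1) by blast
    then obtain V \<psi> where V: "(V, \<psi>) \<in> atlas N" "F p \<in> V" by (rule chart_at[OF N])
    have "openin (mtop M) {q \<in> U. F q \<in> V}"
      by (rule openin_continuous_map_preimage_gen[OF smooth_map_continuous[OF F]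
            chart_open[OF M c(1)] chart_open[OF N V(1)]])
    then obtain T where T: "open T" "\<phi> ` {q \<in> U. F q \<in> V} = \<phi> ` U \<inter> T"
      by (rule chart_image_open[OF M c(1)]) auto
    have inT: "F q \<in> V" if "q \<in> U" "\<phi> q \<in> T" for q
    proof -
      have "\<phi> q \<in> \<phi> ` {q \<in> U. F q \<in> V}" using that T(2) by auto
      then show ?thesis using inj_onD[OF chart_inj[OF M c(1)]] that(1) by blast
    qed
    have "smooth_on (?S \<inter> T) (\<lambda>y. (\<zeta> \<circ> H \<circ> inv_into V \<psi>) ((\<psi> \<circ> F \<circ> inv_into U \<phi>) y))"
    proof (rule smooth_on_compose[where f = "\<psi> \<circ> F \<circ> inv_into U \<phi>"])
      show "smooth_on (?S \<inter> T) (\<psi> \<circ> F \<circ> inv_into U \<phi>)"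
        by (rule smooth_on_subset[OF smooth_map_chart[OF F c(1) V(1)]]) (use inT in auto)
      show "smooth_on (\<psi> ` (V \<inter> H -` W)) (\<zeta> \<circ> H \<circ> inv_into V \<psi>)"
        by (rule smooth_map_chart[OF H V(1) c(2)])
      show "(\<psi> \<circ> F \<circ> inv_into U \<phi>) ` (?S \<inter> T) \<subseteq> \<psi> ` (V \<inter> H -` W)"
        using inT by (auto simp: chart_inv[OF M c(1)])
    qed
    then have "smooth_on (?S \<inter> T) (\<zeta> \<circ> (\<lambda>p. H (F p)) \<circ> inv_into U \<phi>)"
      by (rule smooth_on_cong[rotated]) (use inT in \<open>auto simp: chart_inv[OF M c(1)] chart_inv[OF N V(1)]\<close>)
    moreover have "x \<in> T"
    proof -
      have "x \<in> \<phi> ` {q \<in> U. F q \<in> V}" using p V(2) by auto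
      then show ?thesis using T(2) by auto
    qed
    ultimately show "\<exists>T. open T \<and> x \<in> T \<and> smooth_on (?S \<inter> T) (\<zeta> \<circ> (\<lambda>p. H (F p)) \<circ> inv_into U \<phi>)"
      using T(1) by blast
  qed
qed

section \<open>Products and Euclidean sets as charted spaces\<close>

lemma mtop_prod_mfd [simp]: "mtop (prod_mfd M N) = prod_topology (mtop M) (mtop N)"
  and atlas_prod_mfd: "atlas (prod_mfd M N) =
    {(U \<times> V, map_prod \<phi> \<psi>) | U \<phi> V \<psi>. (U, \<phi>) \<in> atlas M \<and> (V, \<psi>) \<in> atlas N}"
  by (simp_all add: prod_mfd_def)

lemma mtop_euc_mfd [simp]: "mtop (euc_mfd S) = top_of_set S"
  and atlas_euc_mfd: "atlas (euc_mfd S) = {(S, \<lambda>x. x)}"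
  by (simp_all add: euc_mfd_def)

lemma inv_into_map_prod:
  assumes "inj_on \<phi> U" "inj_on \<psi> V" "p \<in> U" "q \<in> V"
  shows "inv_into (U \<times> V) (map_prod \<phi> \<psi>) (\<phi> p, \<psi> q) = (p, q)"
proof -
  have "inj_on (map_prod \<phi> \<psi>) (U \<times> V)" using assms(1,2) by (rule map_prod_inj_on)
  from inv_into_f_f[OF this, of "(p, q)"] show ?thesis using assms(3,4) by simp
qed

lemma smooth_on_map_prod:
  assumes "smooth_on A f" "smooth_on B g"
  shows "smooth_on (A \<times> B) (\<lambda>z. (f (fst z), g (snd z)))"
proof (rule smooth_on_Pair)
  show "smooth_on (A \<times> B) (\<lambda>z. f (fst z))"
    by (rule smooth_on_compose[OF smooth_on_bounded_linear[OF bounded_linear_fst] assms(1)]) auto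
  show "smooth_on (A \<times> B) (\<lambda>z. g (snd z))"
    by (rule smooth_on_compose[OF smooth_on_bounded_linear[OF bounded_linear_snd] assms(2)]) auto
qed

lemma charted_prod_mfd:
  assumes M: "charted M" and N: "charted N"
  shows "charted (prod_mfd M N)"
proof (rule chartedI)
  have "(\<Union>(U, \<phi>)\<in>atlas (prod_mfd M N). U) = (\<Union>(U, \<phi>)\<in>atlas M. U) \<times> (\<Union>(U, \<phi>)\<in>atlas N. U)"
    unfolding atlas_prod_mfd by fast
  then show "(\<Union>(U, \<phi>)\<in>atlas (prod_mfd M N). U) = topspace (mtop (prod_mfd M N))"
    using M N unfolding charted_def by simp
next
  fix W \<theta> assume "(W, \<theta>) \<in> atlas (prod_mfd M N)"
  then obtain U \<phi> V \<psi> where c: "(U, \<phi>) \<in> atlas M" "(V, \<psi>) \<in> atlas N"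
    and W: "W = U \<times> V" "\<theta> = map_prod \<phi> \<psi>"
    unfolding atlas_prod_mfd by blast
  show "openin (mtop (prod_mfd M N)) W"
    using chart_open[OF M c(1)] chart_open[OF N c(2)] by (simp add: W openin_prod_Times_iff)
  obtain f where f: "homeomorphic_maps (subtopology (mtop M) U) (top_of_set (\<phi> ` U)) \<phi> f"
    using chart_homeomorphic[OF M c(1)] unfolding homeomorphic_map_maps by blast
  obtain g where g: "homeomorphic_maps (subtopology (mtop N) V) (top_of_set (\<psi> ` V)) \<psi> g"
    using chart_homeomorphic[OF N c(2)] unfolding homeomorphic_map_maps by blast
  have "homeomorphic_maps (prod_topology (subtopology (mtop M) U) (subtopology (mtop N) V))
      (prod_topology (top_of_set (\<phi> ` U)) (top_of_set (\<psi> ` V)))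
      (\<lambda>(x, y). (\<phi> x, \<psi> y)) (\<lambda>(x, y). (f x, g y))"
    unfolding homeomorphic_maps_prod using f g by blast
  moreover have "\<theta> ` W = \<phi> ` U \<times> \<psi> ` V" by (auto simp: W)
  moreover have "\<theta> = (\<lambda>(x, y). (\<phi> x, \<psi> y))" by (auto simp: W)
  ultimately show "homeomorphic_map (subtopology (mtop (prod_mfd M N)) W) (top_of_set (\<theta> ` W)) \<theta>"
    by (auto simp: W(1) subtopology_Times homeomorphic_map_maps)
next
  fix W \<theta> W' \<theta>'
  assume "(W, \<theta>) \<in> atlas (prod_mfd M N)" "(W', \<theta>') \<in> atlas (prod_mfd M N)"
  then obtain U \<phi> V \<psi> U' \<phi>' V' \<psi>' where c: "(U, \<phi>) \<in> atlas M" "(V, \<psi>) \<in> atlas N"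
    and c': "(U', \<phi>') \<in> atlas M" "(V', \<psi>') \<in> atlas N"
    and W: "W = U \<times> V" "\<theta> = map_prod \<phi> \<psi>" and W': "W' = U' \<times> V'" "\<theta>' = map_prod \<phi>' \<psi>'"
    unfolding atlas_prod_mfd by blast
  have im: "\<theta> ` (W \<inter> W') = \<phi> ` (U \<inter> U') \<times> \<psi> ` (V \<inter> V')"
    by (auto simp: W W')
  have "smooth_on (\<theta> ` (W \<inter> W'))
      (\<lambda>z. ((\<phi>' \<circ> inv_into U \<phi>) (fst z), (\<psi>' \<circ> inv_into V \<psi>) (snd z)))"
    unfolding im by (intro smooth_on_map_prod chart_transition[OF M c(1) c'(1)] chart_transition[OF N c(2) c'(2)])
  then show "smooth_on (\<theta> ` (W \<inter> W')) (\<theta>' \<circ> inv_into W \<theta>)"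
  proof (rule smooth_on_cong[rotated])
    fix z assume "z \<in> \<theta> ` (W \<inter> W')"
    then obtain p q where "p \<in> U" "q \<in> V" "z = (\<phi> p, \<psi> q)" by (auto simp: W)
    then show "((\<phi>' \<circ> inv_into U \<phi>) (fst z), (\<psi>' \<circ> inv_into V \<psi>) (snd z)) = (\<theta>' \<circ> inv_into W \<theta>) z"
      by (simp add: W W' inv_into_map_prod chart_inj[OF M c(1)] chart_inj[OF N c(2)])
  qed
qed

lemma charted_euc_mfd: "charted (euc_mfd S)"
proof -
  have "inv_into S (\<lambda>x. x) y = y" if "y \<in> S" for y
    using inv_into_f_f[of "\<lambda>x. x" S y] that by (simp add: inj_on_def)
  then have "smooth_on S ((\<lambda>x. x) \<circ> inv_into S (\<lambda>x. x))"
    by (intro smooth_on_cong[OF _ smooth_on_id]) auto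
  moreover have "homeomorphic_map (top_of_set S) (top_of_set S) (\<lambda>x. x)"
    using homeomorphic_map_id[of "top_of_set S" "top_of_set S"] by (simp add: id_def)
  ultimately show ?thesis
    by (simp add: charted_def atlas_euc_mfd subtopology_subtopology)
qed

text \<open>Turns maps of several real parameters into maps on one Euclidean set, where partial
  derivatives are available.\<close>

lemma prod_euc_mfd: "prod_mfd (euc_mfd S) (euc_mfd T) = euc_mfd (S \<times> T)"
proof -
  have "map_prod (\<lambda>x. x) (\<lambda>x. x) = (\<lambda>x::'a \<times> 'b. x)" by (auto simp: fun_eq_iff)
  then show ?thesis by (simp add: prod_mfd_def euc_mfd_def)
qed

lemma inv_into_ident: "y \<in> S \<Longrightarrow> inv_into S (\<lambda>x. x) y = y"
  using inv_into_f_f[of "\<lambda>x. x" S y] by (simp add: inj_on_def)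

lemma smooth_map_euc:
  "smooth_map (euc_mfd S) (euc_mfd T) f \<longleftrightarrow> smooth_on S f \<and> f ` S \<subseteq> T"
proof
  assume sm: "smooth_map (euc_mfd S) (euc_mfd T) f"
  have T: "f ` S \<subseteq> T"
    using smooth_map_in[OF sm] by auto
  have "smooth_on ((\<lambda>x. x) ` (S \<inter> f -` T)) ((\<lambda>x. x) \<circ> f \<circ> inv_into S (\<lambda>x. x))"
    by (rule smooth_map_chart[OF sm]) (simp_all add: atlas_euc_mfd)
  moreover have "(\<lambda>x. x) ` (S \<inter> f -` T) = S" using T by auto
  ultimately have "smooth_on S ((\<lambda>x. x) \<circ> f \<circ> inv_into S (\<lambda>x. x))" by simp
  then have "smooth_on S f"
    by (rule smooth_on_cong[rotated]) (simp add: inv_into_ident)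
  then show "smooth_on S f \<and> f ` S \<subseteq> T" using T by simp
next
  assume sm: "smooth_on S f \<and> f ` S \<subseteq> T"
  have "smooth_on S ((\<lambda>x. x) \<circ> f \<circ> inv_into S (\<lambda>x. x))"
    by (rule smooth_on_cong[of S f]) (use sm in \<open>auto simp: inv_into_ident\<close>)
  moreover have "(\<lambda>x. x) ` (S \<inter> f -` T) = S" using sm by auto
  moreover have "continuous_on S f" using sm by (simp add: smooth_on_continuous_on)
  ultimately show "smooth_map (euc_mfd S) (euc_mfd T) f"
    using sm by (simp add: smooth_map_def atlas_euc_mfd continuous_map_in_subtopology image_subset_iff_funcset)
qed

lemma smooth_map_Pair:
  assumes F: "smooth_map M N F" and G: "smooth_map M P G"
  shows "smooth_map M (prod_mfd N P) (\<lambda>p. (F p, G p))"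
  unfolding smooth_map_def
proof (intro conjI ballI; clarify?)
  show "continuous_map (mtop M) (mtop (prod_mfd N P)) (\<lambda>p. (F p, G p))"
    using smooth_map_continuous[OF F] smooth_map_continuous[OF G]
    by (simp add: continuous_map_pairedI)
  fix U \<phi> W \<theta> assume c: "(U, \<phi>) \<in> atlas M" and "(W, \<theta>) \<in> atlas (prod_mfd N P)"
  then obtain V \<psi> V' \<psi>' where c': "(V, \<psi>) \<in> atlas N" "(V', \<psi>') \<in> atlas P"
    and W: "W = V \<times> V'" "\<theta> = map_prod \<psi> \<psi>'"
    unfolding atlas_prod_mfd by blast
  let ?S = "\<phi> ` (U \<inter> (\<lambda>p. (F p, G p)) -` W)"
  have "smooth_on ?S (\<psi> \<circ> F \<circ> inv_into U \<phi>)"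
    by (rule smooth_on_subset[OF smooth_map_chart[OF F c c'(1)]]) (auto simp: W)
  moreover have "smooth_on ?S (\<psi>' \<circ> G \<circ> inv_into U \<phi>)"
    by (rule smooth_on_subset[OF smooth_map_chart[OF G c c'(2)]]) (auto simp: W)
  ultimately show "smooth_on ?S (\<theta> \<circ> (\<lambda>p. (F p, G p)) \<circ> inv_into U \<phi>)"
    using smooth_on_Pair by (fastforce simp: W comp_def)
qed

lemma smooth_map_id: "charted M \<Longrightarrow> smooth_map M M (\<lambda>p. p)"
proof -
  assume M: "charted M"
  have "smooth_on (\<phi> ` (U \<inter> V)) (\<psi> \<circ> (\<lambda>p. p) \<circ> inv_into U \<phi>)"
    if "(U, \<phi>) \<in> atlas M" "(V, \<psi>) \<in> atlas M" for U \<phi> V \<psi>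
    using chart_transition[OF M that] by (simp add: comp_def)
  then show ?thesis by (auto simp: smooth_map_def)
qed

lemma smooth_map_fst_snd:
  assumes M: "charted M" and N: "charted N"
  shows "smooth_map (prod_mfd M N) M fst" "smooth_map (prod_mfd M N) N snd"
proof -
  have im: "map_prod \<phi> \<psi> ` ((U \<times> V) \<inter> fst -` U') = \<phi> ` (U \<inter> U') \<times> \<psi> ` V"
    "map_prod \<phi> \<psi> ` ((U \<times> V) \<inter> snd -` V') = \<phi> ` U \<times> \<psi> ` (V \<inter> V')"
    for \<phi> :: "'a \<Rightarrow> 'b" and \<psi> :: "'c \<Rightarrow> 'd" and U U' V V'
    by force+
  show "smooth_map (prod_mfd M N) M fst"
    unfolding smooth_map_def
  proof (intro conjI ballI; clarify?)
    show "continuous_map (mtop (prod_mfd M N)) (mtop M) fst" by (simp add: continuous_map_fst)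
    fix W \<theta> U' \<phi>' assume "(W, \<theta>) \<in> atlas (prod_mfd M N)" and c': "(U', \<phi>') \<in> atlas M"
    then obtain U \<phi> V \<psi> where c: "(U, \<phi>) \<in> atlas M" "(V, \<psi>) \<in> atlas N"
      and W: "W = U \<times> V" "\<theta> = map_prod \<phi> \<psi>"
      unfolding atlas_prod_mfd by blast
    have "smooth_on (\<phi> ` (U \<inter> U') \<times> \<psi> ` V) (\<lambda>z. (\<phi>' \<circ> inv_into U \<phi>) (fst z))"
      by (rule smooth_on_compose[OF smooth_on_bounded_linear[OF bounded_linear_fst] chart_transition[OF M c(1) c']]) auto
    then show "smooth_on (\<theta> ` (W \<inter> fst -` U')) (\<phi>' \<circ> fst \<circ> inv_into W \<theta>)"
      unfolding W im
      by (rule smooth_on_cong[rotated]) (auto simp: inv_into_map_prod chart_inj[OF M c(1)] chart_inj[OF N c(2)])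
  qed
  show "smooth_map (prod_mfd M N) N snd"
    unfolding smooth_map_def
  proof (intro conjI ballI; clarify?)
    show "continuous_map (mtop (prod_mfd M N)) (mtop N) snd" by (simp add: continuous_map_snd)
    fix W \<theta> V' \<psi>' assume "(W, \<theta>) \<in> atlas (prod_mfd M N)" and c': "(V', \<psi>') \<in> atlas N"
    then obtain U \<phi> V \<psi> where c: "(U, \<phi>) \<in> atlas M" "(V, \<psi>) \<in> atlas N"
      and W: "W = U \<times> V" "\<theta> = map_prod \<phi> \<psi>"
      unfolding atlas_prod_mfd by blast
    have "smooth_on (\<phi> ` U \<times> \<psi> ` (V \<inter> V')) (\<lambda>z. (\<psi>' \<circ> inv_into V \<psi>) (snd z))"
      by (rule smooth_on_compose[OF smooth_on_bounded_linear[OF bounded_linear_snd] chart_transition[OF N c(2) c']]) auto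
    then show "smooth_on (\<theta> ` (W \<inter> snd -` V')) (\<psi>' \<circ> snd \<circ> inv_into W \<theta>)"
      unfolding W im
      by (rule smooth_on_cong[rotated]) (auto simp: inv_into_map_prod chart_inj[OF M c(1)] chart_inj[OF N c(2)])
  qed
qed

lemma smooth_map_const: "c \<in> topspace (mtop N) \<Longrightarrow> smooth_map M N (\<lambda>p. c)"
  by (auto simp: smooth_map_def comp_def intro: smooth_on_const)

text \<open>The continuity demanded by \<open>smooth_map\<close> follows from smoothness in charts,
  as charts are homeomorphisms from open sets onto their images.\<close>

lemma smooth_funI:
  assumes M: "charted M"
    and sm: "\<And>U \<phi>. (U, \<phi>) \<in> atlas M \<Longrightarrow> smooth_on (\<phi> ` U) (f \<circ> inv_into U \<phi>)"
  shows "f \<in> smooth_fun M"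
  unfolding smooth_fun_def smooth_map_def
proof (intro CollectI conjI ballI; clarify?)
  show "continuous_map (mtop M) (mtop (euc_mfd UNIV)) f"
    unfolding continuous_map_def
  proof (intro conjI allI impI)
    fix T :: "real set" assume "openin (mtop (euc_mfd UNIV)) T"
    then have T: "open T" by simp
    show "openin (mtop M) {p \<in> topspace (mtop M). f p \<in> T}"
    proof (subst openin_subopen, intro ballI)
      fix p assume p: "p \<in> {p \<in> topspace (mtop M). f p \<in> T}"
      then obtain U \<phi> where c: "(U, \<phi>) \<in> atlas M" "p \<in> U" using chart_at[OF M] by blast
      have "continuous_on (\<phi> ` U) (f \<circ> inv_into U \<phi>)"
        using sm[OF c(1)] by (rule smooth_on_continuous_on)
      then obtain A where A: "open A" "A \<inter> \<phi> ` U = (f \<circ> inv_into U \<phi>) -` T \<inter> \<phi> ` U"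
        using T unfolding continuous_on_open_invariant by blast
      have eq: "\<phi> q \<in> A \<longleftrightarrow> f q \<in> T" if "q \<in> U" for q
      proof -
        have "\<phi> q \<in> A \<inter> \<phi> ` U \<longleftrightarrow> \<phi> q \<in> (f \<circ> inv_into U \<phi>) -` T \<inter> \<phi> ` U"
          using A(2) by simp
        then show ?thesis using that by (simp add: chart_inv[OF M c(1) that])
      qed
      have "openin (mtop M) {q \<in> U. \<phi> q \<in> A}" by (rule chart_preimage_open[OF M c(1) A(1)])
      then show "\<exists>S. openin (mtop M) S \<and> p \<in> S \<and> S \<subseteq> {p \<in> topspace (mtop M). f p \<in> T}"
        using p c(2) eq chart_subset[OF M c(1)] by (intro exI[of _ "{q \<in> U. \<phi> q \<in> A}"]) auto
    qed
  qed simp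
  fix U \<phi> V and \<psi> :: "real \<Rightarrow> real"
  assume "(U, \<phi>) \<in> atlas M" "(V, \<psi>) \<in> atlas (euc_mfd UNIV)"
  then show "smooth_on (\<phi> ` (U \<inter> f -` V)) (\<psi> \<circ> f \<circ> inv_into U \<phi>)"
    using sm by (simp add: atlas_euc_mfd comp_def)
qed

lemma smooth_funD: "f \<in> smooth_fun M \<Longrightarrow> smooth_map M (euc_mfd UNIV) f"
  by (simp add: smooth_fun_def)

lemma smooth_fun_chart:
  "f \<in> smooth_fun M \<Longrightarrow> (U, \<phi>) \<in> atlas M \<Longrightarrow> smooth_on (\<phi> ` U) (f \<circ> inv_into U \<phi>)"
  using smooth_map_chart[OF smooth_funD, of f M U \<phi> UNIV "\<lambda>x. x"] by (simp add: atlas_euc_mfd comp_def)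

lemma smooth_fun_compose:
  "charted M \<Longrightarrow> charted N \<Longrightarrow> smooth_map M N F \<Longrightarrow> f \<in> smooth_fun N \<Longrightarrow> (\<lambda>p. f (F p)) \<in> smooth_fun M"
  unfolding smooth_fun_def using smooth_map_compose by blast

lemma smooth_fun_cong:
  "charted M \<Longrightarrow> (\<And>p. p \<in> topspace (mtop M) \<Longrightarrow> f p = g p) \<Longrightarrow> f \<in> smooth_fun M \<longleftrightarrow> g \<in> smooth_fun M"
  unfolding smooth_fun_def using smooth_map_cong[of M _ f g] smooth_map_cong[of M _ g f] by auto

lemma smooth_fun_const: "(\<lambda>p. c) \<in> smooth_fun M"
  by (simp add: smooth_fun_def smooth_map_const)

lemma smooth_fun_add:
  assumes "charted M" "f \<in> smooth_fun M" "g \<in> smooth_fun M"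
  shows "(\<lambda>p. f p + g p) \<in> smooth_fun M"
  using smooth_on_add[OF smooth_fun_chart[OF assms(2)] smooth_fun_chart[OF assms(3)]]
  by (intro smooth_funI[OF assms(1)]) (simp add: comp_def)

lemma smooth_fun_scale:
  assumes "charted M" "f \<in> smooth_fun M"
  shows "(\<lambda>p. c * f p) \<in> smooth_fun M"
  using smooth_on_mult[OF smooth_on_const smooth_fun_chart[OF assms(2)]]
  by (intro smooth_funI[OF assms(1)]) (simp add: comp_def)

text \<open>Smooth dependence of a derivative on parameters. In a chart, \<open>F\<close> extends
  locally to a smooth \<open>h\<close> on an open set, and the derivative of \<open>h\<close> in
  direction (0, 1) is smooth. For a chart point \<open>y\<close> the segment (y, t) with small t
  stays in the domain of \<open>F\<close>, so the choice of the extension does not affect the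
  value.\<close>

lemma smooth_fun_partial:
  assumes M: "charted M" and \<epsilon>: "\<epsilon> > 0"
    and F: "F \<in> smooth_fun (prod_mfd M (euc_mfd {-\<epsilon><..<\<epsilon>}))"
  shows "(\<lambda>p. deriv (\<lambda>t. F (p, t)) 0) \<in> smooth_fun M"
proof (rule smooth_funI[OF M])
  let ?I = "{-\<epsilon><..<\<epsilon>}"
  fix U \<phi> assume c: "(U, \<phi>) \<in> atlas M"
  have "smooth_on (map_prod \<phi> (\<lambda>t. t) ` (U \<times> ?I)) (F \<circ> inv_into (U \<times> ?I) (map_prod \<phi> (\<lambda>t. t)))"
    by (rule smooth_fun_chart[OF F]) (use c in \<open>auto simp: atlas_prod_mfd atlas_euc_mfd\<close>)
  then have "smooth_on (\<phi> ` U \<times> ?I) (F \<circ> inv_into (U \<times> ?I) (map_prod \<phi> (\<lambda>t. t)))"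
    by (simp add: map_prod_surj_on)
  then have sm: "smooth_on (\<phi> ` U \<times> ?I) (\<lambda>z. F (inv_into U \<phi> (fst z), snd z))"
    by (rule smooth_on_cong[rotated])
      (auto simp: inv_into_map_prod[OF chart_inj[OF M c] inj_on_id2] chart_inv[OF M c])
  show "smooth_on (\<phi> ` U) ((\<lambda>p. deriv (\<lambda>t. F (p, t)) 0) \<circ> inv_into U \<phi>)"
    unfolding smooth_on_def
  proof
    fix x assume x: "x \<in> \<phi> ` U"
    then have "(x, 0) \<in> \<phi> ` U \<times> ?I" using \<epsilon> by auto
    then obtain T h where T: "open T" "(x, 0) \<in> T" "\<forall>k. Ck_on k T h"
      and h: "\<forall>z\<in>\<phi> ` U \<times> ?I \<inter> T. h z = F (inv_into U \<phi> (fst z), snd z)"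
      using sm unfolding smooth_on_def by blast
    define A where "A = (\<lambda>y. (y, 0::real)) -` T"
    have A: "open A" "x \<in> A"
      using T by (auto simp: A_def intro!: open_vimage continuous_intros)
    define d where "d y = frechet_derivative h (at (y, 0)) (0, 1)" for y
    have "Ck_on k A d" for k
      unfolding d_def
    proof (rule Ck_on_compose[OF A(1) T(1)])
      show "(\<lambda>y. (y, 0)) ` A \<subseteq> T" by (auto simp: A_def)
      show "Ck_on k A (\<lambda>y. (y, 0))"
        by (intro Ck_on_Pair Ck_on_id Ck_on_const A)
      show "Ck_on k T (\<lambda>z. frechet_derivative h (at z) (0, 1))"
        using T(3)[THEN spec, of "Suc k"] by simp
    qed
    moreover have "d y = deriv (\<lambda>t. F (inv_into U \<phi> y, t)) 0" if y: "y \<in> \<phi> ` U \<inter> A" for y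
    proof -
      have yT: "(y, 0) \<in> T" using y by (simp add: A_def)
      have "(h has_derivative frechet_derivative h (at (y, 0))) (at (y, 0))"
        using T(3)[THEN spec, of 1] yT Ck_on_Suc_deriv[of 0 T h "(y, 0)"] by simp
      moreover have "((\<lambda>t::real. (y, t)) has_derivative (\<lambda>t. (0, t))) (at 0)"
        by (auto intro!: derivative_eq_intros)
      ultimately have "((\<lambda>t. h (y, t)) has_derivative (\<lambda>t. frechet_derivative h (at (y, 0)) (0, t))) (at 0)"
        using has_derivative_compose[of "\<lambda>t. (y, t)" "\<lambda>t. (0, t)" 0 UNIV h] by simp
      moreover have "frechet_derivative h (at (y, 0)) (0, t) = d y * t" for t
      proof -
        have "linear (frechet_derivative h (at (y, 0)))"
          using \<open>(h has_derivative _) _\<close> has_derivative_linear by blast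
        from linear_scale[OF this, of t "(0, 1)"] show ?thesis by (simp add: d_def mult.commute)
      qed
      ultimately have "((\<lambda>t. h (y, t)) has_real_derivative d y) (at 0)"
        by (simp add: has_field_derivative_def)
      moreover have "open ((\<lambda>t. (y, t)) -` T \<inter> ?I)"
        using T(1) by (intro open_Int open_vimage continuous_intros) auto
      ultimately have "((\<lambda>t. F (inv_into U \<phi> y, t)) has_real_derivative d y) (at 0)"
        by (rule has_field_derivative_transform_within_open) (use yT \<epsilon> y h in auto)
      then show ?thesis by (simp add: DERIV_imp_deriv)
    qed
    ultimately show "\<exists>T h. open T \<and> x \<in> T \<and> (\<forall>k. Ck_on k T h) \<and>
        (\<forall>y\<in>\<phi> ` U \<inter> T. h y = ((\<lambda>p. deriv (\<lambda>t. F (p, t)) 0) \<circ> inv_into U \<phi>) y)"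
      using A by (intro exI[of _ A] exI[of _ d]) simp
  qed
qed

section \<open>Tangent spaces of Lie groups\<close>

text \<open>The clause on the diagonal is the source of all product rules below: the factors of a
  product of curves receive separate parameters, which are then set equal.\<close>

lemma smooth_on_partials:
  fixes q :: "real \<times> real \<Rightarrow> real"
  assumes "open A" "smooth_on A q"
  obtains q1 q2 where "smooth_on A q1" "smooth_on A q2"
    and "\<And>s t. (s, t) \<in> A \<Longrightarrow> ((\<lambda>s. q (s, t)) has_real_derivative q1 (s, t)) (at s)"
    and "\<And>s t. (s, t) \<in> A \<Longrightarrow> ((\<lambda>t. q (s, t)) has_real_derivative q2 (s, t)) (at t)"
    and "\<And>s. (s, s) \<in> A \<Longrightarrow> ((\<lambda>s. q (s, s)) has_real_derivative q1 (s, s) + q2 (s, s)) (at s)"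
proof -
  let ?D = "\<lambda>z. frechet_derivative q (at z)"
  have Ck: "Ck_on (Suc k) A q" for k using assms smooth_on_open by blast
  have sm: "smooth_on A (\<lambda>z. ?D z v)" for v
    unfolding smooth_on_open[OF assms(1)] using Ck unfolding Ck_on.simps by blast
  have der: "(q has_derivative ?D z) (at z)" if "z \<in> A" for z
    using Ck that by (rule Ck_on_Suc_deriv)
  \<comment> \<open>The line through (s, t) is parametrised so that for a, b in {0, 1} a moving
    coordinate simplifies to \<open>r\<close> and a resting one to its constant value.\<close>
  have dir: "((\<lambda>r. q (s + r * a - s * a, t + r * b - t * b)) has_real_derivative ?D (s, t) (a, b)) (at r0)"
    if "(s, t) \<in> A" "s + r0 * a - s * a = s" "t + r0 * b - t * b = t" for s t a b r0
  proof -
    have "((\<lambda>r. (s + r * a - s * a, t + r * b - t * b)) has_derivative (\<lambda>r. r *\<^sub>R (a, b))) (at r0)"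
      by (auto intro!: derivative_eq_intros)
    moreover have "(q has_derivative ?D (s, t)) (at (s + r0 * a - s * a, t + r0 * b - t * b))"
      unfolding that(2,3) using der[OF that(1)] .
    ultimately have "((\<lambda>r. q (s + r * a - s * a, t + r * b - t * b)) has_derivative
        (\<lambda>r. ?D (s, t) (r *\<^sub>R (a, b)))) (at r0)"
      by (rule has_derivative_compose)
    moreover have "?D (s, t) (r *\<^sub>R (a, b)) = ?D (s, t) (a, b) * r" for r
      using linear_scale[OF has_derivative_linear[OF der[OF that(1)]], of r "(a, b)"]
      by (simp add: mult.commute)
    ultimately show ?thesis by (simp add: has_field_derivative_def)
  qed
  show thesis
  proof (rule that[of "\<lambda>z. ?D z (1, 0)" "\<lambda>z. ?D z (0, 1)", OF sm sm])
    show "((\<lambda>s. q (s, t)) has_real_derivative ?D (s, t) (1, 0)) (at s)" if "(s, t) \<in> A" for s t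
      using dir[OF that, of s 1 0] by simp
    show "((\<lambda>t. q (s, t)) has_real_derivative ?D (s, t) (0, 1)) (at t)" if "(s, t) \<in> A" for s t
      using dir[OF that, of t 0 1] by simp
    show "((\<lambda>s. q (s, s)) has_real_derivative ?D (s, s) (1, 0) + ?D (s, s) (0, 1)) (at s)"
      if "(s, s) \<in> A" for s
    proof -
      have "?D (s, s) ((1, 0) + (0, 1)) = ?D (s, s) (1, 0) + ?D (s, s) (0, 1)"
        by (rule linear_add[OF has_derivative_linear[OF der[OF that]]])
      then show ?thesis using dir[OF that, of s 1 1] by simp
    qed
  qed
qed

text \<open>Schwarz's theorem: both mixed derivatives are the limit of the second difference
  quotient of \<open>q\<close> over the square with side \<open>h\<close>.\<close>

lemma mixed_partials:
  fixes q :: "real \<times> real \<Rightarrow> real"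
  assumes \<epsilon>: "\<epsilon> > 0" and sm: "smooth_on ({-\<epsilon><..<\<epsilon>} \<times> {-\<epsilon><..<\<epsilon>}) q"
  shows "deriv (\<lambda>s. deriv (\<lambda>t. q (s, t)) 0) 0 = deriv (\<lambda>t. deriv (\<lambda>s. q (s, t)) 0) 0"
proof -
  let ?I = "{-\<epsilon><..<\<epsilon>}"
  let ?A = "?I \<times> ?I"
  have A: "open ?A" by (simp add: open_Times)
  obtain q1 q2 where q1: "smooth_on ?A q1" and q2: "smooth_on ?A q2"
    and d1: "\<And>s t. (s, t) \<in> ?A \<Longrightarrow> ((\<lambda>s. q (s, t)) has_real_derivative q1 (s, t)) (at s)"
    and d2: "\<And>s t. (s, t) \<in> ?A \<Longrightarrow> ((\<lambda>t. q (s, t)) has_real_derivative q2 (s, t)) (at t)"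
    by (rule smooth_on_partials[OF A sm]) blast
  obtain q11 q12 where q12: "smooth_on ?A q12"
    and d12: "\<And>s t. (s, t) \<in> ?A \<Longrightarrow> ((\<lambda>t. q1 (s, t)) has_real_derivative q12 (s, t)) (at t)"
    by (rule smooth_on_partials[OF A q1]) blast
  obtain q21 q22 where q21: "smooth_on ?A q21"
    and d21: "\<And>s t. (s, t) \<in> ?A \<Longrightarrow> ((\<lambda>s. q2 (s, t)) has_real_derivative q21 (s, t)) (at s)"
    by (rule smooth_on_partials[OF A q2]) blast
  have sq: "\<exists>x\<in>{0<..<h} \<times> {0<..<h}. \<exists>y\<in>{0<..<h} \<times> {0<..<h}. q12 x = q21 y" if h: "0 < h" "h < \<epsilon>" for h
  proof -
    let ?d = "q (h, h) - q (h, 0) - (q (0, h) - q (0, 0))"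
    have "\<exists>s. 0 < s \<and> s < h \<and> (q (h, h) - q (h, 0)) - (q (0, h) - q (0, 0)) = (h - 0) * (q1 (s, h) - q1 (s, 0))"
      by (rule MVT2[of 0 h "\<lambda>s. q (s, h) - q (s, 0)"]) (use h in \<open>auto intro!: DERIV_diff d1\<close>)
    then obtain s where s: "0 < s" "s < h" "?d = h * (q1 (s, h) - q1 (s, 0))" by auto
    have "\<exists>t. 0 < t \<and> t < h \<and> q1 (s, h) - q1 (s, 0) = (h - 0) * q12 (s, t)"
      by (rule MVT2[of 0 h "\<lambda>t. q1 (s, t)"]) (use h s in \<open>auto intro!: d12\<close>)
    then obtain t where t: "0 < t" "t < h" "q1 (s, h) - q1 (s, 0) = h * q12 (s, t)" by auto
    have "\<exists>s. 0 < s \<and> s < h \<and> (q (h, h) - q (0, h)) - (q (h, 0) - q (0, 0)) = (h - 0) * (q2 (h, s) - q2 (0, s))"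
      by (rule MVT2[of 0 h "\<lambda>t. q (h, t) - q (0, t)"]) (use h in \<open>auto intro!: DERIV_diff d2\<close>)
    then obtain t' where t': "0 < t'" "t' < h" "?d = h * (q2 (h, t') - q2 (0, t'))"
      by (auto simp: algebra_simps)
    have "\<exists>s. 0 < s \<and> s < h \<and> q2 (h, t') - q2 (0, t') = (h - 0) * q21 (s, t')"
      by (rule MVT2[of 0 h "\<lambda>s. q2 (s, t')"]) (use h t' in \<open>auto intro!: d21\<close>)
    then obtain s' where s': "0 < s'" "s' < h" "q2 (h, t') - q2 (0, t') = h * q21 (s', t')" by auto
    have "h * (h * q12 (s, t)) = ?d" unfolding s(3) t(3) ..
    also have "\<dots> = h * (h * q21 (s', t'))" unfolding t'(3) s'(3) ..
    finally have "q12 (s, t) = q21 (s', t')" using h by simp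
    then show ?thesis using s t s' t' by (intro bexI[of _ "(s, t)"] bexI[of _ "(s', t')"]) auto
  qed
  have z: "(0, 0) \<in> ?A" using \<epsilon> by simp
  have c: "isCont q12 (0, 0)" "isCont q21 (0, 0)"
    using smooth_on_continuous_on[OF q12] smooth_on_continuous_on[OF q21] A z
    by (auto simp: continuous_on_eq_continuous_at)
  have eq: "q12 (0, 0) = q21 (0, 0)"
  proof (rule ccontr)
    assume ne: "q12 (0, 0) \<noteq> q21 (0, 0)"
    define e where "e = \<bar>q12 (0, 0) - q21 (0, 0)\<bar> / 2"
    have e: "e > 0" using ne by (simp add: e_def)
    obtain r1 where r1: "r1 > 0" "\<And>x. dist x (0, 0) < r1 \<Longrightarrow> dist (q12 x) (q12 (0, 0)) < e"
      using c(1) e unfolding continuous_at_eps_delta by blast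
    obtain r2 where r2: "r2 > 0" "\<And>x. dist x (0, 0) < r2 \<Longrightarrow> dist (q21 x) (q21 (0, 0)) < e"
      using c(2) e unfolding continuous_at_eps_delta by blast
    \<comment> \<open>A point of the square with side h has norm below 2h, hence the halves of
      \<open>r1\<close> and \<open>r2\<close>. As \<open>e\<close> is half the gap, equal values at
      \<open>x\<close> and \<open>y\<close> are then impossible.\<close>
    define h where "h = min (\<epsilon> / 2) (min (r1 / 2) (r2 / 2))"
    have h: "0 < h" "h < \<epsilon>" "2 * h \<le> r1" "2 * h \<le> r2"
      using \<epsilon> r1(1) r2(1) by (auto simp: h_def)
    obtain x y where x: "x \<in> {0<..<h} \<times> {0<..<h}" and y: "y \<in> {0<..<h} \<times> {0<..<h}"
      and xy: "q12 x = q21 y"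
      using sq[OF h(1,2)] by blast
    have small: "dist z (0, 0) < 2 * h" if "z \<in> {0<..<h} \<times> {0<..<h}" for z :: "real \<times> real"
    proof -
      have "norm z \<le> norm (fst z) + norm (snd z)"
        using norm_Pair_le[of "fst z" "snd z"] by simp
      then show ?thesis using that by (auto simp: dist_norm zero_prod_def[symmetric])
    qed
    have "dist (q12 x) (q12 (0, 0)) < e" "dist (q21 y) (q21 (0, 0)) < e"
      using r1(2)[of x] r2(2)[of y] small[OF x] small[OF y] h by auto
    then show False using xy by (auto simp: e_def dist_real_def abs_if split: if_splits)
  qed
  have "eventually (\<lambda>s. s \<in> ?I) (nhds 0)"
    using \<epsilon> by (intro eventually_nhds_in_open) auto
  then have ev: "eventually (\<lambda>s. deriv (\<lambda>t. q (s, t)) 0 = q2 (s, 0)) (nhds 0)"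
      "eventually (\<lambda>t. deriv (\<lambda>s. q (s, t)) 0 = q1 (0, t)) (nhds 0)"
    by (eventually_elim; use \<epsilon> in \<open>auto intro!: DERIV_imp_deriv d2 d1\<close>)+
  have "deriv (\<lambda>s. deriv (\<lambda>t. q (s, t)) 0) 0 = deriv (\<lambda>s. q2 (s, 0)) 0"
    by (rule deriv_cong_ev[OF ev(1) refl])
  also have "\<dots> = q21 (0, 0)" using d21[OF z] by (rule DERIV_imp_deriv)
  also have "\<dots> = q12 (0, 0)" using eq by simp
  also have "\<dots> = deriv (\<lambda>t. q1 (0, t)) 0" using d12[OF z] by (rule DERIV_imp_deriv[symmetric])
  also have "\<dots> = deriv (\<lambda>t. deriv (\<lambda>s. q (s, t)) 0) 0"
    by (rule deriv_cong_ev[OF ev(2) refl, symmetric])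
  finally show ?thesis .
qed

section \<open>Tangent vectors as velocities of curves\<close>

lemma tangent_spaceE:
  assumes "v \<in> tangent_space M p"
  obtains \<gamma> \<epsilon> where "\<epsilon> > 0" "smooth_map (euc_mfd {-\<epsilon><..<\<epsilon>}) M \<gamma>" "\<gamma> 0 = p" "v = velocity M \<gamma>"
  using assms unfolding tangent_space_def by blast

lemma tangent_spaceI:
  "\<epsilon> > 0 \<Longrightarrow> smooth_map (euc_mfd {-\<epsilon><..<\<epsilon>}) M \<gamma> \<Longrightarrow> velocity M \<gamma> \<in> tangent_space M (\<gamma> 0)"
  unfolding tangent_space_def by blast

lemma smooth_curve_subset:
  assumes "smooth_map (euc_mfd S) M \<gamma>" "T \<subseteq> S" "charted M"
  shows "smooth_map (euc_mfd T) M \<gamma>"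
proof -
  have "smooth_map (euc_mfd T) (euc_mfd S) (\<lambda>t. t)"
    using assms(2) by (auto simp: smooth_map_euc smooth_on_id)
  from smooth_map_compose[OF charted_euc_mfd charted_euc_mfd this assms(1)] show ?thesis .
qed

lemma smooth_fun_euc: "f \<in> smooth_fun (euc_mfd S) \<longleftrightarrow> smooth_on S f"
  by (simp add: smooth_fun_def smooth_map_euc)

lemma smooth_on_has_real_derivative:
  fixes f :: "real \<Rightarrow> real"
  assumes "open S" "smooth_on S f" "t \<in> S"
  shows "(f has_real_derivative deriv f t) (at t)"
proof -
  have "Ck_on (Suc 0) S f" using assms smooth_on_open by blast
  then have "f differentiable (at t)" using assms(3) by simp
  then show ?thesis
    by (metis DERIV_imp_deriv real_differentiable_def)
qed

lemma smooth_fun_curve: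
  assumes "charted M" "smooth_map (euc_mfd S) M \<gamma>" "f \<in> smooth_fun M"
  shows "smooth_on S (\<lambda>t. f (\<gamma> t))"
  using smooth_fun_compose[OF charted_euc_mfd assms] by (simp add: smooth_fun_euc)

lemma velocity_apply: "f \<in> smooth_fun M \<Longrightarrow> velocity M \<gamma> f = deriv (\<lambda>t. f (\<gamma> t)) 0"
  by (simp add: velocity_def comp_def)

lemma velocity_has_derivative:
  assumes "charted M" "\<epsilon> > 0" "smooth_map (euc_mfd {-\<epsilon><..<\<epsilon>}) M \<gamma>" "f \<in> smooth_fun M"
  shows "((\<lambda>t. f (\<gamma> t)) has_real_derivative velocity M \<gamma> f) (at 0)"
  unfolding velocity_apply[OF assms(4)]
  by (rule smooth_on_has_real_derivative[OF _ smooth_fun_curve[OF assms(1,3,4)]]) (use assms(2) in auto)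

context
  fixes M :: "('a, 'e::euclidean_space) mfd"
  assumes M: "charted M"
begin

lemma tangent_nonsmooth: "v \<in> tangent_space M p \<Longrightarrow> f \<notin> smooth_fun M \<Longrightarrow> v f = 0"
  by (auto simp: tangent_space_def velocity_def)

text \<open>Functions are total and arbitrary off the manifold; a curve through \<open>p\<close>
  never sees those values.\<close>

lemma tangent_cong:
  assumes v: "v \<in> tangent_space M p" and eq: "\<And>x. x \<in> topspace (mtop M) \<Longrightarrow> f x = h x"
  shows "v f = v h"
proof -
  have iff: "f \<in> smooth_fun M \<longleftrightarrow> h \<in> smooth_fun M"
    by (rule smooth_fun_cong[OF M eq])
  show ?thesis
  proof (cases "f \<in> smooth_fun M")
    case True
    then have h: "h \<in> smooth_fun M" using iff by simp
    obtain \<gamma> \<epsilon> where g: "\<epsilon> > 0" "smooth_map (euc_mfd {-\<epsilon><..<\<epsilon>}) M \<gamma>" "\<gamma> 0 = p" "v = velocity M \<gamma>"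
      using v by (rule tangent_spaceE)
    have "eventually (\<lambda>t. t \<in> {-\<epsilon><..<\<epsilon>}) (nhds 0)"
      using g(1) by (intro eventually_nhds_in_open) auto
    then have "eventually (\<lambda>t. f (\<gamma> t) = h (\<gamma> t)) (nhds 0)"
      by eventually_elim (use smooth_map_in[OF g(2)] eq in auto)
    then show ?thesis
      unfolding g(4) velocity_apply[OF True] velocity_apply[OF h] by (rule deriv_cong_ev) simp
  next
    case False
    then have "h \<notin> smooth_fun M" using iff by simp
    then show ?thesis using False v by (simp add: tangent_nonsmooth)
  qed
qed

lemma tangent_const: "v \<in> tangent_space M p \<Longrightarrow> v (\<lambda>x. c) = 0"
  by (auto simp: tangent_space_def velocity_def comp_def)

lemma tangent_add:
  assumes "v \<in> tangent_space M p" "f \<in> smooth_fun M" "h \<in> smooth_fun M"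
  shows "v (\<lambda>x. f x + h x) = v f + v h"
proof -
  obtain \<gamma> \<epsilon> where g: "\<epsilon> > 0" "smooth_map (euc_mfd {-\<epsilon><..<\<epsilon>}) M \<gamma>" "\<gamma> 0 = p" "v = velocity M \<gamma>"
    using assms(1) by (rule tangent_spaceE)
  have "((\<lambda>t. f (\<gamma> t) + h (\<gamma> t)) has_real_derivative v f + v h) (at 0)"
    unfolding g(4) using velocity_has_derivative[OF M g(1,2)] assms(2,3) by (intro DERIV_add)
  then show ?thesis
    unfolding g(4) velocity_apply[OF smooth_fun_add[OF M assms(2,3)]] by (rule DERIV_imp_deriv)
qed

lemma tangent_scale:
  assumes "v \<in> tangent_space M p" "f \<in> smooth_fun M"
  shows "v (\<lambda>x. c * f x) = c * v f"
proof -
  obtain \<gamma> \<epsilon> where g: "\<epsilon> > 0" "smooth_map (euc_mfd {-\<epsilon><..<\<epsilon>}) M \<gamma>" "\<gamma> 0 = p" "v = velocity M \<gamma>"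
    using assms(1) by (rule tangent_spaceE)
  have "((\<lambda>t. c * f (\<gamma> t)) has_real_derivative c * v f) (at 0)"
    unfolding g(4) using velocity_has_derivative[OF M g(1,2) assms(2)] by (rule DERIV_cmult)
  then show ?thesis
    unfolding g(4) velocity_apply[OF smooth_fun_scale[OF M assms(2)]] by (rule DERIV_imp_deriv)
qed

lemma tangent_diff:
  assumes "v \<in> tangent_space M p" "f \<in> smooth_fun M" "h \<in> smooth_fun M"
  shows "v (\<lambda>x. f x - h x) = v f - v h"
  using tangent_add[OF assms(1,2) smooth_fun_scale[OF M assms(3), of "-1"]]
    tangent_scale[OF assms(1,3), of "-1"] by simp

lemma tangent_zero: "p \<in> topspace (mtop M) \<Longrightarrow> 0 \<in> tangent_space M p"
proof -
  assume p: "p \<in> topspace (mtop M)"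
  have "velocity M (\<lambda>t. p) = 0"
    by (auto simp: velocity_def comp_def fun_eq_iff)
  moreover have "smooth_map (euc_mfd {-1<..<1::real}) M (\<lambda>t. p)"
    by (rule smooth_map_const[OF p])
  ultimately show ?thesis
    using tangent_spaceI[of 1 M "\<lambda>t. p"] by simp
qed

lemma tangent_scaleR:
  assumes "v \<in> tangent_space M p"
  shows "c *\<^sub>R v \<in> tangent_space M p"
proof -
  obtain \<gamma> \<epsilon> where g: "\<epsilon> > 0" "smooth_map (euc_mfd {-\<epsilon><..<\<epsilon>}) M \<gamma>" "\<gamma> 0 = p" "v = velocity M \<gamma>"
    using assms by (rule tangent_spaceE)
  \<comment> \<open>The summand 1 covers c = 0; on the new interval \<open>c * t\<close> stays
    within \<epsilon>.\<close>
  define \<delta> where "\<delta> = \<epsilon> / (\<bar>c\<bar> + 1)"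
  have \<delta>: "\<delta> > 0" using g(1) by (simp add: \<delta>_def)
  have "c * t \<in> {-\<epsilon><..<\<epsilon>}" if "t \<in> {-\<delta><..<\<delta>}" for t
  proof -
    have "\<bar>c * t\<bar> \<le> (\<bar>c\<bar> + 1) * \<bar>t\<bar>" by (simp add: abs_mult mult_right_mono)
    also have "\<dots> < (\<bar>c\<bar> + 1) * \<delta>" using that by (intro mult_strict_left_mono) auto
    also have "\<dots> = \<epsilon>" by (simp add: \<delta>_def)
    finally show ?thesis by auto
  qed
  then have "smooth_map (euc_mfd {-\<delta><..<\<delta>}) (euc_mfd {-\<epsilon><..<\<epsilon>}) (\<lambda>t. c * t)"
    using smooth_on_bounded_linear[OF bounded_linear_mult_right] by (auto simp: smooth_map_euc)
  from smooth_map_compose[OF charted_euc_mfd charted_euc_mfd this g(2)]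
  have sm: "smooth_map (euc_mfd {-\<delta><..<\<delta>}) M (\<lambda>t. \<gamma> (c * t))" .
  have "velocity M (\<lambda>t. \<gamma> (c * t)) = c *\<^sub>R v"
  proof
    fix f
    show "velocity M (\<lambda>t. \<gamma> (c * t)) f = (c *\<^sub>R v) f"
    proof (cases "f \<in> smooth_fun M")
      case True
      have "((\<lambda>t. f (\<gamma> t)) has_real_derivative v f) (at (c * 0))"
        using velocity_has_derivative[OF M g(1,2) True] by (simp add: g(4))
      moreover have "((\<lambda>t. c * t) has_real_derivative c) (at 0)"
        by (auto intro!: derivative_eq_intros)
      ultimately have "((\<lambda>t. f (\<gamma> (c * t))) has_real_derivative v f * c) (at 0)"
        by (rule DERIV_chain2)
      then show ?thesis
        unfolding velocity_apply[OF True] by (simp add: DERIV_imp_deriv scaleR_fun_def)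
    next
      case False
      then show ?thesis by (simp add: g(4) velocity_def scaleR_fun_def)
    qed
  qed
  then show ?thesis using tangent_spaceI[OF \<delta> sm] g(3) by simp
qed

end

section \<open>Differentials of smooth maps\<close>

lemma linear_pushforward: "linear (pushforward N F)"
  by (rule linearI) (auto simp: pushforward_def fun_eq_iff scaleR_fun_def)

lemma pushforward_apply: "f \<in> smooth_fun N \<Longrightarrow> pushforward N F v f = v (\<lambda>x. f (F x))"
  by (simp add: pushforward_def comp_def)

lemma pushforward_velocity:
  assumes "charted M" "charted N" "smooth_map M N F"
  shows "pushforward N F (velocity M \<gamma>) = velocity N (\<lambda>t. F (\<gamma> t))"
proof
  fix f
  show "pushforward N F (velocity M \<gamma>) f = velocity N (\<lambda>t. F (\<gamma> t)) f"
    using smooth_fun_compose[OF assms, of f] by (simp add: pushforward_def velocity_def comp_def)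
qed

lemma pushforward_tangent:
  assumes "charted M" "charted N" "smooth_map M N F" "v \<in> tangent_space M p"
  shows "pushforward N F v \<in> tangent_space N (F p)"
proof -
  obtain \<gamma> \<epsilon> where g: "\<epsilon> > 0" "smooth_map (euc_mfd {-\<epsilon><..<\<epsilon>}) M \<gamma>" "\<gamma> 0 = p" "v = velocity M \<gamma>"
    using assms(4) by (rule tangent_spaceE)
  have "smooth_map (euc_mfd {-\<epsilon><..<\<epsilon>}) N (\<lambda>t. F (\<gamma> t))"
    by (rule smooth_map_compose[OF charted_euc_mfd assms(1) g(2) assms(3)])
  from tangent_spaceI[OF g(1) this] show ?thesis
    unfolding g(4) pushforward_velocity[OF assms(1-3)] g(3) .
qed

lemma pushforward_cong:
  assumes "charted M" "v \<in> tangent_space M p" "\<And>x. x \<in> topspace (mtop M) \<Longrightarrow> F x = F' x"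
  shows "pushforward N F v = pushforward N F' v"
proof
  fix f
  have "v (f \<circ> F) = v (f \<circ> F')"
    by (rule tangent_cong[OF assms(1,2)]) (simp add: assms(3))
  then show "pushforward N F v f = pushforward N F' v f" by (simp add: pushforward_def)
qed

lemma pushforward_compose:
  assumes "charted N" "charted P" "smooth_map N P H"
  shows "pushforward P H (pushforward N F v) = pushforward P (\<lambda>x. H (F x)) v"
proof
  fix f
  show "pushforward P H (pushforward N F v) f = pushforward P (\<lambda>x. H (F x)) v f"
    using smooth_fun_compose[OF assms, of f] by (simp add: pushforward_def comp_def)
qed

lemma pushforward_ident:
  assumes "charted M" "v \<in> tangent_space M p"
  shows "pushforward M (\<lambda>x. x) v = v"
proof
  fix f
  show "pushforward M (\<lambda>x. x) v f = v f"
    using tangent_nonsmooth[OF assms, of f] by (simp add: pushforward_def comp_def)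
qed

section \<open>Lie groups and left translations\<close>

locale lie_grp =
  fixes G :: "('a, 'b) monoid_scheme" (structure) and M :: "('a, 'e::euclidean_space) mfd"
  assumes lie_group: "lie_group G M"
begin

lemma is_group: "group G"
  using lie_group unfolding lie_group_def by blast

sublocale group G by (rule is_group)

lemma charted: "charted M"
  using lie_group smooth_manifold_charted unfolding lie_group_def by blast

lemma topspace_eq: "topspace (mtop M) = carrier G"
  using lie_group unfolding lie_group_def by blast

lemma smooth_mult:
  assumes "charted P" "smooth_map P M F" "smooth_map P M H"
  shows "smooth_map P M (\<lambda>x. F x \<otimes> H x)"
proof -
  have "smooth_map (prod_mfd M M) M (\<lambda>(x, y). x \<otimes> y)"
    using lie_group unfolding lie_group_def by blast
  from smooth_map_compose[OF assms(1) charted_prod_mfd[OF charted charted] smooth_map_Pair[OF assms(2,3)] this]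
  show ?thesis by simp
qed

lemma smooth_inv:
  assumes "charted P" "smooth_map P M F"
  shows "smooth_map P M (\<lambda>x. inv (F x))"
proof -
  have "smooth_map M M (\<lambda>x. inv x)"
    using lie_group unfolding lie_group_def by blast
  from smooth_map_compose[OF assms(1) charted assms(2) this] show ?thesis .
qed

lemma smooth_const: "a \<in> carrier G \<Longrightarrow> smooth_map P M (\<lambda>x. a)"
  by (rule smooth_map_const) (simp add: topspace_eq)

lemma smooth_left: "a \<in> carrier G \<Longrightarrow> smooth_map M M (\<lambda>x. a \<otimes> x)"
  by (intro smooth_mult charted smooth_const smooth_map_id)

lemma curve_in: "smooth_map (euc_mfd S) M \<gamma> \<Longrightarrow> t \<in> S \<Longrightarrow> \<gamma> t \<in> carrier G"
  using smooth_map_in[of "euc_mfd S" M \<gamma> t] by (simp add: topspace_eq)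

text \<open>The product of two curves through the identity has the sum of their velocities: the
  derivative of f (\<gamma> s \<otimes> \<delta> t) along the diagonal splits into two partial
  derivatives, in each of which the other factor is the identity.\<close>

lemma tangent_one_add:
  assumes "u \<in> tangent_space M \<one>" "v \<in> tangent_space M \<one>"
  shows "u + v \<in> tangent_space M \<one>"
proof -
  obtain \<gamma> \<alpha> where g: "\<alpha> > 0" "smooth_map (euc_mfd {-\<alpha><..<\<alpha>}) M \<gamma>" "\<gamma> 0 = \<one>" "u = velocity M \<gamma>"
    using assms(1) by (rule tangent_spaceE)
  obtain \<delta> \<beta> where d: "\<beta> > 0" "smooth_map (euc_mfd {-\<beta><..<\<beta>}) M \<delta>" "\<delta> 0 = \<one>" "v = velocity M \<delta>"
    using assms(2) by (rule tangent_spaceE)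
  define \<epsilon> where "\<epsilon> = min \<alpha> \<beta>"
  let ?I = "{-\<epsilon><..<\<epsilon>}"
  have \<epsilon>: "\<epsilon> > 0" using g(1) d(1) by (simp add: \<epsilon>_def)
  have sg: "smooth_map (euc_mfd ?I) M \<gamma>"
    by (rule smooth_curve_subset[OF g(2) _ charted]) (auto simp: \<epsilon>_def)
  have sd: "smooth_map (euc_mfd ?I) M \<delta>"
    by (rule smooth_curve_subset[OF d(2) _ charted]) (auto simp: \<epsilon>_def)
  have sm: "smooth_map (euc_mfd ?I) M (\<lambda>t. \<gamma> t \<otimes> \<delta> t)"
    by (rule smooth_mult[OF charted_euc_mfd sg sd])
  have "velocity M (\<lambda>t. \<gamma> t \<otimes> \<delta> t) = u + v"
  proof
    fix f
    show "velocity M (\<lambda>t. \<gamma> t \<otimes> \<delta> t) f = (u + v) f"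
    proof (cases "f \<in> smooth_fun M")
      case True
      let ?q = "\<lambda>z. f (\<gamma> (fst z) \<otimes> \<delta> (snd z))"
      have "smooth_map (prod_mfd (euc_mfd ?I) (euc_mfd ?I)) M (\<lambda>z. \<gamma> (fst z) \<otimes> \<delta> (snd z))"
        by (intro smooth_mult charted_prod_mfd charted_euc_mfd
            smooth_map_compose[OF _ charted_euc_mfd _ sg] smooth_map_compose[OF _ charted_euc_mfd _ sd]
            smooth_map_fst_snd)
      then have "smooth_on (?I \<times> ?I) ?q"
        unfolding prod_euc_mfd by (rule smooth_fun_curve[OF charted _ True])
      then obtain q1 q2 where
        q: "\<And>s t. (s, t) \<in> ?I \<times> ?I \<Longrightarrow> ((\<lambda>s. ?q (s, t)) has_real_derivative q1 (s, t)) (at s)"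
          "\<And>s t. (s, t) \<in> ?I \<times> ?I \<Longrightarrow> ((\<lambda>t. ?q (s, t)) has_real_derivative q2 (s, t)) (at t)"
          "\<And>s. (s, s) \<in> ?I \<times> ?I \<Longrightarrow> ((\<lambda>s. ?q (s, s)) has_real_derivative q1 (s, s) + q2 (s, s)) (at s)"
        by (rule smooth_on_partials[rotated]) (auto intro: open_Times)
      have z: "(0, 0) \<in> ?I \<times> ?I" using \<epsilon> by simp
      have ev: "eventually (\<lambda>t. t \<in> ?I) (nhds 0)"
        using \<epsilon> by (intro eventually_nhds_in_open) auto
      have "eventually (\<lambda>t. ?q (t, 0) = f (\<gamma> t)) (nhds 0)"
        using ev by eventually_elim (simp add: d(3) curve_in[OF sg])
      then have "q1 (0, 0) = u f"
        unfolding g(4) velocity_apply[OF True]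
        using DERIV_imp_deriv[OF q(1)[OF z]] deriv_cong_ev[of "\<lambda>t. ?q (t, 0)" "\<lambda>t. f (\<gamma> t)" 0 0] by simp
      moreover have "eventually (\<lambda>t. ?q (0, t) = f (\<delta> t)) (nhds 0)"
        using ev by eventually_elim (simp add: g(3) curve_in[OF sd])
      then have "q2 (0, 0) = v f"
        unfolding d(4) velocity_apply[OF True]
        using DERIV_imp_deriv[OF q(2)[OF z]] deriv_cong_ev[of "\<lambda>t. ?q (0, t)" "\<lambda>t. f (\<delta> t)" 0 0] by simp
      ultimately show ?thesis
        unfolding velocity_apply[OF True] using DERIV_imp_deriv[OF q(3)[OF z]] by simp
    next
      case False
      then show ?thesis by (simp add: g(4) d(4) velocity_def)
    qed
  qed
  then show ?thesis using tangent_spaceI[OF \<epsilon> sm] g(3) d(3) by simp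
qed

lemma subspace_tangent_one: "subspace (tangent_space M \<one>)"
  unfolding real_vector.subspace_def
  using tangent_one_add tangent_scaleR[OF charted] tangent_zero[OF charted, of \<one>]
  by (simp add: topspace_eq)

lemma pushforward_left:
  assumes "a \<in> carrier G" "v \<in> tangent_space M p"
  shows "pushforward M (\<lambda>x. a \<otimes> x) v \<in> tangent_space M (a \<otimes> p)"
  by (rule pushforward_tangent[OF charted charted smooth_left[OF assms(1)] assms(2)])

lemma pushforward_left_left:
  assumes "a \<in> carrier G" "b \<in> carrier G" "v \<in> tangent_space M p"
  shows "pushforward M (\<lambda>x. a \<otimes> x) (pushforward M (\<lambda>x. b \<otimes> x) v) = pushforward M (\<lambda>x. (a \<otimes> b) \<otimes> x) v"
  unfolding pushforward_compose[OF charted charted smooth_left[OF assms(1)]]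
  by (rule pushforward_cong[OF charted assms(3)]) (use assms in \<open>simp add: topspace_eq m_assoc\<close>)

lemma pushforward_left_one: "v \<in> tangent_space M p \<Longrightarrow> pushforward M (\<lambda>x. \<one> \<otimes> x) v = v"
  using pushforward_cong[OF charted, of v p "\<lambda>x. \<one> \<otimes> x" "\<lambda>x. x" M] pushforward_ident[OF charted]
  by (simp add: topspace_eq)

lemma tangent_space_eq:
  assumes "p \<in> carrier G"
  shows "tangent_space M p = pushforward M (\<lambda>x. p \<otimes> x) ` tangent_space M \<one>"
proof
  show "pushforward M (\<lambda>x. p \<otimes> x) ` tangent_space M \<one> \<subseteq> tangent_space M p"
    using pushforward_left[OF assms, of _ \<one>] assms by auto
  show "tangent_space M p \<subseteq> pushforward M (\<lambda>x. p \<otimes> x) ` tangent_space M \<one>"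
  proof
    fix v assume v: "v \<in> tangent_space M p"
    let ?w = "pushforward M (\<lambda>x. inv p \<otimes> x) v"
    have "?w \<in> tangent_space M \<one>"
      using pushforward_left[OF inv_closed[OF assms] v] assms by simp
    moreover have "v = pushforward M (\<lambda>x. p \<otimes> x) ?w"
      using pushforward_left_left[OF assms inv_closed[OF assms] v] assms pushforward_left_one[OF v] by simp
    ultimately show "v \<in> pushforward M (\<lambda>x. p \<otimes> x) ` tangent_space M \<one>" by blast
  qed
qed

lemma subspace_tangent: "p \<in> carrier G \<Longrightarrow> subspace (tangent_space M p)"
  unfolding tangent_space_eq
  by (rule linear_subspace_image[OF linear_pushforward subspace_tangent_one])

section \<open>Left-invariant vector fields\<close>

lemma subspace_vector_fields: "subspace (vector_fields M)"
proof -
  note T = real_vector.subspace_0[OF subspace_tangent] real_vector.subspace_add[OF subspace_tangent]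
    real_vector.subspace_scale[OF subspace_tangent]
  show ?thesis
    unfolding real_vector.subspace_def vector_fields_def topspace_eq
    using T smooth_fun_const[of 0 M] smooth_fun_add[OF charted] smooth_fun_scale[OF charted]
    by (auto simp: scaleR_fun_def plus_fun_def zero_fun_def)
qed

text \<open>The left-invariant field with value \<open>v\<close> at the identity, set to 0 off the
  group as \<open>vector_fields\<close> requires.\<close>

definition lfield :: "'a tvector \<Rightarrow> 'a vfield" where
  "lfield v = (\<lambda>p. if p \<in> carrier G then pushforward M (\<lambda>x. p \<otimes> x) v else 0)"

lemma linear_lfield: "linear lfield"
  by (rule linearI) (auto simp: lfield_def pushforward_def fun_eq_iff scaleR_fun_def)

lemma lfield_one: "v \<in> tangent_space M \<one> \<Longrightarrow> lfield v \<one> = v"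
  by (simp add: lfield_def pushforward_left_one)

lemma lfield_apply:
  assumes "p \<in> carrier G" "f \<in> smooth_fun M"
  shows "lfield v p f = v (\<lambda>x. f (p \<otimes> x))"
  using assms by (simp add: lfield_def pushforward_apply)

lemma smooth_fun_left: "a \<in> carrier G \<Longrightarrow> f \<in> smooth_fun M \<Longrightarrow> (\<lambda>x. f (a \<otimes> x)) \<in> smooth_fun M"
  by (rule smooth_fun_compose[OF charted charted smooth_left])

lemma lfield_velocity:
  assumes "p \<in> carrier G" "f \<in> smooth_fun M"
  shows "lfield (velocity M \<gamma>) p f = deriv (\<lambda>t. f (p \<otimes> \<gamma> t)) 0"
  using lfield_apply[OF assms] velocity_apply[OF smooth_fun_left[OF assms]] by simp

text \<open>With a curve \<gamma> for \<open>v\<close>, the value at \<open>p\<close> is the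
  t-derivative at 0 of f (p \<otimes> \<gamma> t), a smooth function on the product of the group
  with an interval.\<close>

lemma lfield_smooth:
  assumes v: "v \<in> tangent_space M \<one>" and f: "f \<in> smooth_fun M"
  shows "(\<lambda>p. lfield v p f) \<in> smooth_fun M"
proof -
  obtain \<gamma> \<epsilon> where g: "\<epsilon> > 0" "smooth_map (euc_mfd {-\<epsilon><..<\<epsilon>}) M \<gamma>" "\<gamma> 0 = \<one>" "v = velocity M \<gamma>"
    using v by (rule tangent_spaceE)
  let ?P = "prod_mfd M (euc_mfd {-\<epsilon><..<\<epsilon>})"
  have "smooth_map ?P M (\<lambda>z. fst z \<otimes> \<gamma> (snd z))"
    by (intro smooth_mult charted_prod_mfd charted charted_euc_mfd
        smooth_map_compose[OF _ charted_euc_mfd _ g(2)] smooth_map_fst_snd)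
  then have "(\<lambda>z. f (fst z \<otimes> \<gamma> (snd z))) \<in> smooth_fun ?P"
    by (rule smooth_fun_compose[OF charted_prod_mfd[OF charted charted_euc_mfd] charted _ f])
  from smooth_fun_partial[OF charted g(1) this]
  have sm: "(\<lambda>p. deriv (\<lambda>t. f (p \<otimes> \<gamma> t)) 0) \<in> smooth_fun M" by simp
  have eq: "deriv (\<lambda>t. f (p \<otimes> \<gamma> t)) 0 = lfield v p f" if "p \<in> topspace (mtop M)" for p
    using lfield_velocity[of p f \<gamma>] that f by (simp add: topspace_eq g(4))
  show ?thesis using sm smooth_fun_cong[OF charted eq] by simp
qed

lemma lfield_lie_algebra:
  assumes v: "v \<in> tangent_space M \<one>"
  shows "lfield v \<in> lie_algebra G M"
  unfolding lie_algebra_def vector_fields_def topspace_eq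
proof (intro CollectI conjI ballI allI impI)
  show "lfield v p \<in> tangent_space M p" if "p \<in> carrier G" for p
    using pushforward_left[OF that v] that by (simp add: lfield_def)
  show "lfield v p = 0" if "p \<notin> carrier G" for p using that by (simp add: lfield_def)
  show "(\<lambda>p. lfield v p f) \<in> smooth_fun M" if "f \<in> smooth_fun M" for f
    by (rule lfield_smooth[OF v that])
  show "lfield v (a \<otimes> p) = pushforward M (\<lambda>x. a \<otimes> x) (lfield v p)"
    if "a \<in> carrier G" "p \<in> carrier G" for a p
    using pushforward_left_left[OF that v] that by (simp add: lfield_def)
qed

lemma lie_algebra_lfield:
  assumes "X \<in> lie_algebra G M"
  shows "X \<one> \<in> tangent_space M \<one>" "X = lfield (X \<one>)"
proof -
  show "X \<one> \<in> tangent_space M \<one>"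
    using assms by (simp add: lie_algebra_def vector_fields_def topspace_eq)
  show "X = lfield (X \<one>)"
  proof
    fix p
    show "X p = lfield (X \<one>) p"
    proof (cases "p \<in> carrier G")
      case True
      have "\<forall>a\<in>carrier G. \<forall>p\<in>carrier G. X (a \<otimes> p) = pushforward M (\<lambda>x. a \<otimes> x) (X p)"
        using assms unfolding lie_algebra_def by blast
      then have "X (p \<otimes> \<one>) = pushforward M (\<lambda>x. p \<otimes> x) (X \<one>)"
        using True one_closed by blast
      then show ?thesis using True by (simp add: lfield_def)
    next
      case False
      then show ?thesis
        using assms by (simp add: lfield_def lie_algebra_def vector_fields_def topspace_eq)
    qed
  qed
qed

lemma lie_algebra_eq: "lie_algebra G M = lfield ` tangent_space M \<one>"
  using lie_algebra_lfield lfield_lie_algebra by blast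

lemma subspace_lie_algebra: "subspace (lie_algebra G M)"
  unfolding lie_algebra_eq by (rule linear_subspace_image[OF linear_lfield subspace_tangent_one])

end

section \<open>Tangent spaces in charts\<close>

text \<open>The graph of \<open>c\<close> is an uncountable subset of a second countable space, so it is
  not discrete.\<close>

lemma second_countable_nonisolated:
  fixes c :: "real \<Rightarrow> 'a"
  assumes X: "second_countable X" and \<epsilon>: "\<epsilon> > 0"
    and c: "\<And>t. t \<in> {-\<epsilon><..<\<epsilon>} \<Longrightarrow> c t \<in> topspace X"
  shows "\<exists>t0\<in>{-\<epsilon><..<\<epsilon>}. \<forall>U \<eta>. openin X U \<longrightarrow> c t0 \<in> U \<longrightarrow> \<eta> > 0 \<longrightarrow>
      (\<exists>t\<in>{-\<epsilon><..<\<epsilon>}. t \<noteq> t0 \<and> \<bar>t - t0\<bar> < \<eta> \<and> c t \<in> U)"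
    (is "\<exists>t0\<in>?I. ?P t0")
proof (rule ccontr)
  assume neg: "\<not> (\<exists>t0\<in>?I. ?P t0)"
  obtain \<B> where B: "countable \<B>" "\<And>V. V \<in> \<B> \<Longrightarrow> openin X V"
    "\<And>U x. openin X U \<Longrightarrow> x \<in> U \<Longrightarrow> \<exists>V\<in>\<B>. x \<in> V \<and> V \<subseteq> U"
    using X unfolding second_countable_def by auto
  \<comment> \<open>If every t were isolated, it could be labelled by a basic open set and a
    rational interval that isolate it; there are countably many labels.\<close>
  have "\<exists>V a b. V \<in> \<B> \<and> a \<in> \<rat> \<and> b \<in> \<rat> \<and> c t \<in> V \<and> a < t \<and> t < b \<and>
      (\<forall>s\<in>?I. s \<noteq> t \<longrightarrow> a < s \<longrightarrow> s < b \<longrightarrow> c s \<notin> V)" if t: "t \<in> ?I" for t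
  proof -
    have "\<not> ?P t" using neg t by simp
    then obtain U \<eta> where U: "openin X U" "c t \<in> U" "\<eta> > 0"
      and iso: "\<not> (\<exists>s\<in>?I. s \<noteq> t \<and> \<bar>s - t\<bar> < \<eta> \<and> c s \<in> U)"
      by blast
    obtain V where V: "V \<in> \<B>" "c t \<in> V" "V \<subseteq> U" using B(3) U by blast
    obtain a where a: "a \<in> \<rat>" "t - \<eta> < a" "a < t" using Rats_dense_in_real[of "t - \<eta>" t] U(3) by auto
    obtain b where b: "b \<in> \<rat>" "t < b" "b < t + \<eta>" using Rats_dense_in_real[of t "t + \<eta>"] U(3) by auto
    have "c s \<notin> V" if "s \<in> ?I" "s \<noteq> t" "a < s" "s < b" for s
    proof -
      have "\<bar>s - t\<bar> < \<eta>" using that a b by auto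
      then show ?thesis using iso that V(3) by auto
    qed
    then show ?thesis using V a b by blast
  qed
  then obtain V a b where Vab: "\<And>t. t \<in> ?I \<Longrightarrow> V t \<in> \<B> \<and> a t \<in> \<rat> \<and> b t \<in> \<rat> \<and> c t \<in> V t \<and> a t < t \<and> t < b t \<and>
      (\<forall>s\<in>?I. s \<noteq> t \<longrightarrow> a t < s \<longrightarrow> s < b t \<longrightarrow> c s \<notin> V t)"
    by metis
  \<comment> \<open>If s \<noteq> t had the same label, then s would lie in the interval of t and
    \<open>c s\<close> in \<open>V t\<close>, against the isolation of t.\<close>
  have inj: "inj_on (\<lambda>t. (V t, a t, b t)) ?I"
  proof (rule inj_onI)
    fix s t assume s: "s \<in> ?I" and t: "t \<in> ?I" and eq: "(V s, a s, b s) = (V t, a t, b t)"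
    have e: "V s = V t" "a s = a t" "b s = b t" using eq by auto
    show "s = t"
    proof (rule ccontr)
      assume "s \<noteq> t"
      then have "c s \<notin> V t" using Vab[OF t] Vab[OF s] s e by metis
      then show False using Vab[OF s] e by simp
    qed
  qed
  have sub: "(\<lambda>t. (V t, a t, b t)) ` ?I \<subseteq> \<B> \<times> \<rat> \<times> \<rat>"
    using Vab by auto
  have "countable (\<B> \<times> (\<rat> :: real set) \<times> (\<rat> :: real set))"
    using B(1) by (intro countable_SIGMA countable_rat)
  then have "countable ?I"
    using countable_image_inj_on[OF countable_subset[OF sub] inj] by simp
  then show False using uncountable_open_interval[of "-\<epsilon>" \<epsilon>] \<epsilon> by simp
qed

text \<open>Duality in finite dimension, with functions as test vectors. In the induction step an
  \<open>f0\<close> killed by \<open>B\<close> but not by \<open>b\<close> exists by the induction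
  hypothesis for \<open>b\<close>; subtracting the multiple of \<open>b\<close> that agrees with
  \<open>v\<close> at \<open>f0\<close> reduces the claim to \<open>B\<close>.\<close>

lemma span_annihilator:
  fixes v :: "'a tvector"
  assumes T: "subspace T" "finite B" "B \<subseteq> T" "v \<in> T"
    and add: "\<And>v f h. v \<in> T \<Longrightarrow> f \<in> S \<Longrightarrow> h \<in> S \<Longrightarrow> v (\<lambda>x. f x + h x) = v f + v h"
    and scale: "\<And>v f c. v \<in> T \<Longrightarrow> f \<in> S \<Longrightarrow> v (\<lambda>x. c * f x) = c * v f"
    and zero: "\<And>v f. v \<in> T \<Longrightarrow> f \<notin> S \<Longrightarrow> v f = 0"
    and S: "\<And>f h. f \<in> S \<Longrightarrow> h \<in> S \<Longrightarrow> (\<lambda>x. f x + h x) \<in> S" "\<And>f c. f \<in> S \<Longrightarrow> (\<lambda>x. c * f x) \<in> S"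
    and ann: "\<And>f. f \<in> S \<Longrightarrow> (\<And>b. b \<in> B \<Longrightarrow> b f = 0) \<Longrightarrow> v f = 0"
  shows "v \<in> span B"
  using T(2-4) ann
proof (induction B arbitrary: v rule: finite_induct)
  case empty
  have "v f = 0" for f using empty(3)[of f] zero[OF empty(2)] by (cases "f \<in> S") auto
  then have "v = 0" by (auto simp: fun_eq_iff)
  then show ?case by (simp only: real_vector.span_zero)
next
  case (insert b B)
  note bT = insert.prems(1)
  show ?case
  proof (cases "b \<in> span B")
    case True
    have "v \<in> span B"
    proof (rule insert.IH)
      show "v f = 0" if f: "f \<in> S" "\<And>b. b \<in> B \<Longrightarrow> b f = 0" for f
      proof (rule insert.prems(3)[OF f(1)])
        have "w f = 0" if "w \<in> span B" for w
          using that
        proof (induction rule: real_vector.span_induct_alt)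
          case (step c x y)
          then show ?case using f(2) by (simp add: scaleR_fun_def)
        qed simp
        then show "b' f = 0" if "b' \<in> insert b B" for b' using that f(2) True by auto
      qed
    qed (use insert.prems in auto)
    then show ?thesis by (meson real_vector.span_mono subset_insertI subsetD)
  next
    case False
    have "\<exists>f\<in>S. (\<forall>b\<in>B. b f = 0) \<and> b f \<noteq> 0"
      using insert.IH[of b] bT False by blast
    then obtain f0 where f0: "f0 \<in> S" "\<And>w. w \<in> B \<Longrightarrow> w f0 = 0" "b f0 \<noteq> 0" by blast
    define r where "r = v f0 / b f0"
    let ?u = "v - r *\<^sub>R b"
    have uT: "?u \<in> T"
      using insert.prems T(1) by (simp add: real_vector.subspace_diff real_vector.subspace_scale)
    have "?u \<in> span B"
    proof (rule insert.IH[OF _ uT])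
      show "B \<subseteq> T" using bT by simp
      fix f assume f: "f \<in> S" "\<And>w. w \<in> B \<Longrightarrow> w f = 0"
      \<comment> \<open>Correcting \<open>f\<close> by a multiple of \<open>f0\<close> makes
        \<open>b\<close> vanish as well, so the hypothesis on \<open>v\<close> applies to
        \<open>?k\<close>.\<close>
      let ?s = "- (b f / b f0)"
      let ?k = "\<lambda>x. f x + ?s * f0 x"
      have kS: "?k \<in> S" using S f(1) f0(1) by blast
      have k: "w ?k = w f + ?s * w f0" if "w \<in> T" for w
        using add[OF that f(1) S(2)[OF f0(1), of ?s]] scale[OF that f0(1), of ?s] by simp
      have "v ?k = 0"
      proof (rule insert.prems(3)[OF kS])
        show "w ?k = 0" if w: "w \<in> insert b B" for w
        proof (cases "w = b")
          case True
          then show ?thesis using k[of b] bT f0(3) by simp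
        next
          case False
          then have wB: "w \<in> B" "w \<in> T" using w bT by auto
          then show ?thesis using k[OF wB(2)] f(2)[OF wB(1)] f0(2)[OF wB(1)] by simp
        qed
      qed
      then have "v f = (b f / b f0) * v f0" using k[OF insert.prems(2)] by simp
      then show "?u f = 0" by (simp add: r_def scaleR_fun_def)
    qed
    then have "?u \<in> span (insert b B)" by (meson real_vector.span_mono subset_insertI subsetD)
    moreover have "r *\<^sub>R b \<in> span (insert b B)"
      by (intro real_vector.span_scale real_vector.span_base) simp
    ultimately have "?u + r *\<^sub>R b \<in> span (insert b B)" by (rule real_vector.span_add)
    then show ?thesis by simp
  qed
qed

section \<open>Tangent vectors in a fixed chart\<close>

context
  fixes N :: "('a, 'd::euclidean_space) mfd" and V :: "'a set" and \<psi> :: "'a \<Rightarrow> 'd" and p :: 'a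
  assumes N: "smooth_manifold N" and c: "(V, \<psi>) \<in> atlas N" and p: "p \<in> V"
begin

lemma subspace_model: "subspace (model N)"
  using N unfolding smooth_manifold_def by blast

lemma chart_model: obtains T where "open T" "\<psi> ` V = model N \<inter> T"
proof -
  have "openin (top_of_set (model N)) (\<psi> ` V)"
    using N c unfolding smooth_manifold_def by blast
  then show thesis using that unfolding openin_open by blast
qed

text \<open>A straight line in chart coordinates; meaningful for \<open>w\<close> in the model space
  and small t, since elsewhere \<open>inv_into\<close> is arbitrary.\<close>

definition chart_line :: "'d \<Rightarrow> real \<Rightarrow> 'a" where
  "chart_line w t = inv_into V \<psi> (\<psi> p + t *\<^sub>R w)"

lemma chart_line_0: "chart_line w 0 = p"
  by (simp add: chart_line_def chart_inv[OF smooth_manifold_charted[OF N] c p])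

lemma chart_line_smooth:
  assumes w: "w \<in> model N"
  obtains \<epsilon> where "\<epsilon> > 0" "smooth_map (euc_mfd {-\<epsilon><..<\<epsilon>}) N (chart_line w)"
    "\<And>t. t \<in> {-\<epsilon><..<\<epsilon>} \<Longrightarrow> chart_line w t \<in> V \<and> \<psi> (chart_line w t) = \<psi> p + t *\<^sub>R w"
proof -
  let ?l = "\<lambda>t. \<psi> p + t *\<^sub>R w"
  obtain T where T: "open T" "\<psi> ` V = model N \<inter> T" by (rule chart_model)
  have pT: "\<psi> p \<in> model N \<inter> T" using p T(2) by blast
  have lc: "continuous_on UNIV ?l" by (intro continuous_intros)
  have "open (?l -` T)" using T(1) lc by (rule open_vimage)
  moreover have "0 \<in> ?l -` T" using pT by simp
  ultimately obtain \<epsilon> where \<epsilon>: "\<epsilon> > 0" "ball 0 \<epsilon> \<subseteq> ?l -` T"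
    unfolding open_contains_ball by blast
  let ?I = "{-\<epsilon><..<\<epsilon>}"
  have lV: "?l t \<in> \<psi> ` V" if "t \<in> ?I" for t
  proof -
    have "t \<in> ball 0 \<epsilon>" using that by (auto simp: dist_real_def)
    then have "?l t \<in> T" using \<epsilon>(2) by blast
    moreover have "?l t \<in> model N"
      using pT w subspace_model by (simp add: real_vector.subspace_add real_vector.subspace_scale)
    ultimately show ?thesis using T(2) by blast
  qed
  have inV: "chart_line w t \<in> V \<and> \<psi> (chart_line w t) = ?l t" if "t \<in> ?I" for t
    using lV[OF that] by (simp add: chart_line_def inv_into_into f_inv_into_f)
  have eq: "chart_line w t = q \<longleftrightarrow> ?l t = \<psi> q" if "t \<in> ?I" "q \<in> V" for t q
    using inV[OF that(1)] inj_onD[OF chart_inj[OF smooth_manifold_charted[OF N] c]] that(2) by metis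
  have "smooth_map (euc_mfd ?I) N (chart_line w)"
    unfolding smooth_map_def
  proof (intro conjI ballI; clarify?)
    show "continuous_map (mtop (euc_mfd ?I)) (mtop N) (chart_line w)"
      unfolding continuous_map_def
    proof (intro conjI allI impI)
      show "chart_line w \<in> topspace (mtop (euc_mfd ?I)) \<rightarrow> topspace (mtop N)"
        using inV chart_subset[OF smooth_manifold_charted[OF N] c] by auto
      fix W assume W: "openin (mtop N) W"
      have "openin (mtop N) (V \<inter> W)" using chart_open[OF smooth_manifold_charted[OF N] c] W by blast
      then obtain A where A: "open A" "\<psi> ` (V \<inter> W) = \<psi> ` V \<inter> A"
        by (rule chart_image_open[OF smooth_manifold_charted[OF N] c]) auto
      have "chart_line w t \<in> W \<longleftrightarrow> ?l t \<in> A" if "t \<in> ?I" for t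
      proof -
        have "chart_line w t \<in> W \<longleftrightarrow> chart_line w t \<in> V \<inter> W" using inV[OF that] by simp
        also have "\<dots> \<longleftrightarrow> ?l t \<in> \<psi> ` (V \<inter> W)" using eq[OF that] by auto
        also have "\<dots> \<longleftrightarrow> ?l t \<in> A" using A(2) lV[OF that] by simp
        finally show ?thesis .
      qed
      then have "{t \<in> ?I. chart_line w t \<in> W} = ?I \<inter> ?l -` A" by auto
      moreover have "open (?l -` A)" using A(1) lc by (rule open_vimage)
      ultimately show "openin (mtop (euc_mfd ?I)) {t \<in> topspace (mtop (euc_mfd ?I)). chart_line w t \<in> W}"
        by auto
    qed
    fix U V' and \<phi> :: "real \<Rightarrow> real" and \<psi>' assume "(U, \<phi>) \<in> atlas (euc_mfd ?I)" and c': "(V', \<psi>') \<in> atlas N"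
    then have U: "U = ?I" "\<phi> = (\<lambda>x. x)" by (auto simp: atlas_euc_mfd)
    have "smooth_on (?I \<inter> chart_line w -` V') (\<lambda>t. (\<psi>' \<circ> inv_into V \<psi>) (?l t))"
    proof (rule smooth_on_compose[where f = ?l])
      show "smooth_on (?I \<inter> chart_line w -` V') ?l"
        by (intro smooth_on_add smooth_on_const smooth_on_bounded_linear bounded_linear_scaleR_left)
      show "smooth_on (\<psi> ` (V \<inter> V')) (\<psi>' \<circ> inv_into V \<psi>)" by (rule chart_transition[OF smooth_manifold_charted[OF N] c c'])
      show "?l ` (?I \<inter> chart_line w -` V') \<subseteq> \<psi> ` (V \<inter> V')"
      proof
        fix y assume "y \<in> ?l ` (?I \<inter> chart_line w -` V')"
        then obtain t where t: "t \<in> ?I" "chart_line w t \<in> V'" "y = ?l t" by auto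
        then have "y = \<psi> (chart_line w t)" "chart_line w t \<in> V \<inter> V'" using inV[OF t(1)] by auto
        then show "y \<in> \<psi> ` (V \<inter> V')" by blast
      qed
    qed
    then have "smooth_on (?I \<inter> chart_line w -` V') (\<psi>' \<circ> chart_line w \<circ> inv_into ?I (\<lambda>x. x))"
      by (rule smooth_on_cong[rotated]) (simp add: inv_into_ident chart_line_def)
    then show "smooth_on (\<phi> ` (U \<inter> chart_line w -` V')) (\<psi>' \<circ> chart_line w \<circ> inv_into U \<phi>)"
      unfolding U by simp
  qed
  then show thesis using that \<epsilon>(1) inV by blast
qed

text \<open>\<open>h\<close> lives on an open set of the whole Euclidean type, so \<open>D\<close>
  is tied to \<open>f\<close> only along the model space; later uses evaluate it there.\<close>

lemma smooth_fun_extension: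
  assumes f: "f \<in> smooth_fun N"
  obtains T h D where "open T" "\<psi> p \<in> T" "(h has_derivative D) (at (\<psi> p))"
    "\<And>q. q \<in> V \<Longrightarrow> \<psi> q \<in> T \<Longrightarrow> h (\<psi> q) = f q"
proof -
  obtain T h where T: "open T" "\<psi> p \<in> T" "\<forall>k. Ck_on k T h" "\<forall>y\<in>\<psi> ` V \<inter> T. h y = (f \<circ> inv_into V \<psi>) y"
    using smooth_fun_chart[OF f c] p unfolding smooth_on_def by blast
  have "Ck_on (Suc 0) T h" using T(3) by blast
  then have "(h has_derivative frechet_derivative h (at (\<psi> p))) (at (\<psi> p))"
    using T(2) by (rule Ck_on_Suc_deriv)
  moreover have "h (\<psi> q) = f q" if "q \<in> V" "\<psi> q \<in> T" for q
    using T(4) that chart_inv[OF smooth_manifold_charted[OF N] c that(1)] by auto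
  ultimately show thesis using that T by blast
qed

lemma curve_chart_derivative:
  assumes \<epsilon>: "\<epsilon> > 0" and g: "smooth_map (euc_mfd {-\<epsilon><..<\<epsilon>}) N \<gamma>" "\<gamma> t0 = p" and t0: "t0 \<in> {-\<epsilon><..<\<epsilon>}"
  obtains w \<delta> where "\<delta> > 0" "((\<lambda>t. \<psi> (\<gamma> t)) has_vector_derivative w) (at t0)"
    "\<And>t. \<bar>t - t0\<bar> < \<delta> \<Longrightarrow> t \<in> {-\<epsilon><..<\<epsilon>} \<and> \<gamma> t \<in> V"
proof -
  let ?I = "{-\<epsilon><..<\<epsilon>}"
  have "openin (mtop (euc_mfd ?I)) {t \<in> topspace (mtop (euc_mfd ?I)). \<gamma> t \<in> V}"
    by (rule openin_continuous_map_preimage[OF smooth_map_continuous[OF g(1)] chart_open[OF smooth_manifold_charted[OF N] c]])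
  then have o: "open (?I \<inter> \<gamma> -` V)"
    by (auto simp: openin_open_eq vimage_def Int_def)
  have t0': "t0 \<in> ?I \<inter> \<gamma> -` V" using t0 g(2) p by simp
  have "smooth_on ((\<lambda>x. x) ` (?I \<inter> \<gamma> -` V)) (\<psi> \<circ> \<gamma> \<circ> inv_into ?I (\<lambda>x. x))"
    by (rule smooth_map_chart[OF g(1) _ c]) (simp add: atlas_euc_mfd)
  then have "smooth_on (?I \<inter> \<gamma> -` V) (\<psi> \<circ> \<gamma> \<circ> inv_into ?I (\<lambda>x. x))" by simp
  then have "smooth_on (?I \<inter> \<gamma> -` V) (\<lambda>t. \<psi> (\<gamma> t))"
    by (rule smooth_on_cong[rotated]) (simp add: inv_into_ident)
  then have "Ck_on (Suc 0) (?I \<inter> \<gamma> -` V) (\<lambda>t. \<psi> (\<gamma> t))"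
    using smooth_on_open[OF o] by blast
  then have "(\<lambda>t. \<psi> (\<gamma> t)) differentiable (at t0)" using t0' by simp
  then obtain w where w: "((\<lambda>t. \<psi> (\<gamma> t)) has_vector_derivative w) (at t0)"
    using vector_derivative_works by blast
  obtain \<delta> where "\<delta> > 0" "ball t0 \<delta> \<subseteq> ?I \<inter> \<gamma> -` V"
    using o t0' unfolding open_contains_ball by blast
  moreover have "\<bar>t - t0\<bar> < \<delta> \<Longrightarrow> t \<in> ball t0 \<delta>" for t by (simp add: dist_real_def abs_minus_commute)
  ultimately show thesis using that[OF _ w] by blast
qed

lemma velocity_eq_chart:
  assumes \<epsilon>: "\<epsilon> > 0" and g: "smooth_map (euc_mfd {-\<epsilon><..<\<epsilon>}) N \<gamma>" "\<gamma> 0 = p"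
    and w: "((\<lambda>t. \<psi> (\<gamma> t)) has_vector_derivative w) (at 0)"
    and f: "f \<in> smooth_fun N" and T: "open T" "\<psi> p \<in> T" and h: "(h has_derivative D) (at (\<psi> p))"
    and hf: "\<And>q. q \<in> V \<Longrightarrow> \<psi> q \<in> T \<Longrightarrow> h (\<psi> q) = f q"
  shows "velocity N \<gamma> f = D w"
proof -
  have "0 \<in> {-\<epsilon><..<\<epsilon>}" using \<epsilon> by simp
  then obtain w' \<delta> where \<delta>0: "\<delta> > 0" "((\<lambda>t. \<psi> (\<gamma> t)) has_vector_derivative w') (at 0)"
    "\<And>t. \<bar>t - 0\<bar> < \<delta> \<Longrightarrow> t \<in> {-\<epsilon><..<\<epsilon>} \<and> \<gamma> t \<in> V"
    by (rule curve_chart_derivative[OF \<epsilon> g]) (rule that; assumption)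
  have \<delta>: "\<delta> > 0" "\<And>t. \<bar>t\<bar> < \<delta> \<Longrightarrow> \<gamma> t \<in> V"
    using \<delta>0(1,3) by auto
  have "isCont (\<lambda>t. \<psi> (\<gamma> t)) 0"
    using w has_vector_derivative_continuous by blast
  then have "eventually (\<lambda>t. \<psi> (\<gamma> t) \<in> T) (at 0)"
    using T g(2) unfolding isCont_def by (metis topological_tendstoD)
  moreover have "eventually (\<lambda>t. t \<in> {-\<delta><..<\<delta>}) (at 0)"
    using \<delta>(1) by (intro eventually_at_in_open') auto
  ultimately have "eventually (\<lambda>t. h (\<psi> (\<gamma> t)) = f (\<gamma> t)) (at 0)"
    by eventually_elim (use \<delta>(2) hf in \<open>auto simp: abs_less_iff\<close>)
  moreover have "h (\<psi> (\<gamma> 0)) = f (\<gamma> 0)" using hf p T(2) g(2) by simp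
  moreover have "((\<lambda>t. h (\<psi> (\<gamma> t))) has_derivative (\<lambda>t. D (t *\<^sub>R w))) (at 0)"
    by (rule has_derivative_compose[OF w[unfolded has_vector_derivative_def]]) (use h g(2) in simp)
  ultimately have "((\<lambda>t. f (\<gamma> t)) has_derivative (\<lambda>t. D (t *\<^sub>R w))) (at 0)"
    using has_derivative_transform_eventually[of "\<lambda>t. h (\<psi> (\<gamma> t))" _ 0 UNIV "\<lambda>t. f (\<gamma> t)"] by simp
  moreover have "(\<lambda>t. D (t *\<^sub>R w)) = (*) (D w)"
    using linear_scale[OF has_derivative_linear[OF h]] by (auto simp: mult.commute)
  ultimately have "((\<lambda>t. f (\<gamma> t)) has_real_derivative D w) (at 0)"
    by (simp add: has_field_derivative_def)
  then show ?thesis unfolding velocity_apply[OF f] by (rule DERIV_imp_deriv)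
qed

lemma velocity_chart_line:
  assumes w: "w \<in> model N" and f: "f \<in> smooth_fun N" and T: "open T" "\<psi> p \<in> T"
    and h: "(h has_derivative D) (at (\<psi> p))" and hf: "\<And>q. q \<in> V \<Longrightarrow> \<psi> q \<in> T \<Longrightarrow> h (\<psi> q) = f q"
  shows "velocity N (chart_line w) f = D w"
proof -
  obtain \<epsilon> where \<epsilon>: "\<epsilon> > 0" "smooth_map (euc_mfd {-\<epsilon><..<\<epsilon>}) N (chart_line w)"
    "\<And>t. t \<in> {-\<epsilon><..<\<epsilon>} \<Longrightarrow> chart_line w t \<in> V \<and> \<psi> (chart_line w t) = \<psi> p + t *\<^sub>R w"
    by (rule chart_line_smooth[OF w]) blast
  have "((\<lambda>t. \<psi> p + t *\<^sub>R w) has_vector_derivative w) (at 0)"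
    by (auto intro!: derivative_eq_intros)
  then have "((\<lambda>t. \<psi> (chart_line w t)) has_vector_derivative w) (at 0)"
    by (rule has_vector_derivative_transform_within_open[of _ _ _ "{-\<epsilon><..<\<epsilon>}"]) (use \<epsilon> in auto)
  from velocity_eq_chart[OF \<epsilon>(1,2) chart_line_0 this f T h hf] show ?thesis .
qed

lemma velocity_chart_line_tangent:
  assumes "w \<in> model N"
  shows "velocity N (chart_line w) \<in> tangent_space N p"
  by (rule chart_line_smooth[OF assms]) (metis tangent_spaceI chart_line_0)

text \<open>The coordinate velocity of a curve is a limit of difference quotients in the closed
  subspace \<open>model N\<close>, and the chart line in that direction has the same
  velocity.\<close>

lemma tangent_space_chart: "tangent_space N p \<subseteq> (\<lambda>w. velocity N (chart_line w)) ` model N"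
proof
  fix v assume "v \<in> tangent_space N p"
  then obtain \<gamma> \<epsilon> where g: "\<epsilon> > 0" "smooth_map (euc_mfd {-\<epsilon><..<\<epsilon>}) N \<gamma>" "\<gamma> 0 = p" "v = velocity N \<gamma>"
    by (rule tangent_spaceE)
  have "0 \<in> {-\<epsilon><..<\<epsilon>}" using g(1) by simp
  then obtain w \<delta>
    where \<delta>: "\<delta> > 0" and w: "((\<lambda>t. \<psi> (\<gamma> t)) has_vector_derivative w) (at 0)"
    and V: "\<And>t. \<bar>t - 0\<bar> < \<delta> \<Longrightarrow> t \<in> {-\<epsilon><..<\<epsilon>} \<and> \<gamma> t \<in> V"
    by (rule curve_chart_derivative[OF g(1-3)]) (rule that; assumption)
  have mod: "\<psi> q \<in> model N" if "q \<in> V" for q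
    by (rule chart_model) (use that in blast)
  have "w \<in> model N"
  proof (rule Lim_in_closed_set)
    show "closed (model N)" by (rule closed_subspace[OF subspace_model])
    show "((\<lambda>t. (\<psi> (\<gamma> t) - \<psi> (\<gamma> 0)) /\<^sub>R (t - 0)) \<longlongrightarrow> w) (at 0)"
    proof -
      let ?x = "\<lambda>t. \<psi> (\<gamma> t) - \<psi> (\<gamma> 0)"
      have "((\<lambda>t. norm (?x t - t *\<^sub>R w) / \<bar>t\<bar>) \<longlongrightarrow> 0) (at 0)"
        using w by (simp add: has_vector_derivative_def has_derivative_iff_norm)
      moreover have "eventually (\<lambda>t. norm (?x t - t *\<^sub>R w) / \<bar>t\<bar> = norm (?x t /\<^sub>R (t - 0) - w)) (at 0)"
        unfolding eventually_at_filter
      proof (rule always_eventually, intro allI impI)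
        fix t :: real assume "t \<noteq> 0"
        then have "?x t /\<^sub>R (t - 0) - w = (?x t - t *\<^sub>R w) /\<^sub>R t"
          by (simp add: scaleR_diff_right)
        then show "norm (?x t - t *\<^sub>R w) / \<bar>t\<bar> = norm (?x t /\<^sub>R (t - 0) - w)"
          by (simp add: divide_inverse mult.commute)
      qed
      ultimately have "((\<lambda>t. norm (?x t /\<^sub>R (t - 0) - w)) \<longlongrightarrow> 0) (at 0)"
        by (rule Lim_transform_eventually)
      then show ?thesis by (rule LIM_zero_cancel[OF tendsto_norm_zero_cancel])
    qed
    have "eventually (\<lambda>t. t \<in> {-\<delta><..<\<delta>}) (at 0)"
      using \<delta> by (intro eventually_at_in_open') auto
    then show "eventually (\<lambda>t. (\<psi> (\<gamma> t) - \<psi> (\<gamma> 0)) /\<^sub>R (t - 0) \<in> model N) (at 0)"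
    proof eventually_elim
      case (elim t)
      then have "\<psi> (\<gamma> t) \<in> model N" "\<psi> (\<gamma> 0) \<in> model N"
        using V[of t] mod p g(3) by (auto simp: abs_less_iff)
      then show ?case
        using subspace_model by (simp add: real_vector.subspace_diff real_vector.subspace_scale)
    qed
  qed simp
  moreover have "v = velocity N (chart_line w)"
  proof
    fix f
    show "v f = velocity N (chart_line w) f"
    proof (cases "f \<in> smooth_fun N")
      case True
      obtain T h D where "open T" "\<psi> p \<in> T" "(h has_derivative D) (at (\<psi> p))"
        "\<And>q. q \<in> V \<Longrightarrow> \<psi> q \<in> T \<Longrightarrow> h (\<psi> q) = f q"
        by (rule smooth_fun_extension[OF True]) blast
      note ext = this
      have "velocity N \<gamma> f = D w" by (rule velocity_eq_chart[OF g(1-3) w True ext])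
      moreover have "velocity N (chart_line w) f = D w"
        by (rule velocity_chart_line[OF \<open>w \<in> model N\<close> True ext])
      ultimately show ?thesis by (simp add: g(4))
    next
      case False
      then show ?thesis by (simp add: g(4) velocity_def)
    qed
  qed
  ultimately show "v \<in> (\<lambda>w. velocity N (chart_line w)) ` model N" by blast
qed

text \<open>The velocity of the chart line depends linearly on its direction, so a basis of the
  model space yields a finite spanning set.\<close>

lemma tangent_space_finite_dim: "\<exists>B. finite B \<and> tangent_space N p \<subseteq> span B"
proof -
  let ?\<Lambda> = "\<lambda>w. velocity N (chart_line w)"
  obtain B where B: "B \<subseteq> model N" "independent B" "model N \<subseteq> span B"
    using real_vector.basis_exists[of "model N"] by metis
  have fin: "finite B" using B(2) independent_bound_general by blast
  have "?\<Lambda> w \<in> span (?\<Lambda> ` B) \<and> w \<in> model N" if "w \<in> span B" for w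
    using that
  proof (induction rule: real_vector.span_induct_alt)
    case base
    have z: "?\<Lambda> 0 = 0"
      by (auto simp: velocity_def chart_line_def comp_def fun_eq_iff)
    show ?case unfolding z by (intro conjI real_vector.span_zero real_vector.subspace_0 subspace_model)
  next
    case (step r b w)
    have bm: "b \<in> model N" using step(1) B(1) by blast
    have m: "r *\<^sub>R b + w \<in> model N"
      using step bm subspace_model by (simp add: real_vector.subspace_add real_vector.subspace_scale)
    have e: "?\<Lambda> (r *\<^sub>R b + w) = r *\<^sub>R ?\<Lambda> b + ?\<Lambda> w"
    proof
      fix f
      show "?\<Lambda> (r *\<^sub>R b + w) f = (r *\<^sub>R ?\<Lambda> b + ?\<Lambda> w) f"
      proof (cases "f \<in> smooth_fun N")
        case True
        obtain T h D where "open T" "\<psi> p \<in> T" "(h has_derivative D) (at (\<psi> p))"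
          "\<And>q. q \<in> V \<Longrightarrow> \<psi> q \<in> T \<Longrightarrow> h (\<psi> q) = f q"
          by (rule smooth_fun_extension[OF True]) blast
        note ext = this
        have "linear D" using has_derivative_linear[OF ext(3)] .
        then show ?thesis
          using velocity_chart_line[OF m True ext] velocity_chart_line[OF bm True ext]
            velocity_chart_line[OF conjunct2[OF step(2)] True ext]
          by (simp add: linear_add linear_scale scaleR_fun_def)
      next
        case False
        then show ?thesis by (simp add: velocity_def scaleR_fun_def)
      qed
    qed
    have "?\<Lambda> b \<in> span (?\<Lambda> ` B)" using step(1) by (intro real_vector.span_base imageI)
    then show ?case
      unfolding e using step(2) m by (intro conjI real_vector.span_add real_vector.span_scale) auto
  qed
  then have "tangent_space N p \<subseteq> span (?\<Lambda> ` B)"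
    using tangent_space_chart B(3) by blast
  then show ?thesis using fin by blast
qed

end

section \<open>Normal Lie subgroups\<close>

lemma has_derivative_bound:
  assumes "(f has_derivative f') (at x within S)" "e > 0"
  obtains d where "d > 0"
    "\<And>y. y \<in> S \<Longrightarrow> norm (y - x) < d \<Longrightarrow> norm (f y - f x - f' (y - x)) \<le> e * norm (y - x)"
  using assms unfolding has_derivative_within_alt by blast

text \<open>A tangent vector must be the velocity of a curve, and the formula for the bracket does
  not exhibit one. Closure is thus assumed here and discharged in the final theorem.\<close>

locale lie_grp_bracket = lie_grp +
  assumes bracket_vector_fields:
    "X \<in> vector_fields M \<Longrightarrow> Y \<in> vector_fields M \<Longrightarrow> bracket X Y \<in> vector_fields M"
begin

section \<open>The bracket of vector fields\<close>

lemma vector_fieldsD: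
  assumes "X \<in> vector_fields M"
  shows "p \<in> carrier G \<Longrightarrow> X p \<in> tangent_space M p" "p \<notin> carrier G \<Longrightarrow> X p = 0"
    "f \<in> smooth_fun M \<Longrightarrow> (\<lambda>q. X q f) \<in> smooth_fun M"
  using assms unfolding vector_fields_def topspace_eq by blast+

text \<open>Values off the group and on non-smooth functions are zero by convention and agree
  automatically.\<close>

lemma vector_fields_eqI:
  assumes "X \<in> vector_fields M" "Y \<in> vector_fields M"
    and "\<And>p f. p \<in> carrier G \<Longrightarrow> f \<in> smooth_fun M \<Longrightarrow> X p f = Y p f"
  shows "X = Y"
proof (intro ext)
  fix p f
  show "X p f = Y p f"
  proof (cases "p \<in> carrier G")
    case True
    show ?thesis
    proof (cases "f \<in> smooth_fun M")
      case False
      then show ?thesis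
        using tangent_nonsmooth[OF charted vector_fieldsD(1)[OF assms(1) True]]
          tangent_nonsmooth[OF charted vector_fieldsD(1)[OF assms(2) True]] by simp
    qed (use assms(3) True in blast)
  next
    case False
    then show ?thesis using vector_fieldsD(2) assms(1,2) by simp
  qed
qed

lemma lie_algebra_vector_fields: "X \<in> lie_algebra G M \<Longrightarrow> X \<in> vector_fields M"
  unfolding lie_algebra_def by blast

lemma lie_algebra_left:
  "X \<in> lie_algebra G M \<Longrightarrow> a \<in> carrier G \<Longrightarrow> p \<in> carrier G \<Longrightarrow>
    X (a \<otimes> p) = pushforward M (\<lambda>x. a \<otimes> x) (X p)"
  unfolding lie_algebra_def by blast

lemmas vf_add = real_vector.subspace_add[OF subspace_vector_fields]
  and vf_scale = real_vector.subspace_scale[OF subspace_vector_fields]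

lemma bracket_add:
  assumes "X \<in> vector_fields M" "Y \<in> vector_fields M" "Z \<in> vector_fields M"
  shows "bracket X (Y + Z) = bracket X Y + bracket X Z"
proof (rule vector_fields_eqI)
  show "bracket X (Y + Z) p f = (bracket X Y + bracket X Z) p f"
    if "p \<in> carrier G" "f \<in> smooth_fun M" for p f
    using tangent_add[OF charted vector_fieldsD(1)[OF assms(1) that(1)]
        vector_fieldsD(3)[OF assms(2) that(2)] vector_fieldsD(3)[OF assms(3) that(2)]]
    by (simp add: bracket_def)
qed (use assms vf_add bracket_vector_fields in blast)+

lemma bracket_scale:
  assumes "X \<in> vector_fields M" "Y \<in> vector_fields M"
  shows "bracket X (r *\<^sub>R Y) = r *\<^sub>R bracket X Y"
proof (rule vector_fields_eqI)
  show "bracket X (r *\<^sub>R Y) p f = (r *\<^sub>R bracket X Y) p f"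
    if "p \<in> carrier G" "f \<in> smooth_fun M" for p f
    using tangent_scale[OF charted vector_fieldsD(1)[OF assms(1) that(1)]
        vector_fieldsD(3)[OF assms(2) that(2)], of r]
    by (simp add: bracket_def scaleR_fun_def right_diff_distrib)
qed (use assms vf_scale bracket_vector_fields in blast)+

lemma bracket_anti: "bracket X Y = - bracket Y X"
  by (auto simp: bracket_def fun_eq_iff)

lemma bracket_diff_apply:
  assumes "X \<in> vector_fields M" "Y \<in> vector_fields M" "Z \<in> vector_fields M"
    "p \<in> carrier G" "f \<in> smooth_fun M"
  shows "X p (\<lambda>q. bracket Y Z q f) = X p (\<lambda>q. Y q (\<lambda>q. Z q f)) - X p (\<lambda>q. Z q (\<lambda>q. Y q f))"
  unfolding bracket_def
  by (rule tangent_diff[OF charted vector_fieldsD(1)[OF assms(1,4)]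
        vector_fieldsD(3)[OF assms(2) vector_fieldsD(3)[OF assms(3,5)]]
        vector_fieldsD(3)[OF assms(3) vector_fieldsD(3)[OF assms(2,5)]]])

text \<open>In Leibniz form, so that it also provides the derivation property of
  \<open>bracket E\<close>.\<close>

lemma bracket_jacobi:
  assumes "X \<in> vector_fields M" "Y \<in> vector_fields M" "Z \<in> vector_fields M"
  shows "bracket X (bracket Y Z) = bracket (bracket X Y) Z + bracket Y (bracket X Z)"
proof (rule vector_fields_eqI)
  fix p f assume pf: "p \<in> carrier G" "f \<in> smooth_fun M"
  have b: "bracket X Y p f = X p (\<lambda>q. Y q f) - Y p (\<lambda>q. X q f)" for X Y :: "'a vfield" and f
    by (simp add: bracket_def)
  show "bracket X (bracket Y Z) p f = (bracket (bracket X Y) Z + bracket Y (bracket X Z)) p f"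
    using bracket_diff_apply[OF assms pf] bracket_diff_apply[OF assms(3,1,2) pf]
      bracket_diff_apply[OF assms(2,1,3) pf]
    by (simp add: b[of X "bracket Y Z"] b[of "bracket X Y" Z] b[of Y "bracket X Z"]
        b[of Y Z "\<lambda>q. X q f"] b[of X Y "\<lambda>q. Z q f"] b[of X Z "\<lambda>q. Y q f"])
qed (intro vf_add bracket_vector_fields assms)+

lemma bracket_lie_algebra:
  assumes X: "X \<in> lie_algebra G M" and Y: "Y \<in> lie_algebra G M"
  shows "bracket X Y \<in> lie_algebra G M"
proof -
  note vX = lie_algebra_vector_fields[OF X] and vY = lie_algebra_vector_fields[OF Y]
  note vB = bracket_vector_fields[OF vX vY]
  have step: "A (a \<otimes> p) (\<lambda>q. B q f) = A p (\<lambda>q. B q (\<lambda>x. f (a \<otimes> x)))"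
    if A: "A \<in> lie_algebra G M" and B: "B \<in> lie_algebra G M"
      and ap: "a \<in> carrier G" "p \<in> carrier G" and f: "f \<in> smooth_fun M" for A B a p f
  proof -
    have "A (a \<otimes> p) (\<lambda>q. B q f) = A p (\<lambda>q. B (a \<otimes> q) f)"
      unfolding lie_algebra_left[OF A ap]
      by (rule pushforward_apply[OF vector_fieldsD(3)[OF lie_algebra_vector_fields[OF B] f]])
    also have "\<dots> = A p (\<lambda>q. B q (\<lambda>x. f (a \<otimes> x)))"
    proof (rule tangent_cong[OF charted vector_fieldsD(1)[OF lie_algebra_vector_fields[OF A] ap(2)]])
      show "B (a \<otimes> x) f = B x (\<lambda>x. f (a \<otimes> x))" if "x \<in> topspace (mtop M)" for x
        using lie_algebra_left[OF B ap(1), of x] that pushforward_apply[OF f] by (simp add: topspace_eq)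
    qed
    finally show ?thesis .
  qed
  have "bracket X Y (a \<otimes> p) = pushforward M (\<lambda>x. a \<otimes> x) (bracket X Y p)"
    if ap: "a \<in> carrier G" "p \<in> carrier G" for a p
  proof
    fix f
    show "bracket X Y (a \<otimes> p) f = pushforward M (\<lambda>x. a \<otimes> x) (bracket X Y p) f"
    proof (cases "f \<in> smooth_fun M")
      case True
      then show ?thesis
        unfolding pushforward_apply[OF True] bracket_def
        by (simp add: step[OF X Y ap] step[OF Y X ap])
    next
      case False
      then show ?thesis
        using tangent_nonsmooth[OF charted vector_fieldsD(1)[OF vB]] ap
        by (simp add: pushforward_def)
    qed
  qed
  then show ?thesis using vB unfolding lie_algebra_def by blast
qed

end

section \<open>A normal Lie subgroup and its inclusion\<close>

locale lie_normal = lie_grp_bracket G M for G :: "('a, 'b) monoid_scheme" (structure) and M :: "('a, 'e::euclidean_space) mfd" +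
  fixes K :: "'a set" and N :: "('a, 'd::euclidean_space) mfd"
  assumes lie_subgroup: "lie_subgroup K N G M" and normal: "K \<lhd> G"
begin

sublocale NG: lie_grp "G\<lparr>carrier := K\<rparr>" N
  using lie_subgroup unfolding lie_subgroup_def by unfold_locales blast

lemma subgroup_K: "subgroup K G"
  using lie_subgroup unfolding lie_subgroup_def by blast

lemma topspace_N: "topspace (mtop N) = K"
  using NG.topspace_eq by simp

lemma K_carrier: "x \<in> K \<Longrightarrow> x \<in> carrier G"
  using subgroup.mem_carrier[OF subgroup_K] .

lemma smooth_manifold_M: "smooth_manifold M"
  using lie_group unfolding lie_group_def by blast

lemma smooth_manifold_N: "smooth_manifold N"
  using NG.lie_group unfolding lie_group_def by blast

lemma incl_immersion: "immersion N M (\<lambda>x. x)"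
  using lie_subgroup unfolding lie_subgroup_def by blast

lemma incl_smooth: "smooth_map N M (\<lambda>x. x)"
  using incl_immersion unfolding immersion_def by blast

lemma smooth_fun_restrict: "f \<in> smooth_fun M \<Longrightarrow> f \<in> smooth_fun N"
  using smooth_fun_compose[OF NG.charted charted incl_smooth, of f] by simp

lemma smooth_curve_N: "smooth_map (euc_mfd S) N \<delta> \<Longrightarrow> smooth_map (euc_mfd S) M \<delta>"
  by (rule smooth_map_compose[OF charted_euc_mfd NG.charted _ incl_smooth])

text \<open>In a chart of \<open>N\<close> the increment of \<open>f\<close> at the identity is of
  smaller order than the coordinate increment, because its derivative vanishes along the model
  space. The inclusion is an immersion, so near the identity of \<open>N\<close> that increment is
  bounded by a multiple of the increment in a chart of \<open>M\<close>. The latter is what can be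
  estimated for a curve that is smooth in \<open>M\<close> only.\<close>

lemma annihilator_little_o:
  assumes f: "f \<in> smooth_fun M" and ann: "\<forall>w\<in>tangent_space N \<one>. w f = 0"
    and chart: "(U0, \<phi>) \<in> atlas M" "\<one> \<in> U0" and e: "e > 0"
  shows "\<exists>U. openin (mtop N) U \<and> \<one> \<in> U \<and> (\<forall>d\<in>U. \<bar>f d - f \<one>\<bar> \<le> e * norm (\<phi> d - \<phi> \<one>))"
proof -
  have fN: "f \<in> smooth_fun N" by (rule smooth_fun_restrict[OF f])
  have one: "\<one> \<in> topspace (mtop N)" using subgroup.one_closed[OF subgroup_K] by (simp add: topspace_N)
  obtain V \<psi> where V: "(V, \<psi>) \<in> atlas N" "\<one> \<in> V"
    using one by (rule chart_at[OF NG.charted])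
  note ctx = smooth_manifold_N V
  obtain T h D where T: "open T" "\<psi> \<one> \<in> T" and h: "(h has_derivative D) (at (\<psi> \<one>))"
    and hf: "\<And>q. q \<in> V \<Longrightarrow> \<psi> q \<in> T \<Longrightarrow> h (\<psi> q) = f q"
    by (rule smooth_fun_extension[OF ctx fN]) blast
  have D0: "D w = 0" if "w \<in> model N" for w
  proof -
    have "velocity N (chart_line V \<psi> \<one> w) f = D w"
      by (rule velocity_chart_line[OF ctx that fN T h hf])
    then show ?thesis using bspec[OF ann velocity_chart_line_tangent[OF ctx that]] by simp
  qed
  let ?S = "\<psi> ` (V \<inter> (\<lambda>x. x) -` U0)" and ?g = "\<phi> \<circ> (\<lambda>x. x) \<circ> inv_into V \<psi>"
  have "\<one> \<in> V \<inter> (\<lambda>x. x) -` U0" using V chart by simp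
  then obtain D' where g: "(?g has_derivative D') (at (\<psi> \<one>) within ?S)" and inj: "inj_on D' (model N)"
    using incl_immersion V(1) chart(1) unfolding immersion_def by blast
  have bl: "bounded_linear D'" using has_derivative_bounded_linear[OF g] .
  have subm: "subspace (model N)" by (rule subspace_model[OF ctx])
  \<comment> \<open>An injective linear map is bounded below on a closed subspace of finite
    dimension. Half of \<open>m\<close> is given up to the linearisation error; the other half
    bounds the chart increment from below and is compensated by the factor m / 2 in the estimate for
    \<open>h\<close>.\<close>
  have "\<exists>m>0. \<forall>x\<in>model N. norm (D' x) \<ge> m * norm x"
  proof (rule injective_imp_isometric[OF closed_subspace[OF subm] subm bl])
    show "\<forall>x\<in>model N. D' x = 0 \<longrightarrow> x = 0"
    proof (intro ballI impI)
      fix x assume x: "x \<in> model N" "D' x = 0"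
      have "D' 0 = 0" by (rule linear_0[OF bounded_linear.linear[OF bl]])
      then have "D' x = D' 0" using x(2) by simp
      then show "x = 0" using inj_onD[OF inj _ x(1) real_vector.subspace_0[OF subm]] by simp
    qed
  qed
  then obtain m where m: "m > 0" "\<And>x. x \<in> model N \<Longrightarrow> norm (D' x) \<ge> m * norm x" by blast
  have m2: "m / 2 > 0" using m(1) by simp
  obtain d1 where d1: "d1 > 0"
    "\<And>y. y \<in> ?S \<Longrightarrow> norm (y - \<psi> \<one>) < d1 \<Longrightarrow>
      norm (?g y - ?g (\<psi> \<one>) - D' (y - \<psi> \<one>)) \<le> m / 2 * norm (y - \<psi> \<one>)"
    by (rule has_derivative_bound[OF g m2]) blast
  have em2: "e * (m / 2) > 0" using m(1) e by simp
  obtain d2 where d2: "d2 > 0"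
    "\<And>y. norm (y - \<psi> \<one>) < d2 \<Longrightarrow>
      norm (h y - h (\<psi> \<one>) - D (y - \<psi> \<one>)) \<le> e * (m / 2) * norm (y - \<psi> \<one>)"
    by (rule has_derivative_bound[OF h em2]) blast
  define U where "U = {d \<in> V. \<psi> d \<in> T \<inter> ball (\<psi> \<one>) (min d1 d2)} \<inter> {d \<in> topspace (mtop N). d \<in> U0}"
  have "openin (mtop N) U"
    unfolding U_def
    by (intro openin_Int chart_preimage_open[OF NG.charted V(1)] open_Int T(1) open_ball
        openin_continuous_map_preimage[OF smooth_map_continuous[OF incl_smooth] chart_open[OF charted chart(1)]])
  moreover have "\<one> \<in> U" using V T(2) d1(1) d2(1) chart(2) one by (simp add: U_def)
  moreover have "\<bar>f d - f \<one>\<bar> \<le> e * norm (\<phi> d - \<phi> \<one>)" if "d \<in> U" for d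
  proof -
    have d: "d \<in> V" "\<psi> d \<in> T" "d \<in> U0" "norm (\<psi> d - \<psi> \<one>) < d1" "norm (\<psi> d - \<psi> \<one>) < d2"
      using that by (auto simp: U_def dist_norm norm_minus_commute)
    have mod: "\<psi> q \<in> model N" if "q \<in> V" for q
      by (rule chart_model[OF ctx]) (use that in blast)
    let ?w = "\<psi> d - \<psi> \<one>"
    have w: "?w \<in> model N" using mod d(1) V(2) subm by (simp add: real_vector.subspace_diff)
    have "?g (\<psi> d) = \<phi> d" "?g (\<psi> \<one>) = \<phi> \<one>"
      using d(1) V by (simp_all add: chart_inv[OF NG.charted])
    then have "norm (\<phi> d - \<phi> \<one> - D' ?w) \<le> m / 2 * norm ?w"
      using d1(2)[of "\<psi> d"] d by auto
    moreover have "m * norm ?w \<le> norm (D' ?w)" by (rule m(2)[OF w])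
    moreover have "norm (D' ?w) \<le> norm (\<phi> d - \<phi> \<one>) + norm (\<phi> d - \<phi> \<one> - D' ?w)"
      using norm_triangle_ineq4[of "\<phi> d - \<phi> \<one>" "\<phi> d - \<phi> \<one> - D' ?w"] by simp
    ultimately have lower: "m / 2 * norm ?w \<le> norm (\<phi> d - \<phi> \<one>)" by simp
    have "\<bar>f d - f \<one>\<bar> = norm (h (\<psi> d) - h (\<psi> \<one>) - D ?w)"
      using hf[OF d(1,2)] hf[OF V(2) T(2)] D0[OF w] by simp
    also have "\<dots> \<le> e * (m / 2) * norm ?w" by (rule d2(2)[OF d(5)])
    also have "\<dots> \<le> e * norm (\<phi> d - \<phi> \<one>)"
      using mult_left_mono[OF lower, of e] e by (simp add: mult.assoc)
    finally show ?thesis .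
  qed
  ultimately show ?thesis by blast
qed

text \<open>The curve \<open>c\<close> need not be continuous into \<open>N\<close>, but at some \<open>t0\<close> it returns
  to \<open>c t0\<close> in the topology of \<open>N\<close> along a sequence \<open>t \<rightarrow> t0\<close>.\<close>

lemma curve_annihilated_somewhere:
  assumes f: "f \<in> smooth_fun M" and ann: "\<forall>w\<in>tangent_space N \<one>. w f = 0"
    and \<epsilon>: "\<epsilon> > 0" and c: "smooth_map (euc_mfd {-\<epsilon><..<\<epsilon>}) M c"
    and cK: "\<And>t. t \<in> {-\<epsilon><..<\<epsilon>} \<Longrightarrow> c t \<in> K"
  shows "\<exists>t0\<in>{-\<epsilon><..<\<epsilon>}. deriv (\<lambda>t. f (inv (c t0) \<otimes> c t)) t0 = 0"
proof -
  let ?I = "{-\<epsilon><..<\<epsilon>}"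
  have sc: "second_countable (mtop N)"
    using smooth_manifold_N unfolding smooth_manifold_def by blast
  have "c t \<in> topspace (mtop N)" if "t \<in> ?I" for t using cK[OF that] by (simp add: topspace_N)
  from second_countable_nonisolated[of "mtop N" \<epsilon> c, OF sc \<epsilon> this]
  obtain t0 where t0: "t0 \<in> ?I"
    and acc: "\<And>U \<eta>. openin (mtop N) U \<Longrightarrow> c t0 \<in> U \<Longrightarrow> \<eta> > 0 \<Longrightarrow>
      \<exists>t\<in>?I. t \<noteq> t0 \<and> \<bar>t - t0\<bar> < \<eta> \<and> c t \<in> U" by blast
  have c0: "c t0 \<in> K" "c t0 \<in> carrier G" "inv (c t0) \<in> K" "inv (c t0) \<in> carrier G"
    using cK[OF t0] K_carrier subgroup.m_inv_closed[OF subgroup_K] by auto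
  let ?k = "\<lambda>t. inv (c t0) \<otimes> c t"
  have k: "smooth_map (euc_mfd ?I) M ?k"
    by (intro smooth_mult charted_euc_mfd smooth_const c c0)
  have k0: "?k t0 = \<one>" using c0 by simp
  obtain U0 \<phi> where U0: "(U0, \<phi>) \<in> atlas M" "\<one> \<in> U0"
    by (rule chart_at[OF charted, of \<one>]) (simp_all add: topspace_eq)
  obtain w \<delta> where w: "((\<lambda>t. \<phi> (?k t)) has_vector_derivative w) (at t0)"
    by (rule curve_chart_derivative[OF smooth_manifold_M U0 \<epsilon> k k0 t0]) blast
  have one: "(1::real) > 0" by simp
  obtain \<eta>1 where \<eta>1: "\<eta>1 > 0"
    "\<And>t. norm (t - t0) < \<eta>1 \<Longrightarrow> norm (\<phi> (?k t) - \<phi> (?k t0) - (t - t0) *\<^sub>R w) \<le> 1 * norm (t - t0)"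
    by (rule has_derivative_bound[OF w[unfolded has_vector_derivative_def] one]) blast
  \<comment> \<open>A Lipschitz constant at \<open>t0\<close> for the curve in the ambient chart:
    speed plus 1.\<close>
  let ?C = "norm w + 1"
  have C: "?C > 0" by (simp add: add_nonneg_pos)
  let ?q = "\<lambda>t. f (?k t)"
  have q: "(?q has_real_derivative deriv ?q t0) (at t0)"
    by (rule smooth_on_has_real_derivative[OF _ smooth_fun_curve[OF charted k f] t0]) simp
  have "deriv ?q t0 = 0"
  proof (rule ccontr)
    let ?r = "deriv ?q t0"
    assume r: "?r \<noteq> 0"
    then have r4: "\<bar>?r\<bar> / 4 > 0" by simp
    obtain \<eta>2 where \<eta>2: "\<eta>2 > 0"
      "\<And>t. norm (t - t0) < \<eta>2 \<Longrightarrow> norm (?q t - ?q t0 - ?r * (t - t0)) \<le> \<bar>?r\<bar> / 4 * norm (t - t0)"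
      by (rule has_derivative_bound[OF q[unfolded has_field_derivative_def] r4]) blast
    \<comment> \<open>With this constant the increment of \<open>?q\<close> at a return time is at
      most |r|/2 times the elapsed time, while its deviation from the linear part is at most |r|/4
      times it. Together that is less than |r|, a contradiction.\<close>
    have "\<bar>?r\<bar> / (2 * ?C) > 0" using r C by simp
    from annihilator_little_o[of f, OF f ann U0 this]
    obtain U where U: "openin (mtop N) U" "\<one> \<in> U"
      "\<And>d. d \<in> U \<Longrightarrow> \<bar>f d - f \<one>\<bar> \<le> \<bar>?r\<bar> / (2 * ?C) * norm (\<phi> d - \<phi> \<one>)" by blast
    \<comment> \<open>Translation is continuous in \<open>N\<close>, so the neighbourhood
      \<open>U\<close> of the identity pulls back to a neighbourhood of \<open>c t0\<close> to which
      the curve returns.\<close>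
    have "smooth_map N N (\<lambda>x. inv (c t0) \<otimes> x)"
      using NG.smooth_left[of "inv (c t0)"] c0 by simp
    from openin_continuous_map_preimage[OF smooth_map_continuous[OF this] U(1)]
    have "openin (mtop N) {x \<in> topspace (mtop N). inv (c t0) \<otimes> x \<in> U}" .
    moreover have "c t0 \<in> {x \<in> topspace (mtop N). inv (c t0) \<otimes> x \<in> U}"
      using c0 k0 U(2) by (simp add: topspace_N)
    ultimately obtain t where t: "t \<in> ?I" "t \<noteq> t0" "\<bar>t - t0\<bar> < min \<eta>1 \<eta>2" "?k t \<in> U"
      using acc[of _ "min \<eta>1 \<eta>2"] \<eta>1(1) \<eta>2(1) by fastforce
    let ?d = "\<bar>t - t0\<bar>"
    have d: "?d > 0" using t(2) by simp
    have "norm (\<phi> (?k t) - \<phi> \<one>) \<le> norm (\<phi> (?k t) - \<phi> \<one> - (t - t0) *\<^sub>R w) + norm ((t - t0) *\<^sub>R w)"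
      using norm_triangle_ineq[of "\<phi> (?k t) - \<phi> \<one> - (t - t0) *\<^sub>R w" "(t - t0) *\<^sub>R w"] by simp
    also have "\<dots> \<le> ?C * ?d"
    proof -
      have h1: "norm (\<phi> (?k t) - \<phi> \<one> - (t - t0) *\<^sub>R w) \<le> ?d"
        using \<eta>1(2)[of t] t(3) unfolding k0 by simp
      have h2: "norm ((t - t0) *\<^sub>R w) = norm w * ?d" by simp
      show ?thesis
        using add_left_mono[OF h1, of "norm w * ?d"] unfolding h2 distrib_right mult_1
        by (simp only: add.commute)
    qed
    finally have kt: "norm (\<phi> (?k t) - \<phi> \<one>) \<le> ?C * ?d" .
    have "\<bar>?q t - ?q t0\<bar> \<le> \<bar>?r\<bar> / (2 * ?C) * norm (\<phi> (?k t) - \<phi> \<one>)"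
      using U(3)[OF t(4)] k0 by simp
    also have "\<dots> \<le> \<bar>?r\<bar> / (2 * ?C) * (?C * ?d)"
      using kt C by (intro mult_left_mono) auto
    also have "\<dots> = \<bar>?r\<bar> / 2 * ?d"
    proof -
      have "x / (2 * y) * (y * z) = x / 2 * z" if "y > 0" for x y z :: real
        using that by (simp add: field_simps)
      then show ?thesis using C .
    qed
    finally have u: "\<bar>?q t - ?q t0\<bar> \<le> \<bar>?r\<bar> / 2 * ?d" .
    have v: "\<bar>?q t - ?q t0 - ?r * (t - t0)\<bar> \<le> \<bar>?r\<bar> / 4 * ?d"
      using \<eta>2(2)[of t] t(3) by simp
    have "\<bar>?r\<bar> * ?d \<le> \<bar>?q t - ?q t0\<bar> + \<bar>?q t - ?q t0 - ?r * (t - t0)\<bar>"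
      using abs_triangle_ineq4[of "?q t - ?q t0" "?q t - ?q t0 - ?r * (t - t0)"] by (simp add: abs_mult)
    also have "\<dots> \<le> \<bar>?r\<bar> / 2 * ?d + \<bar>?r\<bar> / 4 * ?d" by (rule add_mono[OF u v])
    finally have "\<bar>?r\<bar> * ?d \<le> \<bar>?r\<bar> / 2 * ?d + \<bar>?r\<bar> / 4 * ?d" .
    moreover have "x * y > x / 2 * y + x / 4 * y" if "x > 0" "y > 0" for x y :: real
      using mult_pos_pos[OF that] by (simp add: field_simps)
    then have "\<bar>?r\<bar> * ?d > \<bar>?r\<bar> / 2 * ?d + \<bar>?r\<bar> / 4 * ?d" using r d by simp
    ultimately show False by simp
  qed
  then show ?thesis using t0 by blast
qed

lemma smooth_euc_fst_snd:
  "smooth_map (euc_mfd (S \<times> T)) (euc_mfd S) fst" "smooth_map (euc_mfd (S \<times> T)) (euc_mfd T) snd"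
  using smooth_map_fst_snd[OF charted_euc_mfd charted_euc_mfd, of S T] by (simp_all add: prod_euc_mfd)

text \<open>Normality keeps the conjugated curve in \<open>K\<close>, but its smoothness into
  \<open>N\<close> is not known. On every interval around 0 some \<open>t0\<close> satisfies the
  claim after translation to the identity; such points accumulate at 0, and continuity of the
  partial derivative on the diagonal gives the claim at 0 itself.\<close>

lemma conjugate_annihilated:
  assumes f: "f \<in> smooth_fun M" and ann: "\<forall>w\<in>tangent_space N \<one>. w f = 0"
    and a: "a \<in> carrier G" and \<epsilon>: "\<epsilon> > 0"
    and \<delta>: "smooth_map (euc_mfd {-\<epsilon><..<\<epsilon>}) N \<delta>" "\<delta> 0 = \<one>"
  shows "deriv (\<lambda>t. f (a \<otimes> \<delta> t \<otimes> inv a)) 0 = 0"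
proof -
  let ?I = "{-\<epsilon><..<\<epsilon>}"
  let ?c = "\<lambda>t. a \<otimes> \<delta> t \<otimes> inv a"
  have c: "smooth_map (euc_mfd ?I) M ?c"
    by (intro smooth_mult charted_euc_mfd smooth_const smooth_curve_N[OF \<delta>(1)] a inv_closed)
  have cK: "?c t \<in> K" if "t \<in> ?I" for t
    using normal.inv_op_closed2[OF normal a] NG.curve_in[OF \<delta>(1) that] by simp
  have c0: "?c 0 = \<one>" using a by (simp add: \<delta>(2))
  let ?q = "\<lambda>z. f (inv (?c (fst z)) \<otimes> ?c (snd z))"
  have "smooth_map (euc_mfd (?I \<times> ?I)) M (\<lambda>z. inv (?c (fst z)) \<otimes> ?c (snd z))"
    by (rule smooth_mult[OF charted_euc_mfd smooth_inv[OF charted_euc_mfd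
          smooth_map_compose[OF charted_euc_mfd charted_euc_mfd smooth_euc_fst_snd(1) c]]
          smooth_map_compose[OF charted_euc_mfd charted_euc_mfd smooth_euc_fst_snd(2) c]])
  then have sm: "smooth_on (?I \<times> ?I) ?q" by (rule smooth_fun_curve[OF charted _ f])
  have op: "open (?I \<times> ?I)" by (simp add: open_Times)
  obtain q1 q2 where q2: "smooth_on (?I \<times> ?I) q2"
    and d2: "\<And>s t. (s, t) \<in> ?I \<times> ?I \<Longrightarrow> ((\<lambda>t. ?q (s, t)) has_real_derivative q2 (s, t)) (at t)"
    by (rule smooth_on_partials[OF op sm]) blast
  have q2z: "\<exists>t0\<in>{-\<eta><..<\<eta>}. q2 (t0, t0) = 0" if \<eta>: "0 < \<eta>" "\<eta> \<le> \<epsilon>" for \<eta>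
  proof -
    have sub: "{-\<eta><..<\<eta>} \<subseteq> ?I" using \<eta> by auto
    obtain t0 where t0: "t0 \<in> {-\<eta><..<\<eta>}" "deriv (\<lambda>t. f (inv (?c t0) \<otimes> ?c t)) t0 = 0"
      using curve_annihilated_somewhere[of f, OF f ann \<eta>(1) smooth_curve_subset[OF c sub charted]] cK sub by blast
    have "(t0, t0) \<in> ?I \<times> ?I" using t0(1) sub by blast
    from DERIV_imp_deriv[OF d2[OF this]] show ?thesis using t0 by auto
  qed
  have "q2 (0, 0) = 0"
  proof (rule ccontr)
    assume ne: "q2 (0, 0) \<noteq> 0"
    have "isCont q2 (0, 0)"
      using smooth_on_continuous_on[OF q2] op \<epsilon> by (auto simp: continuous_on_eq_continuous_at)
    then obtain r where r: "r > 0" "\<And>z. dist z (0, 0) < r \<Longrightarrow> dist (q2 z) (q2 (0, 0)) < \<bar>q2 (0, 0)\<bar>"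
      using ne unfolding continuous_at_eps_delta by (metis zero_less_abs_iff)
    define \<eta> where "\<eta> = min \<epsilon> (r / 2)"
    have \<eta>: "0 < \<eta>" "\<eta> \<le> \<epsilon>" "2 * \<eta> \<le> r" using \<epsilon> r(1) by (auto simp: \<eta>_def)
    obtain t where t: "t \<in> {-\<eta><..<\<eta>}" "q2 (t, t) = 0" using q2z[OF \<eta>(1,2)] by blast
    have "norm (t, t) \<le> norm t + norm t" by (rule norm_Pair_le)
    also have "\<dots> < r" using t(1) \<eta>(3) by auto
    finally have "dist (t, t) (0, 0) < r" by (simp add: dist_norm)
    from r(2)[OF this] show False using t(2) by (simp add: dist_real_def)
  qed
  moreover have "((\<lambda>t. ?q (0, t)) has_real_derivative q2 (0, 0)) (at 0)"
    using \<epsilon> by (intro d2) simp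
  ultimately have "deriv (\<lambda>t. ?q (0, t)) 0 = 0" by (simp add: DERIV_imp_deriv)
  moreover have "deriv (\<lambda>t. ?q (0, t)) 0 = deriv (\<lambda>t. f (?c t)) 0"
  proof (rule deriv_cong_ev)
    have "eventually (\<lambda>t. t \<in> ?I) (nhds 0)"
      using \<epsilon> by (intro eventually_nhds_in_open) auto
    then show "eventually (\<lambda>t. ?q (0, t) = f (?c t)) (nhds 0)"
      by eventually_elim (simp only: fst_conv snd_conv c0 inv_one l_one curve_in[OF c])
  qed simp
  ultimately show ?thesis by simp
qed

end

context lie_grp
begin

text \<open>The product p \<otimes> \<gamma> s \<otimes> inv (\<gamma> s) is constant in s, so its
  two partial derivatives on the diagonal cancel.\<close>

lemma deriv_inverse_curve:
  assumes \<epsilon>: "\<epsilon> > 0" and \<gamma>: "smooth_map (euc_mfd {-\<epsilon><..<\<epsilon>}) M \<gamma>" "\<gamma> 0 = \<one>"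
    and f: "f \<in> smooth_fun M" and p: "p \<in> carrier G"
  shows "deriv (\<lambda>r. f (p \<otimes> inv (\<gamma> r))) 0 = - lfield (velocity M \<gamma>) p f"
proof -
  let ?I = "{-\<epsilon><..<\<epsilon>}"
  let ?Q = "\<lambda>z. f (p \<otimes> \<gamma> (fst z) \<otimes> inv (\<gamma> (snd z)))"
  note pr = smooth_map_fst_snd[OF charted_euc_mfd charted_euc_mfd, of ?I ?I, unfolded prod_euc_mfd]
  note pull = smooth_map_compose[OF charted_euc_mfd charted_euc_mfd _ \<gamma>(1)]
  have "smooth_map (euc_mfd (?I \<times> ?I)) M (\<lambda>z. p \<otimes> \<gamma> (fst z) \<otimes> inv (\<gamma> (snd z)))"
    by (intro smooth_mult smooth_inv charted_euc_mfd smooth_const p pull[OF pr(1)] pull[OF pr(2)])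
  then have sm: "smooth_on (?I \<times> ?I) ?Q" by (rule smooth_fun_curve[OF charted _ f])
  have op: "open (?I \<times> ?I)" by (simp add: open_Times)
  obtain q1 q2 where
    q1: "\<And>s t. (s, t) \<in> ?I \<times> ?I \<Longrightarrow> ((\<lambda>s. ?Q (s, t)) has_real_derivative q1 (s, t)) (at s)" and
    q2: "\<And>s t. (s, t) \<in> ?I \<times> ?I \<Longrightarrow> ((\<lambda>t. ?Q (s, t)) has_real_derivative q2 (s, t)) (at t)" and
    qd: "\<And>s. (s, s) \<in> ?I \<times> ?I \<Longrightarrow> ((\<lambda>s. ?Q (s, s)) has_real_derivative q1 (s, s) + q2 (s, s)) (at s)"
    by (rule smooth_on_partials[OF op sm]) blast
  have z: "(0, 0) \<in> ?I \<times> ?I" using \<epsilon> by simp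
  have ev: "eventually (\<lambda>t. t \<in> ?I) (nhds 0)"
    using \<epsilon> by (intro eventually_nhds_in_open) auto
  have "deriv (\<lambda>s. ?Q (s, s)) 0 = deriv (\<lambda>s::real. f p) 0"
  proof (rule deriv_cong_ev)
    show "eventually (\<lambda>s. ?Q (s, s) = f p) (nhds 0)"
      using ev by eventually_elim (simp add: m_assoc p curve_in[OF \<gamma>(1)])
  qed simp
  then have 1: "q1 (0, 0) + q2 (0, 0) = 0" using DERIV_imp_deriv[OF qd[OF z]] by simp
  have "deriv (\<lambda>s. ?Q (s, 0)) 0 = deriv (\<lambda>s. f (p \<otimes> \<gamma> s)) 0"
  proof (rule deriv_cong_ev)
    show "eventually (\<lambda>s. ?Q (s, 0) = f (p \<otimes> \<gamma> s)) (nhds 0)"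
      using ev by eventually_elim (simp add: p \<gamma>(2) curve_in[OF \<gamma>(1)])
  qed simp
  then have 2: "q1 (0, 0) = lfield (velocity M \<gamma>) p f"
    using DERIV_imp_deriv[OF q1[OF z]] lfield_velocity[OF p f] by simp
  have "q2 (0, 0) = deriv (\<lambda>r. f (p \<otimes> inv (\<gamma> r))) 0"
    using DERIV_imp_deriv[OF q2[OF z]] by (simp add: \<gamma>(2) p)
  then show ?thesis using 1 2 by simp
qed

lemma lie_algebra_eqI:
  assumes X: "X \<in> lie_algebra G M" and Y: "Y \<in> lie_algebra G M" and p: "p \<in> carrier G"
    and eq: "X p = Y p"
  shows "X = Y"
proof -
  have "Z \<one> = pushforward M (\<lambda>x. inv p \<otimes> x) (Z p)" if "Z \<in> lie_algebra G M" for Z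
  proof -
    have "Z (inv p \<otimes> p) = pushforward M (\<lambda>x. inv p \<otimes> x) (Z p)"
      using that p inv_closed unfolding lie_algebra_def by blast
    then show ?thesis using p by simp
  qed
  then have "X \<one> = Y \<one>" using X Y eq by simp
  then show ?thesis using lie_algebra_lfield(2)[OF X] lie_algebra_lfield(2)[OF Y] by simp
qed

text \<open>Takes the place of extension by cut-off functions: the extension is global and
  left-invariant.\<close>

lemma lie_algebra_extend:
  assumes p: "p \<in> carrier G" and u: "u \<in> tangent_space M p"
  shows "\<exists>E\<in>lie_algebra G M. E p = u"
proof -
  obtain v where v: "v \<in> tangent_space M \<one>" "u = pushforward M (\<lambda>x. p \<otimes> x) v"
    using u unfolding tangent_space_eq[OF p] by blast
  then show ?thesis
    using lfield_lie_algebra[OF v(1)] p by (intro bexI[of _ "lfield v"]) (auto simp: lfield_def)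
qed

end

section \<open>The Lie algebra of the subgroup as an ideal\<close>

context lie_normal
begin

lemma subgroup_tangent_eq: "subgroup_tangent N G M = pushforward M (\<lambda>x. x) ` tangent_space N \<one>"
  by (rule subgroup_tangent_def)

lemma subgroup_tangent_subset: "subgroup_tangent N G M \<subseteq> tangent_space M \<one>"
  using pushforward_tangent[OF NG.charted charted incl_smooth] unfolding subgroup_tangent_eq by blast

lemma subspace_subgroup_tangent: "subspace (subgroup_tangent N G M)"
  unfolding subgroup_tangent_eq
  by (rule linear_subspace_image[OF linear_pushforward]) (use NG.subspace_tangent_one in simp)

lemma subgroup_tangent_basis:
  obtains B where "finite B" "B \<subseteq> subgroup_tangent N G M" "span B = subgroup_tangent N G M"
proof -
  have "\<one> \<in> topspace (mtop N)" using subgroup.one_closed[OF subgroup_K] by (simp add: topspace_N)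
  then obtain V \<psi> where V: "(V, \<psi>) \<in> atlas N" "\<one> \<in> V" by (rule chart_at[OF NG.charted])
  obtain C where C: "finite C" "tangent_space N \<one> \<subseteq> span C"
    using tangent_space_finite_dim[OF smooth_manifold_N V] by blast
  have sub: "subgroup_tangent N G M \<subseteq> span (pushforward M (\<lambda>x. x) ` C)"
    unfolding subgroup_tangent_eq linear_span_image[OF linear_pushforward] using C(2) by (rule image_mono)
  obtain B where B: "B \<subseteq> subgroup_tangent N G M" "independent B" "subgroup_tangent N G M \<subseteq> span B"
    using real_vector.basis_exists[of "subgroup_tangent N G M"] by metis
  have "finite B"
    using real_vector.independent_span_bound[of "pushforward M (\<lambda>x. x) ` C" B] B C(1) sub by auto
  moreover have "span B = subgroup_tangent N G M"
    using B real_vector.span_minimal[OF B(1) subspace_subgroup_tangent] by blast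
  ultimately show thesis using that B(1) by blast
qed

text \<open>Differentiating \<open>f (\<gamma> s \<otimes> \<delta> t \<otimes> inv (\<gamma> s))\<close> in \<open>t\<close> and then in \<open>s\<close> gives
  \<open>[X, V] f\<close> at the identity, and the first derivative already vanishes for every \<open>s\<close>.\<close>

lemma bracket_annihilated:
  assumes X: "X \<in> lie_algebra G M" and V: "V \<in> subgroup_lie_algebra N G M"
    and f: "f \<in> smooth_fun M" and ann: "\<forall>w\<in>tangent_space N \<one>. w f = 0"
  shows "bracket X V \<one> f = 0"
proof -
  have VL: "V \<in> lie_algebra G M" and V1: "V \<one> \<in> subgroup_tangent N G M"
    using V unfolding subgroup_lie_algebra_def by auto
  obtain \<gamma> \<alpha> where g: "\<alpha> > 0" "smooth_map (euc_mfd {-\<alpha><..<\<alpha>}) M \<gamma>" "\<gamma> 0 = \<one>" "X \<one> = velocity M \<gamma>"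
    using lie_algebra_lfield(1)[OF X] by (rule tangent_spaceE)
  obtain v where v: "v \<in> tangent_space N \<one>" "V \<one> = pushforward M (\<lambda>x. x) v"
    using V1 unfolding subgroup_tangent_eq by blast
  obtain \<delta> \<beta> where d: "\<beta> > 0" "smooth_map (euc_mfd {-\<beta><..<\<beta>}) N \<delta>" "\<delta> 0 = \<one>" "v = velocity N \<delta>"
    using v(1) by (rule tangent_spaceE)
  have Vd: "V \<one> = velocity M \<delta>"
    unfolding v(2) d(4) by (rule pushforward_velocity[OF NG.charted charted incl_smooth])
  have Xl: "X = lfield (velocity M \<gamma>)" using lie_algebra_lfield(2)[OF X] by (simp only: g(4))
  have Vl: "V = lfield (velocity M \<delta>)" using lie_algebra_lfield(2)[OF VL] by (simp only: Vd)
  define \<epsilon> where "\<epsilon> = min \<alpha> \<beta>"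
  let ?I = "{-\<epsilon><..<\<epsilon>}"
  have \<epsilon>: "\<epsilon> > 0" using g(1) d(1) by (simp add: \<epsilon>_def)
  have sg: "smooth_map (euc_mfd ?I) M \<gamma>"
    by (rule smooth_curve_subset[OF g(2) _ charted]) (auto simp: \<epsilon>_def)
  have sdN: "smooth_map (euc_mfd ?I) N \<delta>"
    by (rule smooth_curve_subset[OF d(2) _ NG.charted]) (auto simp: \<epsilon>_def)
  have sd: "smooth_map (euc_mfd ?I) M \<delta>" by (rule smooth_curve_N[OF sdN])
  have ev: "eventually (\<lambda>t. t \<in> ?I) (nhds 0)"
    using \<epsilon> by (intro eventually_nhds_in_open) auto
  have z: "(0, 0) \<in> ?I \<times> ?I" using \<epsilon> by simp
  have op: "open (?I \<times> ?I)" by (simp add: open_Times)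
  note Xf = vector_fieldsD(3)[OF lie_algebra_vector_fields[OF X] f]
  note Vf = vector_fieldsD(3)[OF lie_algebra_vector_fields[OF VL] f]
  \<comment> \<open>The two occurrences of \<gamma> get separate parameters s and r. The diagonal s
    = r is conjugation, where the derivative in t vanishes; at the origin the s-derivative yields X
    (V f) and the r-derivative -V (X f).\<close>
  let ?H = "\<lambda>s t r. f (\<gamma> s \<otimes> \<delta> t \<otimes> inv (\<gamma> r))"
  let ?G = "\<lambda>y. deriv (\<lambda>t. ?H (fst y) t (snd y)) 0"
  have comp: "smooth_map (euc_mfd A) M (\<lambda>x. \<eta> (h x))"
    if "smooth_map (euc_mfd A) (euc_mfd ?I) h" "smooth_map (euc_mfd ?I) M \<eta>"
    for A :: "((real \<times> real) \<times> real) set" and h \<eta>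
    by (rule smooth_map_compose[OF charted_euc_mfd charted_euc_mfd that])
  have pr: "smooth_map (euc_mfd ((?I \<times> ?I) \<times> ?I)) (euc_mfd ?I) (\<lambda>x. fst (fst x))"
    "smooth_map (euc_mfd ((?I \<times> ?I) \<times> ?I)) (euc_mfd ?I) (\<lambda>x. snd (fst x))"
    "smooth_map (euc_mfd ((?I \<times> ?I) \<times> ?I)) (euc_mfd ?I) snd"
    by (rule smooth_map_compose[OF charted_euc_mfd charted_euc_mfd smooth_euc_fst_snd(1) smooth_euc_fst_snd(1)]
        smooth_map_compose[OF charted_euc_mfd charted_euc_mfd smooth_euc_fst_snd(1) smooth_euc_fst_snd(2)]
        smooth_euc_fst_snd(2))+
  have "smooth_map (euc_mfd ((?I \<times> ?I) \<times> ?I)) M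
      (\<lambda>x. \<gamma> (fst (fst x)) \<otimes> \<delta> (snd x) \<otimes> inv (\<gamma> (snd (fst x))))"
    by (intro smooth_mult smooth_inv charted_euc_mfd comp[OF pr(1) sg] comp[OF pr(2) sg] comp[OF pr(3) sd])
  then have "(\<lambda>x. ?H (fst (fst x)) (snd x) (snd (fst x))) \<in> smooth_fun (euc_mfd ((?I \<times> ?I) \<times> ?I))"
    by (rule smooth_fun_compose[OF charted_euc_mfd charted _ f])
  from smooth_fun_partial[OF charted_euc_mfd \<epsilon> this[folded prod_euc_mfd, unfolded prod_euc_mfd[of ?I ?I]]]
  have Gsm: "smooth_on (?I \<times> ?I) ?G" by (simp add: smooth_fun_euc)
  obtain G1 G2 where
    G1: "\<And>s t. (s, t) \<in> ?I \<times> ?I \<Longrightarrow> ((\<lambda>s. ?G (s, t)) has_real_derivative G1 (s, t)) (at s)" and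
    G2: "\<And>s t. (s, t) \<in> ?I \<times> ?I \<Longrightarrow> ((\<lambda>t. ?G (s, t)) has_real_derivative G2 (s, t)) (at t)" and
    Gd: "\<And>s. (s, s) \<in> ?I \<times> ?I \<Longrightarrow> ((\<lambda>s. ?G (s, s)) has_real_derivative G1 (s, s) + G2 (s, s)) (at s)"
    by (rule smooth_on_partials[OF op Gsm]) blast
  have "deriv (\<lambda>s. ?G (s, s)) 0 = deriv (\<lambda>s::real. 0) 0"
  proof (rule deriv_cong_ev)
    show "eventually (\<lambda>s. ?G (s, s) = 0) (nhds 0)"
      using ev
    proof eventually_elim
      case (elim s)
      from conjugate_annihilated[OF f ann curve_in[OF sg elim] \<epsilon> sdN d(3)]
      show ?case by simp
    qed
  qed simp
  then have sum: "G1 (0, 0) + G2 (0, 0) = 0" using DERIV_imp_deriv[OF Gd[OF z]] by simp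
  have "deriv (\<lambda>s. ?G (s, 0)) 0 = deriv (\<lambda>s. V (\<gamma> s) f) 0"
  proof (rule deriv_cong_ev)
    show "eventually (\<lambda>s. ?G (s, 0) = V (\<gamma> s) f) (nhds 0)"
      using ev
    proof eventually_elim
      case (elim s)
      have gs: "\<gamma> s \<in> carrier G" by (rule curve_in[OF sg elim])
      have "?G (s, 0) = deriv (\<lambda>t. f (\<gamma> s \<otimes> \<delta> t)) 0"
      proof (rule deriv_cong_ev)
        show "eventually (\<lambda>t. ?H (fst (s, 0::real)) t (snd (s, 0)) = f (\<gamma> s \<otimes> \<delta> t)) (nhds 0)"
          using ev by eventually_elim (simp add: g(3) gs curve_in[OF sd])
      qed simp
      also have "\<dots> = V (\<gamma> s) f" unfolding Vl by (rule lfield_velocity[OF gs f, symmetric])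
      finally show ?case .
    qed
  qed simp
  then have G1_eq: "G1 (0, 0) = X \<one> (\<lambda>q. V q f)"
    using DERIV_imp_deriv[OF G1[OF z]] by (simp only: g(4) velocity_apply[OF Vf])
  \<comment> \<open>The r- and t-derivatives are interchanged here: for fixed t the r-derivative is
    already known to be -X f at \<delta> t.\<close>
  let ?q = "\<lambda>y. ?H 0 (snd y) (fst y)"
  have pr2: "smooth_map (euc_mfd (?I \<times> ?I)) M (\<lambda>x. \<delta> (snd x))"
    "smooth_map (euc_mfd (?I \<times> ?I)) M (\<lambda>x. \<gamma> (fst x))"
    by (rule smooth_map_compose[OF charted_euc_mfd charted_euc_mfd smooth_euc_fst_snd(2) sd]
        smooth_map_compose[OF charted_euc_mfd charted_euc_mfd smooth_euc_fst_snd(1) sg])+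
  have g0: "\<gamma> 0 \<in> carrier G" by (simp add: g(3))
  have "smooth_map (euc_mfd (?I \<times> ?I)) M (\<lambda>y. \<gamma> 0 \<otimes> \<delta> (snd y) \<otimes> inv (\<gamma> (fst y)))"
    by (intro smooth_mult smooth_inv smooth_const charted_euc_mfd pr2 g0)
  then have "smooth_on (?I \<times> ?I) ?q" by (rule smooth_fun_curve[OF charted _ f])
  from mixed_partials[OF \<epsilon> this]
  have "deriv (\<lambda>r. ?G (0, r)) 0 = deriv (\<lambda>t. deriv (\<lambda>r. ?H 0 t r) 0) 0" by simp
  also have "\<dots> = deriv (\<lambda>t. - X (\<delta> t) f) 0"
  proof (rule deriv_cong_ev)
    show "eventually (\<lambda>t. deriv (\<lambda>r. ?H 0 t r) 0 = - X (\<delta> t) f) (nhds 0)"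
      using ev
    proof eventually_elim
      case (elim t)
      have "\<delta> t \<in> carrier G" by (rule curve_in[OF sd elim])
      then show ?case
        using deriv_inverse_curve[OF \<epsilon> sg g(3) f, of "\<delta> t"] by (simp add: g(3) Xl)
    qed
  qed simp
  also have "\<dots> = - V \<one> (\<lambda>q. X q f)"
  proof -
    have "((\<lambda>t. X (\<delta> t) f) has_real_derivative velocity M \<delta> (\<lambda>q. X q f)) (at 0)"
      by (rule velocity_has_derivative[OF charted \<epsilon> sd Xf])
    from DERIV_imp_deriv[OF DERIV_minus[OF this]] show ?thesis by (simp only: Vd)
  qed
  finally have "G2 (0, 0) = - V \<one> (\<lambda>q. X q f)"
    using DERIV_imp_deriv[OF G2[OF z]] by simp
  then show ?thesis using sum G1_eq by (simp add: bracket_def)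
qed

lemma subgroup_lie_algebra_subset: "subgroup_lie_algebra N G M \<subseteq> lie_algebra G M"
  unfolding subgroup_lie_algebra_def by blast

text \<open>A function killed by the spanning set \<open>B\<close> is killed by all velocities of
  \<open>N\<close> at the identity, so \<open>bracket_annihilated\<close> applies; duality in finite
  dimension then gives membership.\<close>

lemma bracket_ideal:
  assumes X: "X \<in> lie_algebra G M" and V: "V \<in> subgroup_lie_algebra N G M"
  shows "bracket X V \<in> subgroup_lie_algebra N G M"
proof -
  have BL: "bracket X V \<in> lie_algebra G M"
    using bracket_lie_algebra[OF X] V subgroup_lie_algebra_subset by blast
  obtain B where B: "finite B" "B \<subseteq> subgroup_tangent N G M" "span B = subgroup_tangent N G M"
    by (rule subgroup_tangent_basis)
  have "bracket X V \<one> \<in> span B"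
  proof (rule span_annihilator[of "tangent_space M \<one>" B "bracket X V \<one>" "smooth_fun M"])
    show "B \<subseteq> tangent_space M \<one>" using B(2) subgroup_tangent_subset by blast
    show "bracket X V \<one> \<in> tangent_space M \<one>" by (rule lie_algebra_lfield(1)[OF BL])
    show "bracket X V \<one> f = 0" if f: "f \<in> smooth_fun M" and ann: "\<And>b. b \<in> B \<Longrightarrow> b f = 0" for f
    proof (rule bracket_annihilated[OF X V f], intro ballI)
      fix w assume "w \<in> tangent_space N \<one>"
      then have "pushforward M (\<lambda>x. x) w \<in> span B"
        unfolding B(3) subgroup_tangent_eq by (rule imageI)
      then have "pushforward M (\<lambda>x. x) w f = 0"
      proof (induction rule: real_vector.span_induct_alt)
        case (step c x y)
        then show ?case using ann[OF step(1)] by (simp add: scaleR_fun_def)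
      qed simp
      then show "w f = 0" by (simp add: pushforward_apply[OF f])
    qed
  qed (fact subspace_tangent_one B(1) tangent_add[OF charted] tangent_scale[OF charted]
      tangent_nonsmooth[OF charted] smooth_fun_add[OF charted] smooth_fun_scale[OF charted])+
  then show ?thesis using BL B(3) unfolding subgroup_lie_algebra_def by simp
qed

lemma subspace_subgroup_lie_algebra: "subspace (subgroup_lie_algebra N G M)"
  unfolding real_vector.subspace_def
proof (intro conjI ballI allI)
  note L = real_vector.subspace_0[OF subspace_lie_algebra]
    real_vector.subspace_add[OF subspace_lie_algebra] real_vector.subspace_scale[OF subspace_lie_algebra]
  note S = real_vector.subspace_0[OF subspace_subgroup_tangent]
    real_vector.subspace_add[OF subspace_subgroup_tangent] real_vector.subspace_scale[OF subspace_subgroup_tangent]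
  have app: "(0 :: 'a vfield) \<one> = 0" "(X + Y) \<one> = X \<one> + Y \<one>" "(r *\<^sub>R X) \<one> = r *\<^sub>R X \<one>"
    for X Y :: "'a vfield" and r
    by (simp_all only: zero_fun_def plus_fun_def scaleR_fun_def)
  show "0 \<in> subgroup_lie_algebra N G M"
    unfolding subgroup_lie_algebra_def mem_Collect_eq app using L(1) S(1) ..
  fix X assume X: "X \<in> subgroup_lie_algebra N G M"
  show "X + Y \<in> subgroup_lie_algebra N G M" if "Y \<in> subgroup_lie_algebra N G M" for Y
    using X that L(2) S(2) unfolding subgroup_lie_algebra_def mem_Collect_eq app by blast
  show "r *\<^sub>R X \<in> subgroup_lie_algebra N G M" for r
    using X L(3) S(3) unfolding subgroup_lie_algebra_def mem_Collect_eq app by blast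
qed

lemma generated_distribution_eq:
  assumes p: "p \<in> carrier G"
  shows "generated_distribution N G M p = (\<lambda>W. W p) ` subgroup_lie_algebra N G M"
proof
  show "generated_distribution N G M p \<subseteq> (\<lambda>W. W p) ` subgroup_lie_algebra N G M"
  proof
    fix u assume "u \<in> generated_distribution N G M p"
    then obtain v where v: "v \<in> subgroup_tangent N G M" "u = pushforward M (\<lambda>x. p \<otimes> x) v"
      unfolding generated_distribution_def by blast
    have vT: "v \<in> tangent_space M \<one>" using v(1) subgroup_tangent_subset by blast
    have "lfield v \<in> subgroup_lie_algebra N G M"
      using lfield_lie_algebra[OF vT] lfield_one[OF vT] v(1) unfolding subgroup_lie_algebra_def by simp
    moreover have "u = lfield v p" using v(2) p by (simp add: lfield_def)
    ultimately show "u \<in> (\<lambda>W. W p) ` subgroup_lie_algebra N G M" by blast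
  qed
  show "(\<lambda>W. W p) ` subgroup_lie_algebra N G M \<subseteq> generated_distribution N G M p"
  proof
    fix u assume "u \<in> (\<lambda>W. W p) ` subgroup_lie_algebra N G M"
    then obtain W where W: "W \<in> lie_algebra G M" "W \<one> \<in> subgroup_tangent N G M" "u = W p"
      unfolding subgroup_lie_algebra_def by blast
    have "W (p \<otimes> \<one>) = pushforward M (\<lambda>x. p \<otimes> x) (W \<one>)"
      by (rule lie_algebra_left[OF W(1) p one_closed])
    then show "u \<in> generated_distribution N G M p"
      unfolding generated_distribution_def W(3) using p W(2) by simp
  qed
qed

lemma linear_eval: "linear (\<lambda>X :: 'a vfield. X p)"
  by (rule linearI) (simp_all only: plus_fun_def scaleR_fun_def)

lemma subspace_generated_distribution:
  "p \<in> carrier G \<Longrightarrow> subspace (generated_distribution N G M p)"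
  unfolding generated_distribution_eq
  by (rule linear_subspace_image[OF linear_eval subspace_subgroup_lie_algebra])

lemma generated_distribution_tangent:
  "p \<in> carrier G \<Longrightarrow> generated_distribution N G M p \<subseteq> tangent_space M p"
  unfolding generated_distribution_eq
  using vector_fieldsD(1)[OF lie_algebra_vector_fields] subgroup_lie_algebra_subset by blast

end

section \<open>Second fundamental forms\<close>

lemma smooth_fun_mult:
  assumes "charted M" "f \<in> smooth_fun M" "g \<in> smooth_fun M"
  shows "(\<lambda>p. f p * g p) \<in> smooth_fun M"
  using smooth_on_mult[OF smooth_fun_chart[OF assms(2)] smooth_fun_chart[OF assms(3)]]
  by (intro smooth_funI[OF assms(1)]) (simp add: comp_def)

lemma independent_family:
  fixes V :: "nat \<Rightarrow> 'v::real_vector"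
  assumes inj: "inj_on V {..<n}"
    and zero: "\<forall>c. (\<Sum>i<n. c i *\<^sub>R V i) = 0 \<longrightarrow> (\<forall>j<n. c j = 0)"
  shows "independent (V ` {..<n})"
proof (rule real_vector.independent_if_scalars_zero)
  fix f x assume s: "(\<Sum>x\<in>V ` {..<n}. f x *\<^sub>R x) = 0" and "x \<in> V ` {..<n}"
  then obtain j where j: "j < n" "x = V j" by auto
  have "(\<Sum>i<n. f (V i) *\<^sub>R V i) = 0" using s by (simp add: sum.reindex[OF inj])
  then show "f x = 0" using zero[THEN spec, of "\<lambda>i. f (V i)"] j by simp
qed simp

locale lie_normal_metric = lie_normal G M K N
  for G :: "('a, 'b) monoid_scheme" (structure) and M :: "('a, 'e::euclidean_space) mfd"
    and K :: "'a set" and N :: "('a, 'd::euclidean_space) mfd" +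
  fixes g :: "'a metric" and nabla :: "'a vfield \<Rightarrow> 'a vfield \<Rightarrow> 'a vfield"
  assumes metric: "riemannian_metric M g" and left_inv: "left_invariant_metric G M g"
    and lc: "levi_civita M g nabla"
begin

abbreviation "\<V> \<equiv> generated_distribution N G M"
abbreviation "\<H> \<equiv> horizontal M g \<V>"
abbreviation "\<kk> \<equiv> subgroup_lie_algebra N G M"
abbreviation "\<gg> \<equiv> lie_algebra G M"

section \<open>Metric and connection on the group\<close>

lemma g_comb:
  assumes "p \<in> carrier G" "u \<in> tangent_space M p" "v \<in> tangent_space M p" "w \<in> tangent_space M p"
  shows "g p (a *\<^sub>R u + b *\<^sub>R v) w = a * g p u w + b * g p v w"
  using metric assms unfolding riemannian_metric_def topspace_eq by blast

lemma g_sym: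
  "p \<in> carrier G \<Longrightarrow> u \<in> tangent_space M p \<Longrightarrow> v \<in> tangent_space M p \<Longrightarrow> g p u v = g p v u"
  using metric unfolding riemannian_metric_def topspace_eq by blast

lemma g_pos: "p \<in> carrier G \<Longrightarrow> u \<in> tangent_space M p \<Longrightarrow> u \<noteq> 0 \<Longrightarrow> g p u u > 0"
  using metric unfolding riemannian_metric_def topspace_eq by blast

lemma g_smooth:
  "X \<in> vector_fields M \<Longrightarrow> Y \<in> vector_fields M \<Longrightarrow> (\<lambda>p. g p (X p) (Y p)) \<in> smooth_fun M"
  by (rule bspec[OF bspec[OF conjunct2[OF metric[unfolded riemannian_metric_def]]]])

lemma g_add:
  "p \<in> carrier G \<Longrightarrow> u \<in> tangent_space M p \<Longrightarrow> v \<in> tangent_space M p \<Longrightarrow> w \<in> tangent_space M p \<Longrightarrow>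
    g p (u + v) w = g p u w + g p v w"
  using g_comb[of p u v w 1 1] by simp

lemma g_scale:
  "p \<in> carrier G \<Longrightarrow> u \<in> tangent_space M p \<Longrightarrow> w \<in> tangent_space M p \<Longrightarrow> g p (a *\<^sub>R u) w = a * g p u w"
  using g_comb[of p u u w a 0] by simp

lemma g_diff:
  assumes "p \<in> carrier G" "u \<in> tangent_space M p" "v \<in> tangent_space M p" "w \<in> tangent_space M p"
  shows "g p (u - v) w = g p u w - g p v w"
proof -
  have e: "u - v = 1 *\<^sub>R u + (-1) *\<^sub>R v" by simp
  show ?thesis unfolding e using g_comb[OF assms, of 1 "-1"] by simp
qed

lemma g_zero: "p \<in> carrier G \<Longrightarrow> w \<in> tangent_space M p \<Longrightarrow> g p 0 w = 0"
  using g_scale[of p w w 0] by simp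

lemma tangent_sum:
  "p \<in> carrier G \<Longrightarrow> (\<And>i. i \<in> A \<Longrightarrow> u i \<in> tangent_space M p) \<Longrightarrow> (\<Sum>i\<in>A. u i) \<in> tangent_space M p"
  by (rule real_vector.subspace_sum[OF subspace_tangent])

lemma g_sum:
  assumes p: "p \<in> carrier G" and w: "w \<in> tangent_space M p" and "finite A"
    and u: "\<And>i. i \<in> A \<Longrightarrow> u i \<in> tangent_space M p"
  shows "g p (\<Sum>i\<in>A. u i) w = (\<Sum>i\<in>A. g p (u i) w)"
  using assms(3) u
proof (induction A)
  case empty
  show ?case unfolding sum.empty by (rule g_zero[OF p w])
next
  case (insert i A)
  have a: "g p (u i + sum u A) w = g p (u i) w + g p (sum u A) w"
    by (rule g_add[OF p _ tangent_sum[OF p] w]) (use insert.prems in blast)+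
  have IH: "g p (sum u A) w = (\<Sum>i\<in>A. g p (u i) w)"
    by (rule insert.IH) (use insert.prems in blast)
  show ?case unfolding sum.insert[OF insert.hyps] a IH ..
qed

lemma kk_gg: "W \<in> \<kk> \<Longrightarrow> W \<in> \<gg>"
  using subgroup_lie_algebra_subset by blast

lemma gg_vf: "X \<in> \<gg> \<Longrightarrow> X \<in> vector_fields M"
  by (rule lie_algebra_vector_fields)

lemma vf_at: "X \<in> vector_fields M \<Longrightarrow> p \<in> carrier G \<Longrightarrow> X p \<in> tangent_space M p"
  by (rule vector_fieldsD(1))

lemma g_left_invariant:
  assumes X: "X \<in> \<gg>" and Y: "Y \<in> \<gg>" and p: "p \<in> carrier G"
  shows "g p (X p) (Y p) = g \<one> (X \<one>) (Y \<one>)"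
proof -
  have "g (p \<otimes> \<one>) (pushforward M (\<lambda>x. p \<otimes> x) (X \<one>)) (pushforward M (\<lambda>x. p \<otimes> x) (Y \<one>)) = g \<one> (X \<one>) (Y \<one>)"
    using left_inv p lie_algebra_lfield(1)[OF X] lie_algebra_lfield(1)[OF Y] one_closed
    unfolding left_invariant_metric_def by blast
  then show ?thesis
    using lie_algebra_left[OF X p one_closed] lie_algebra_left[OF Y p one_closed] p by simp
qed

lemma g_left_invariant2:
  assumes "X \<in> \<gg>" "Y \<in> \<gg>" "p \<in> carrier G" "q \<in> carrier G"
  shows "g p (X p) (Y p) = g q (X q) (Y q)"
  unfolding g_left_invariant[OF assms(1,2,3)] g_left_invariant[OF assms(1,2,4)] ..

lemma nabla_vf: "X \<in> vector_fields M \<Longrightarrow> Y \<in> vector_fields M \<Longrightarrow> nabla X Y \<in> vector_fields M"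
  using lc unfolding levi_civita_def affine_connection_def by blast

lemma nabla_add_left:
  "X \<in> vector_fields M \<Longrightarrow> Y \<in> vector_fields M \<Longrightarrow> Z \<in> vector_fields M \<Longrightarrow>
    nabla (X + Y) Z = nabla X Z + nabla Y Z"
  using lc unfolding levi_civita_def affine_connection_def by blast

lemma nabla_smult_left:
  "X \<in> vector_fields M \<Longrightarrow> Y \<in> vector_fields M \<Longrightarrow> f \<in> smooth_fun M \<Longrightarrow>
    nabla (fun_smult f X) Y = fun_smult f (nabla X Y)"
  using lc unfolding levi_civita_def affine_connection_def by blast

lemma nabla_swap:
  assumes "X \<in> vector_fields M" "Y \<in> vector_fields M"
  shows "nabla X Y p = nabla Y X p + bracket X Y p"
proof -
  have "nabla X Y - nabla Y X = bracket X Y"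
    using lc assms unfolding levi_civita_def by blast
  then have "bracket X Y p = nabla X Y p - nabla Y X p" by (auto simp: fun_eq_iff)
  then have *: "bracket X Y p + nabla Y X p = nabla X Y p" by (simp only: eq_diff_eq)
  show ?thesis unfolding *[symmetric] by (rule add.commute)
qed

text \<open>The form in which metric compatibility is used: the constant comes either from a pair of
  left-invariant fields or, with value 0, from a vertical and a horizontal field.\<close>

lemma compatible_const:
  assumes "X \<in> vector_fields M" "Y \<in> vector_fields M" "Z \<in> vector_fields M" "p \<in> carrier G"
    and "\<And>q. q \<in> carrier G \<Longrightarrow> g q (Y q) (Z q) = c"
  shows "g p (nabla X Y p) (Z p) = - g p (Y p) (nabla X Z p)"
proof -
  have "X p (\<lambda>q. g q (Y q) (Z q)) = g p (nabla X Y p) (Z p) + g p (Y p) (nabla X Z p)"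
    by (rule bspec[OF bspec[OF bspec[OF bspec[OF conjunct2[OF conjunct2[OF
        lc[unfolded levi_civita_def topspace_eq]]] assms(1)] assms(2)] assms(3)] assms(4)])
  moreover have "X p (\<lambda>q. g q (Y q) (Z q)) = X p (\<lambda>q. c)"
    by (rule tangent_cong[OF charted vf_at[OF assms(1,4)]]) (simp add: topspace_eq assms(5))
  moreover have "X p (\<lambda>q. c) = 0" by (rule tangent_const[OF charted vf_at[OF assms(1,4)]])
  ultimately show ?thesis by simp
qed

section \<open>Vertical and horizontal vectors\<close>

lemma vertical_at: "W \<in> \<kk> \<Longrightarrow> p \<in> carrier G \<Longrightarrow> W p \<in> \<V> p"
  unfolding generated_distribution_eq by (rule imageI)

lemma vertical_extend: "p \<in> carrier G \<Longrightarrow> u \<in> \<V> p \<Longrightarrow> \<exists>W\<in>\<kk>. W p = u"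
  unfolding generated_distribution_eq by blast

lemma vertical_tangent: "p \<in> carrier G \<Longrightarrow> u \<in> \<V> p \<Longrightarrow> u \<in> tangent_space M p"
  using generated_distribution_tangent by blast

lemma horizontal_tangent: "u \<in> \<H> p \<Longrightarrow> u \<in> tangent_space M p"
  unfolding horizontal_def by blast

lemma horizontal_vertical: "u \<in> \<H> p \<Longrightarrow> v \<in> \<V> p \<Longrightarrow> g p u v = 0"
  unfolding horizontal_def by blast

lemma horizontal_left_invariant:
  assumes E: "E \<in> \<gg>" and p: "p \<in> carrier G" "E p \<in> \<H> p" and q: "q \<in> carrier G"
  shows "E q \<in> \<H> q"
proof -
  have "g q (E q) u = 0" if u: "u \<in> \<V> q" for u
  proof -
    obtain W where W: "W \<in> \<kk>" "W q = u" using vertical_extend[OF q u] by blast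
    have "g q (E q) (W q) = g p (E p) (W p)"
      by (rule g_left_invariant2[OF E kk_gg[OF W(1)] q p(1)])
    then show ?thesis using horizontal_vertical[OF p(2) vertical_at[OF W(1) p(1)]] W(2) by simp
  qed
  then show ?thesis unfolding horizontal_def using vf_at[OF gg_vf[OF E] q] by blast
qed

lemma subspace_horizontal:
  assumes p: "p \<in> carrier G"
  shows "subspace (\<H> p)"
  unfolding real_vector.subspace_def
proof (intro conjI ballI allI)
  note T = real_vector.subspace_0[OF subspace_tangent[OF p]]
    real_vector.subspace_add[OF subspace_tangent[OF p]] real_vector.subspace_scale[OF subspace_tangent[OF p]]
  show "0 \<in> \<H> p"
    unfolding horizontal_def using T(1) g_zero[OF p vertical_tangent[OF p]] by blast
  fix u assume u: "u \<in> \<H> p"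
  show "u + v \<in> \<H> p" if v: "v \<in> \<H> p" for v
  proof -
    have "g p (u + v) w = 0" if w: "w \<in> \<V> p" for w
      using g_add[OF p horizontal_tangent[OF u] horizontal_tangent[OF v] vertical_tangent[OF p w]]
        horizontal_vertical[OF u w] horizontal_vertical[OF v w] by simp
    then show ?thesis
      unfolding horizontal_def using T(2)[OF horizontal_tangent[OF u] horizontal_tangent[OF v]] by blast
  qed
  show "r *\<^sub>R u \<in> \<H> p" for r
  proof -
    have "g p (r *\<^sub>R u) w = 0" if w: "w \<in> \<V> p" for w
      using g_scale[OF p horizontal_tangent[OF u] vertical_tangent[OF p w]]
        horizontal_vertical[OF u w] by simp
    then show ?thesis
      unfolding horizontal_def using T(3)[OF horizontal_tangent[OF u]] by blast
  qed
qed

text \<open>\<open>orth_proj\<close> is a definite description. Two candidates \<open>v\<close> and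
  \<open>w\<close> give g (v - w, v - w) = 0, so positivity yields uniqueness; each use exhibits the
  candidate.\<close>

lemma orth_proj_eq:
  assumes p: "p \<in> carrier G" and W: "subspace W" "W \<subseteq> tangent_space M p"
    and u: "u \<in> tangent_space M p" and w: "w \<in> W" "\<And>w'. w' \<in> W \<Longrightarrow> g p (u - w) w' = 0"
  shows "orth_proj (g p) W u = w"
  unfolding orth_proj_def
proof (rule the_equality)
  show "w \<in> W \<and> (\<forall>w'\<in>W. g p (u - w) w' = 0)" using w by blast
  fix v assume v: "v \<in> W \<and> (\<forall>w'\<in>W. g p (u - v) w' = 0)"
  have T: "v \<in> tangent_space M p" "w \<in> tangent_space M p" using v w(1) W(2) by blast+
  have vw: "v - w \<in> W" using v w(1) W(1) by (blast intro: real_vector.subspace_diff)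
  then have vwT: "v - w \<in> tangent_space M p" using W(2) by blast
  have "g p (v - w) (v - w) = g p v (v - w) - g p w (v - w)" by (rule g_diff[OF p T vwT])
  moreover have "g p u (v - w) - g p w (v - w) = 0"
    using w(2)[OF vw] g_diff[OF p u T(2) vwT] by simp
  moreover have "g p u (v - w) - g p v (v - w) = 0"
    using v vw g_diff[OF p u T(1) vwT] by simp
  ultimately have "g p (v - w) (v - w) = 0" by simp
  then have "v - w = 0" using g_pos[OF p vwT] by force
  then show "v = w" by simp
qed

text \<open>Koszul: since \<open>g (E, W)\<close> and \<open>g (E, E)\<close> are constant, \<open>g (\<nabla>\<^sub>E E, W) = - g (E, [E, W])\<close>, and
  \<open>[E, W]\<close> is vertical.\<close>

lemma nabla_horizontal:
  assumes E: "E \<in> \<gg>" and W: "W \<in> \<kk>" and hor: "\<And>q. q \<in> carrier G \<Longrightarrow> E q \<in> \<H> q"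
    and p: "p \<in> carrier G"
  shows "g p (nabla E E p) (W p) = 0"
proof -
  note vE = gg_vf[OF E] and vW = gg_vf[OF kk_gg[OF W]]
  note T = vf_at[OF vE p] vf_at[OF vW p]
  have 1: "g p (nabla E E p) (W p) = - g p (E p) (nabla E W p)"
    by (rule compatible_const[OF vE vE vW p]) (rule horizontal_vertical[OF hor vertical_at[OF W]])
  have "g p (nabla W E p) (E p) = - g p (E p) (nabla W E p)"
    by (rule compatible_const[OF vW vE vE p]) (rule g_left_invariant[OF E E])
  then have 2: "g p (nabla W E p) (E p) = 0"
    using g_sym[OF p T(1) vf_at[OF nabla_vf[OF vW vE] p]] by simp
  have b: "bracket E W \<in> \<kk>" by (rule bracket_ideal[OF E W])
  have bT: "bracket E W p \<in> tangent_space M p" by (rule vf_at[OF gg_vf[OF kk_gg[OF b]] p])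
  have "g p (E p) (nabla E W p) = g p (nabla W E p + bracket E W p) (E p)"
    unfolding nabla_swap[OF vE vW, symmetric]
    by (rule g_sym[OF p T(1) vf_at[OF nabla_vf[OF vE vW] p]])
  also have "\<dots> = g p (nabla W E p) (E p) + g p (bracket E W p) (E p)"
    by (rule g_add[OF p vf_at[OF nabla_vf[OF vW vE] p] bT T(1)])
  also have "g p (bracket E W p) (E p) = g p (E p) (bracket E W p)"
    by (rule g_sym[OF p bT T(1)])
  also have "\<dots> = 0" by (rule horizontal_vertical[OF hor[OF p] vertical_at[OF b p]])
  finally show ?thesis using 1 2 by simp
qed

section \<open>Vanishing of the horizontal form\<close>

lemma riemannian:
  assumes conf: "conformal_foliation M g nabla \<V>"
  shows "riemannian_foliation M g nabla \<V>"
  unfolding riemannian_foliation_def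
proof (intro ballI)
  obtain U where U: "U \<in> sections M \<V>"
    and sff: "\<And>X Y. X \<in> sections M \<H> \<Longrightarrow> Y \<in> sections M \<H> \<Longrightarrow>
      horizontal_sff M g nabla \<V> X Y = fun_smult (\<lambda>p. g p (X p) (Y p)) U"
    using conf unfolding conformal_foliation_def by blast
  have Uvf: "U \<in> vector_fields M" using U unfolding sections_def by blast
  fix X Y assume X: "X \<in> sections M \<H>" and Y: "Y \<in> sections M \<H>"
  have Yvf: "Y \<in> vector_fields M" using Y unfolding sections_def by blast
  have Xh: "X p \<in> \<H> p" if "p \<in> carrier G" for p
    using X that unfolding sections_def topspace_eq by blast
  have "g p (X p) (Y p) *\<^sub>R U p = 0" for p
  proof (cases "p \<in> carrier G")
    case p: True
    show ?thesis
    proof (cases "X p = 0")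
      case True
      then show ?thesis using g_zero[OF p vf_at[OF Yvf p]] by (simp only: True scaleR_zero_left)
    next
      case False
      \<comment> \<open>For the left-invariant extension \<open>E\<close> of \<open>X p\<close> the
        form at \<open>p\<close> is both zero, by \<open>nabla_horizontal\<close>, and g (E, E) U.
        As X p \<noteq> 0 the factor is positive, so \<open>U p\<close> = 0.\<close>
      obtain E where E: "E \<in> \<gg>" "E p = X p"
        using lie_algebra_extend[OF p horizontal_tangent[OF Xh[OF p]]] by blast
      have hor: "E q \<in> \<H> q" if "q \<in> carrier G" for q
        by (rule horizontal_left_invariant[OF E(1) p _ that]) (simp only: E(2) Xh[OF p])
      have Es: "E \<in> sections M \<H>"
        using gg_vf[OF E(1)] hor unfolding sections_def topspace_eq by blast
      let ?u = "(nabla E E + nabla E E) p"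
      have nT: "nabla E E p \<in> tangent_space M p"
        by (rule vf_at[OF nabla_vf[OF gg_vf[OF E(1)] gg_vf[OF E(1)]] p])
      have u: "?u = nabla E E p + nabla E E p" by (simp only: plus_fun_def)
      have "orth_proj (g p) (\<V> p) ?u = 0"
      proof (rule orth_proj_eq[OF p subspace_generated_distribution[OF p] generated_distribution_tangent[OF p]])
        show "?u \<in> tangent_space M p"
          unfolding u by (rule real_vector.subspace_add[OF subspace_tangent[OF p] nT nT])
        show "0 \<in> \<V> p" by (rule real_vector.subspace_0[OF subspace_generated_distribution[OF p]])
        fix w assume w: "w \<in> \<V> p"
        obtain W where W: "W \<in> \<kk>" "W p = w" using vertical_extend[OF p w] by blast
        have "g p (nabla E E p) w = 0" using nabla_horizontal[OF E(1) W(1) hor p] W(2) by simp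
        then show "g p (?u - 0) w = 0"
          unfolding u diff_zero using g_add[OF p nT nT vertical_tangent[OF p w]] by simp
      qed
      then have "horizontal_sff M g nabla \<V> E E p = 0"
        using p unfolding sff_def by (simp only: topspace_eq if_True scaleR_zero_right)
      then have "g p (E p) (E p) *\<^sub>R U p = 0"
        unfolding sff[OF Es Es] fun_smult_def .
      moreover have "g p (E p) (E p) \<noteq> 0"
        using g_pos[OF p horizontal_tangent[OF Xh[OF p]] False] unfolding E(2) by simp
      ultimately have "U p = 0" by (simp only: scaleR_eq_0_iff simp_thms)
      then show ?thesis by (simp only: scaleR_zero_right)
    qed
  next
    case False
    then have "U p = 0" by (rule vector_fieldsD(2)[OF Uvf])
    then show ?thesis by (simp only: scaleR_zero_right)
  qed
  then show "horizontal_sff M g nabla \<V> X Y = 0"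
    unfolding sff[OF X Y] fun_smult_def by (simp only: zero_fun_def)
qed

section \<open>Minimality of the leaves\<close>

lemma orthonormal_expand:
  fixes n :: nat
  assumes p: "p \<in> carrier G" and w: "\<And>i. i < n \<Longrightarrow> w i \<in> tangent_space M p"
    and on: "\<And>i j. i < n \<Longrightarrow> j < n \<Longrightarrow> g p (w i) (w j) = (if i = j then 1 else 0)"
    and x: "x \<in> span (w ` {..<n})"
  shows "x = (\<Sum>i<n. g p x (w i) *\<^sub>R w i)"
proof -
  have "x \<in> tangent_space M p \<and> x = (\<Sum>i<n. g p x (w i) *\<^sub>R w i)"
    using x
  proof (induction rule: real_vector.span_induct_alt)
    case base
    have "(\<Sum>i<n. g p 0 (w i) *\<^sub>R w i) = 0"
    proof (rule sum.neutral, intro ballI)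
      fix i assume "i \<in> {..<n}"
      then have "g p 0 (w i) = 0" by (intro g_zero[OF p w]) simp
      then show "g p 0 (w i) *\<^sub>R w i = 0" by (simp only: scaleR_zero_left)
    qed
    then show ?case using real_vector.subspace_0[OF subspace_tangent[OF p]] by (simp only: simp_thms)
  next
    case (step c v y)
    obtain k where k: "k < n" "v = w k" using step(1) by blast
    have yT: "y \<in> tangent_space M p" and y: "y = (\<Sum>i<n. g p y (w i) *\<^sub>R w i)"
      using step(2) by blast+
    have cT: "c *\<^sub>R v \<in> tangent_space M p"
      unfolding k(2) by (rule real_vector.subspace_scale[OF subspace_tangent[OF p] w[OF k(1)]])
    have "g p (c *\<^sub>R v + y) (w i) *\<^sub>R w i = (if i = k then c *\<^sub>R w k else 0) + g p y (w i) *\<^sub>R w i"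
      if i: "i < n" for i
    proof -
      have "g p (c *\<^sub>R v + y) (w i) = c * (if k = i then 1 else 0) + g p y (w i)"
        unfolding g_add[OF p cT yT w[OF i]] unfolding k(2) g_scale[OF p w[OF k(1)] w[OF i]] on[OF k(1) i] ..
      then show ?thesis by (cases "i = k") (simp_all add: scaleR_add_left)
    qed
    then have "(\<Sum>i<n. g p (c *\<^sub>R v + y) (w i) *\<^sub>R w i) =
        (\<Sum>i<n. (if i = k then c *\<^sub>R w k else 0) + g p y (w i) *\<^sub>R w i)"
      by (intro sum.cong refl) simp
    also have "\<dots> = (\<Sum>i<n. if i = k then c *\<^sub>R w k else 0) + (\<Sum>i<n. g p y (w i) *\<^sub>R w i)"
      by (rule sum.distrib)
    also have "(\<Sum>i<n. if i = k then c *\<^sub>R w k else 0) = c *\<^sub>R v"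
      using k by (simp only: sum.delta finite_lessThan lessThan_iff if_True)
    also have "(\<Sum>i<n. g p y (w i) *\<^sub>R w i) = y" by (rule y[symmetric])
    finally have "c *\<^sub>R v + y = (\<Sum>i<n. g p (c *\<^sub>R v + y) (w i) *\<^sub>R w i)" by (rule sym)
    then show ?case
      using real_vector.subspace_add[OF subspace_tangent[OF p] cT yT] by blast
  qed
  then show ?thesis by blast
qed

lemma smult_vf:
  assumes f: "f \<in> smooth_fun M" and X: "X \<in> vector_fields M"
  shows "fun_smult f X \<in> vector_fields M"
  unfolding vector_fields_def topspace_eq
proof (intro CollectI conjI ballI allI impI)
  show "fun_smult f X p \<in> tangent_space M p" if "p \<in> carrier G" for p
    unfolding fun_smult_def by (rule tangent_scaleR[OF charted vf_at[OF X that]])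
  show "fun_smult f X p = 0" if "p \<notin> carrier G" for p
    unfolding fun_smult_def vector_fieldsD(2)[OF X that] by (rule scaleR_zero_right)
  show "(\<lambda>p. fun_smult f X p h) \<in> smooth_fun M" if "h \<in> smooth_fun M" for h
    using smooth_fun_mult[OF charted f vector_fieldsD(3)[OF X that]]
    by (simp add: fun_smult_def scaleR_fun_def)
qed

lemma nabla_zero_left: "Z \<in> vector_fields M \<Longrightarrow> nabla 0 Z = 0"
  using nabla_add_left[OF real_vector.subspace_0[OF subspace_vector_fields]
      real_vector.subspace_0[OF subspace_vector_fields], of Z] by (simp only: add_0 add_cancel_right_right)

lemma nabla_sum_left:
  assumes "finite A" and Z: "Z \<in> vector_fields M"
    and f: "\<And>i. i \<in> A \<Longrightarrow> f i \<in> smooth_fun M" and X: "\<And>i. i \<in> A \<Longrightarrow> X i \<in> vector_fields M"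
  shows "nabla (\<Sum>i\<in>A. fun_smult (f i) (X i)) Z = (\<Sum>i\<in>A. fun_smult (f i) (nabla (X i) Z))"
  using assms(1) f X
proof (induction A)
  case empty
  show ?case unfolding sum.empty by (rule nabla_zero_left[OF Z])
next
  case (insert i A)
  have i: "fun_smult (f i) (X i) \<in> vector_fields M" using insert by (intro smult_vf) auto
  have s: "(\<Sum>i\<in>A. fun_smult (f i) (X i)) \<in> vector_fields M"
    using insert by (intro real_vector.subspace_sum[OF subspace_vector_fields] smult_vf) auto
  have IH: "nabla (\<Sum>i\<in>A. fun_smult (f i) (X i)) Z = (\<Sum>i\<in>A. fun_smult (f i) (nabla (X i) Z))"
    using insert by blast
  have sm: "nabla (fun_smult (f i) (X i)) Z = fun_smult (f i) (nabla (X i) Z)"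
    using insert by (intro nabla_smult_left Z) auto
  show ?case
    unfolding sum.insert[OF insert.hyps] nabla_add_left[OF i s Z] IH sm ..
qed

text \<open>\<open>ad E\<close> is a derivation of the semisimple ideal \<open>\<kk>\<close>, hence traceless.\<close>

lemma trace_ad_zero:
  fixes n :: nat
  assumes ss: "semisimple_lie_algebra bracket \<kk>"
    and E: "E \<in> \<gg>" and p: "p \<in> carrier G"
    and V: "\<And>i. i < n \<Longrightarrow> V i \<in> \<kk>"
    and on: "\<And>i j. i < n \<Longrightarrow> j < n \<Longrightarrow> g p (V i p) (V j p) = (if i = j then 1 else 0)"
    and expand: "\<And>X. X \<in> \<kk> \<Longrightarrow> X = (\<Sum>i<n. g p (X p) (V i p) *\<^sub>R V i)"
  shows "(\<Sum>i<n. g p (bracket E (V i) p) (V i p)) = 0"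
proof -
  have VT: "V i p \<in> tangent_space M p" if "i < n" for i
    by (rule vf_at[OF gg_vf[OF kk_gg[OF V[OF that]]] p])
  have inj: "inj_on V {..<n}"
  proof (rule inj_onI)
    fix i j assume ij: "i \<in> {..<n}" "j \<in> {..<n}" "V i = V j"
    then have "(if i = j then 1 else 0 :: real) = 1"
      using on[of i j] on[of j j] by simp
    then show "i = j" by (simp split: if_splits)
  qed
  have scalars: "\<forall>c. (\<Sum>i<n. c i *\<^sub>R V i) = 0 \<longrightarrow> (\<forall>j<n. c j = 0)"
  proof (intro allI impI)
    fix c j assume s: "(\<Sum>i<n. c i *\<^sub>R V i) = 0" and j: "j < n"
    have "(\<Sum>i<n. c i *\<^sub>R V i) p = 0" unfolding s by (simp only: zero_fun_def)
    then have z: "(\<Sum>i<n. c i *\<^sub>R V i p) = 0" by (simp only: sum_fun_apply scaleR_fun_def)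
    have 0: "g p (\<Sum>i<n. c i *\<^sub>R V i p) (V j p) = 0"
      unfolding z by (rule g_zero[OF p VT[OF j]])
    have "g p (\<Sum>i<n. c i *\<^sub>R V i p) (V j p) = (\<Sum>i<n. g p (c i *\<^sub>R V i p) (V j p))"
      by (rule g_sum[OF p VT[OF j]]) (auto intro: real_vector.subspace_scale[OF subspace_tangent[OF p]] VT)
    also have "\<dots> = (\<Sum>i<n. if i = j then c j else 0)"
    proof (rule sum.cong[OF refl])
      fix i assume "i \<in> {..<n}"
      then have i: "i < n" by simp
      show "g p (c i *\<^sub>R V i p) (V j p) = (if i = j then c j else 0)"
        unfolding g_scale[OF p VT[OF i] VT[OF j]] on[OF i j] by simp
    qed
    also have "\<dots> = c j" using j by simp
    finally have 1: "g p (\<Sum>i<n. c i *\<^sub>R V i p) (V j p) = c j" .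
    show "c j = 0" by (rule trans[OF 1[symmetric] 0])
  qed
  have ind: "independent (V ` {..<n})" by (rule independent_family[OF inj scalars])
  have span: "\<kk> = span (V ` {..<n})"
  proof (rule subset_antisym)
    show "\<kk> \<subseteq> span (V ` {..<n})"
    proof (rule subsetI)
      fix X assume X: "X \<in> \<kk>"
      have mem: "(\<Sum>i<n. g p (X p) (V i p) *\<^sub>R V i) \<in> span (V ` {..<n})"
        by (rule real_vector.span_sum, rule real_vector.span_scale, rule real_vector.span_base) (rule imageI)
      show "X \<in> span (V ` {..<n})" by (subst expand[OF X]) (rule mem)
    qed
    show "span (V ` {..<n}) \<subseteq> \<kk>"
      by (rule real_vector.span_minimal[OF _ subspace_subgroup_lie_algebra]) (use V in blast)
  qed
  have kvf: "X \<in> vector_fields M" if "X \<in> \<kk>" for X by (rule gg_vf[OF kk_gg[OF that]])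
  note vE = gg_vf[OF E]
  show ?thesis
  proof (rule derivation_trace_zero[of V n \<kk> bracket "bracket E"
        "\<lambda>i j. g p (bracket E (V i) p) (V j p)"])
    show "inj_on V {..<n}" "independent (V ` {..<n})" "\<kk> = span (V ` {..<n})"
      "semisimple_lie_algebra bracket \<kk>" by (fact inj ind span ss)+
    show "bracket X Y \<in> \<kk>" if "X \<in> \<kk>" "Y \<in> \<kk>" for X Y
      by (rule bracket_ideal[OF kk_gg[OF that(1)] that(2)])
    show "bracket X (Y + Z) = bracket X Y + bracket X Z" if "X \<in> \<kk>" "Y \<in> \<kk>" "Z \<in> \<kk>" for X Y Z
      by (rule bracket_add[OF kvf[OF that(1)] kvf[OF that(2)] kvf[OF that(3)]])
    show "bracket X (r *\<^sub>R Y) = r *\<^sub>R bracket X Y" if "X \<in> \<kk>" "Y \<in> \<kk>" for X Y r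
      by (rule bracket_scale[OF kvf[OF that(1)] kvf[OF that(2)]])
    show "bracket X Y = - bracket Y X" if "X \<in> \<kk>" "Y \<in> \<kk>" for X Y
      by (rule bracket_anti)
    show "bracket X (bracket Y Z) = bracket (bracket X Y) Z + bracket Y (bracket X Z)"
      if "X \<in> \<kk>" "Y \<in> \<kk>" "Z \<in> \<kk>" for X Y Z
      by (rule bracket_jacobi[OF kvf[OF that(1)] kvf[OF that(2)] kvf[OF that(3)]])
    show "bracket E X \<in> \<kk>" if "X \<in> \<kk>" for X by (rule bracket_ideal[OF E that])
    show "bracket E (X + Y) = bracket E X + bracket E Y" if "X \<in> \<kk>" "Y \<in> \<kk>" for X Y
      by (rule bracket_add[OF vE kvf[OF that(1)] kvf[OF that(2)]])
    show "bracket E (r *\<^sub>R X) = r *\<^sub>R bracket E X" if "X \<in> \<kk>" for X r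
      by (rule bracket_scale[OF vE kvf[OF that]])
    show "bracket E (bracket X Y) = bracket (bracket E X) Y + bracket X (bracket E Y)"
      if "X \<in> \<kk>" "Y \<in> \<kk>" for X Y
      by (rule bracket_jacobi[OF vE kvf[OF that(1)] kvf[OF that(2)]])
    show "bracket E (V i) = (\<Sum>j<n. g p (bracket E (V i) p) (V j p) *\<^sub>R V j)" if "i < n" for i
      by (rule expand[OF bracket_ideal[OF E V[OF that]]])
  qed
qed

text \<open>The trace vector S is horizontal; with its left-invariant extension \<open>E\<close>
  each summand of g (S, S) becomes g ([E, V_i], V_i), and the sum of these is the trace of ad
  \<open>E\<close> on \<open>\<kk>\<close>. The left-invariant fields V_i agree with the given ones
  at \<open>p\<close>.\<close>

lemma minimal:
  assumes ss: "semisimple_lie_algebra bracket \<kk>"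
  shows "minimal_foliation M g nabla \<V>"
  unfolding minimal_foliation_def topspace_eq
proof (intro ballI allI impI, elim conjE)
  fix p W and n :: nat
  assume p: "p \<in> carrier G" and Ws: "\<forall>i<n. W i \<in> sections M \<V>"
    and onW: "\<forall>i<n. \<forall>j<n. g p (W i p) (W j p) = (if i = j then 1 else 0)"
    and spW: "span ((\<lambda>i. W i p) ` {..<n}) = \<V> p"
  have Wvf: "W i \<in> vector_fields M" and Wv: "q \<in> carrier G \<Longrightarrow> W i q \<in> \<V> q" if "i < n" for i q
    using Ws that unfolding sections_def topspace_eq by blast+
  have WT: "W i p \<in> tangent_space M p" if "i < n" for i by (rule vf_at[OF Wvf[OF that] p])
  have "\<forall>i. \<exists>X. i < n \<longrightarrow> X \<in> \<kk> \<and> X p = W i p" using vertical_extend[OF p Wv[OF _ p]] by blast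
  then obtain V where V': "\<forall>i. i < n \<longrightarrow> V i \<in> \<kk> \<and> V i p = W i p" by (rule choice[THEN exE])
  have V: "V i \<in> \<kk>" and Vp: "V i p = W i p" if "i < n" for i using V' that by blast+
  have Vg: "V i \<in> \<gg>" and Vvf: "V i \<in> vector_fields M" if "i < n" for i
    using kk_gg[OF V[OF that]] gg_vf by blast+
  \<comment> \<open>Left invariance carries orthonormality from \<open>p\<close> to every
    point.\<close>
  have on: "g q (V i q) (V j q) = (if i = j then 1 else 0)"
    if "i < n" "j < n" "q \<in> carrier G" for i j q
    unfolding g_left_invariant2[OF Vg[OF that(1)] Vg[OF that(2)] that(3) p] Vp[OF that(1)] Vp[OF that(2)]
    using onW that by blast
  have VT: "V i q \<in> tangent_space M q" if "i < n" "q \<in> carrier G" for i q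
    by (rule vf_at[OF Vvf[OF that(1)] that(2)])
  have expand_at: "x = (\<Sum>i<n. g q x (V i q) *\<^sub>R V i q)"
    if q: "q \<in> carrier G" and x: "x \<in> span ((\<lambda>i. V i q) ` {..<n})" for q x
  proof (rule orthonormal_expand[OF q _ _ x])
    show "V i q \<in> tangent_space M q" if "i < n" for i by (rule VT[OF that q])
    show "g q (V i q) (V j q) = (if i = j then 1 else 0)" if "i < n" "j < n" for i j
      by (rule on[OF that q])
  qed
  have expand: "X = (\<Sum>i<n. g p (X p) (V i p) *\<^sub>R V i)" if X: "X \<in> \<kk>" for X
  proof (rule lie_algebra_eqI[OF kk_gg[OF X] _ p])
    show "(\<Sum>i<n. g p (X p) (V i p) *\<^sub>R V i) \<in> \<gg>"
      by (intro real_vector.subspace_sum[OF subspace_lie_algebra] real_vector.subspace_scale[OF subspace_lie_algebra])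
        (simp add: Vg)
    have "(\<lambda>i. W i p) ` {..<n} = (\<lambda>i. V i p) ` {..<n}" using Vp by (intro image_cong) auto
    then have "X p \<in> span ((\<lambda>i. V i p) ` {..<n})"
      using vertical_at[OF X p] spW by simp
    then have "X p = (\<Sum>i<n. g p (X p) (V i p) *\<^sub>R V i p)"
      by (rule expand_at[OF p])
    then show "X p = (\<Sum>i<n. g p (X p) (V i p) *\<^sub>R V i) p"
      by (simp only: sum_fun_apply scaleR_fun_def)
  qed
  \<comment> \<open>The constant coefficients found at \<open>p\<close> expand a left-invariant
    field everywhere, so the V_i span the distribution at every point.\<close>
  have Vspan: "\<V> q \<subseteq> span ((\<lambda>i. V i q) ` {..<n})" if q: "q \<in> carrier G" for q
  proof
    fix u assume "u \<in> \<V> q"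
    then obtain X where X: "X \<in> \<kk>" "X q = u" using vertical_extend[OF q] by blast
    have "X q = (\<Sum>i<n. g p (X p) (V i p) *\<^sub>R V i) q" using expand[OF X(1)] by (rule arg_cong)
    also have "\<dots> = (\<Sum>i<n. g p (X p) (V i p) *\<^sub>R V i q)" by (simp only: sum_fun_apply scaleR_fun_def)
    also have "\<dots> \<in> span ((\<lambda>i. V i q) ` {..<n})"
      by (intro real_vector.span_sum real_vector.span_scale real_vector.span_base) simp
    finally show "u \<in> span ((\<lambda>i. V i q) ` {..<n})" unfolding X(2) .
  qed
  let ?f = "\<lambda>i a q. g q (W i q) (V a q)"
  have Wexp: "W i = (\<Sum>a<n. fun_smult (?f i a) (V a))" if i: "i < n" for i
  proof
    fix q
    have "W i q = (\<Sum>a<n. ?f i a q *\<^sub>R V a q)"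
    proof (cases "q \<in> carrier G")
      case True
      have "W i q \<in> span ((\<lambda>a. V a q) ` {..<n})" using Vspan[OF True] Wv[OF i True] by (rule subsetD)
      then show ?thesis by (rule expand_at[OF True])
    next
      case False
      have "(\<Sum>a<n. ?f i a q *\<^sub>R V a q) = 0"
      proof (rule sum.neutral, intro ballI)
        fix a assume "a \<in> {..<n}"
        then have "V a q = 0" using vector_fieldsD(2)[OF Vvf False] by simp
        then show "?f i a q *\<^sub>R V a q = 0" by (simp only: scaleR_zero_right)
      qed
      then show ?thesis using vector_fieldsD(2)[OF Wvf[OF i] False] by (simp only:)
    qed
    then show "W i q = (\<Sum>a<n. fun_smult (?f i a) (V a)) q"
      by (simp only: sum_fun_apply fun_smult_def)
  qed
  \<comment> \<open>The coefficients of W_i with respect to the V_a are smooth functions that reduce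
    at \<open>p\<close> to 0 and 1, and the connection is function-linear in its first argument.
    That argument suffices: compatibility first moves the derivative from the second W_i onto
    \<open>E\<close>.\<close>
  have tens: "nabla (W i) E p = nabla (V i) E p" if i: "i < n" and E: "E \<in> vector_fields M" for i E
  proof -
    have "nabla (W i) E = (\<Sum>a<n. fun_smult (?f i a) (nabla (V a) E))"
      by (subst Wexp[OF i], rule nabla_sum_left[OF finite_lessThan E])
        (use g_smooth[OF Wvf[OF i] Vvf] Vvf in auto)
    then have "nabla (W i) E p = (\<Sum>a<n. ?f i a p *\<^sub>R nabla (V a) E p)"
      by (simp only: sum_fun_apply fun_smult_def)
    also have "\<dots> = (\<Sum>a<n. if a = i then nabla (V i) E p else 0)"
    proof (rule sum.cong[OF refl])
      fix a assume "a \<in> {..<n}"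
      then have a: "a < n" by simp
      show "?f i a p *\<^sub>R nabla (V a) E p = (if a = i then nabla (V i) E p else 0)"
        unfolding Vp[OF i, symmetric] on[OF i a p] by (cases "a = i") simp_all
    qed
    also have "\<dots> = nabla (V i) E p"
      using i by (simp only: sum.delta finite_lessThan lessThan_iff if_True)
    finally show ?thesis .
  qed
  let ?u = "\<lambda>i. (nabla (W i) (W i) + nabla (W i) (W i)) p"
  have nT: "nabla (W i) (W i) p \<in> tangent_space M p" if "i < n" for i
    by (rule vf_at[OF nabla_vf[OF Wvf[OF that] Wvf[OF that]] p])
  have u: "?u i = nabla (W i) (W i) p + nabla (W i) (W i) p" for i by (simp only: plus_fun_def)
  have uT: "?u i \<in> tangent_space M p" if "i < n" for i
    unfolding u by (rule real_vector.subspace_add[OF subspace_tangent[OF p] nT[OF that] nT[OF that]])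
  define c where "c i j = g p (?u i) (W j p)" for i j
  \<comment> \<open>The vertical part of \<open>?u i\<close> at \<open>p\<close>. The orthonormal
    basis at hand is that of the vertical space, so the horizontal projection is obtained as the
    complement \<open>?u i - v i\<close>.\<close>
  define v where "v i = (\<Sum>j<n. c i j *\<^sub>R W j p)" for i
  have vV: "v i \<in> \<V> p" for i
    unfolding v_def spW[symmetric]
    by (intro real_vector.span_sum real_vector.span_scale real_vector.span_base) simp
  have cT: "c i j *\<^sub>R W j p \<in> tangent_space M p" if "j < n" for i j
    by (rule real_vector.subspace_scale[OF subspace_tangent[OF p] WT[OF that]])
  have vW: "g p (v i) (W k p) = c i k" if k: "k < n" for i k
  proof -
    have "g p (v i) (W k p) = (\<Sum>j<n. g p (c i j *\<^sub>R W j p) (W k p))"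
      unfolding v_def by (rule g_sum[OF p WT[OF k]]) (use cT in auto)
    also have "\<dots> = (\<Sum>j<n. if j = k then c i k else 0)"
    proof (rule sum.cong[OF refl])
      fix j assume "j \<in> {..<n}"
      then have j: "j < n" by simp
      have "g p (W j p) (W k p) = (if j = k then 1 else 0)" using onW j k by blast
      then show "g p (c i j *\<^sub>R W j p) (W k p) = (if j = k then c i k else 0)"
        unfolding g_scale[OF p WT[OF j] WT[OF k]] by simp
    qed
    also have "\<dots> = c i k" using k by simp
    finally show ?thesis .
  qed
  have uvT: "?u i - v i \<in> tangent_space M p" if "i < n" for i
    by (rule real_vector.subspace_diff[OF subspace_tangent[OF p] uT[OF that] vertical_tangent[OF p vV]])
  have uvH: "?u i - v i \<in> \<H> p" if i: "i < n" for i
  proof -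
    have vT: "v i \<in> tangent_space M p" by (rule vertical_tangent[OF p vV])
    have "g p (?u i - v i) w = 0" if "w \<in> \<V> p" for w
    proof -
      have "w \<in> span ((\<lambda>i. W i p) ` {..<n})" using that spW by simp
      then have "w \<in> tangent_space M p \<and> g p w (?u i - v i) = 0"
      proof (induction rule: real_vector.span_induct_alt)
        case base
        show ?case
          by (intro conjI real_vector.subspace_0[OF subspace_tangent[OF p]] g_zero[OF p uvT[OF i]])
      next
        case (step r x y)
        obtain k where k: "k < n" "x = W k p" using step(1) by blast
        have yT: "y \<in> tangent_space M p" and y: "g p y (?u i - v i) = 0" using step(2) by blast+
        have rT: "r *\<^sub>R x \<in> tangent_space M p"
          unfolding k(2) by (rule real_vector.subspace_scale[OF subspace_tangent[OF p] WT[OF k(1)]])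
        have "g p (W k p) (?u i - v i) = g p (?u i - v i) (W k p)"
          by (rule g_sym[OF p WT[OF k(1)] uvT[OF i]])
        also have "\<dots> = 0"
          unfolding g_diff[OF p uT[OF i] vT WT[OF k(1)]] vW[OF k(1)] c_def by (rule right_minus_eq[THEN iffD2, OF refl])
        finally have "g p (r *\<^sub>R x) (?u i - v i) = 0"
          unfolding k(2) g_scale[OF p WT[OF k(1)] uvT[OF i]] by simp
        then have "g p (r *\<^sub>R x + y) (?u i - v i) = 0"
          unfolding g_add[OF p rT yT uvT[OF i]] y by simp
        then show ?case using real_vector.subspace_add[OF subspace_tangent[OF p] rT yT] by blast
      qed
      then show ?thesis using g_sym[OF p uvT[OF i]] by metis
    qed
    then show ?thesis unfolding horizontal_def using uvT[OF i] by blast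
  qed
  have proj: "orth_proj (g p) (\<H> p) (?u i) = ?u i - v i" if i: "i < n" for i
  proof (rule orth_proj_eq[OF p subspace_horizontal[OF p] _ uT[OF i] uvH[OF i]])
    show "\<H> p \<subseteq> tangent_space M p" using horizontal_tangent by blast
    fix w assume w: "w \<in> \<H> p"
    have e: "?u i - (?u i - v i) = v i" by (simp only: diff_diff_eq2 add_diff_cancel_left')
    show "g p (?u i - (?u i - v i)) w = 0"
      unfolding e using g_sym[OF p vertical_tangent[OF p vV] horizontal_tangent[OF w]]
        horizontal_vertical[OF w vV] by simp
  qed
  define S where "S = (\<Sum>i<n. vertical_sff M g nabla \<V> (W i) (W i) p)"
  have hT: "(1/2) *\<^sub>R (?u i - v i) \<in> \<H> p" if "i < n" for i
    by (rule real_vector.subspace_scale[OF subspace_horizontal[OF p] uvH[OF that]])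
  have S: "S = (\<Sum>i<n. (1/2) *\<^sub>R (?u i - v i))"
    unfolding S_def sff_def
    by (intro sum.cong refl) (use p proj in \<open>simp only: topspace_eq if_True lessThan_iff\<close>)
  have SH: "S \<in> \<H> p"
    unfolding S by (rule real_vector.subspace_sum[OF subspace_horizontal[OF p]]) (use hT in simp)
  have ST: "S \<in> tangent_space M p" by (rule horizontal_tangent[OF SH])
  obtain E where E: "E \<in> \<gg>" "E p = S" using lie_algebra_extend[OF p ST] by blast
  have Eh: "E q \<in> \<H> q" if "q \<in> carrier G" for q
    by (rule horizontal_left_invariant[OF E(1) p _ that]) (simp only: E(2) SH)
  have vE: "E \<in> vector_fields M" by (rule gg_vf[OF E(1)])
  have ET: "E p \<in> tangent_space M p" by (rule vf_at[OF vE p])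
  \<comment> \<open>The factor 1/2 cancels the doubling in \<open>?u i\<close>. Then g (\<nabla>_W
    W, E) = -g (V, \<nabla>_V E) = g ([E, V], V), because g (V, V) is constant and so g (\<nabla>_E
    V, V) = 0.\<close>
  have summand: "g p ((1/2) *\<^sub>R (?u i - v i)) (E p) = g p (bracket E (V i) p) (V i p)" if i: "i < n" for i
  proof -
    have Wh: "g q (W i q) (E q) = 0" if q: "q \<in> carrier G" for q
      using g_sym[OF q vertical_tangent[OF q Wv[OF i q]] horizontal_tangent[OF Eh[OF q]]]
        horizontal_vertical[OF Eh[OF q] Wv[OF i q]] by simp
    have 1: "g p (nabla (W i) (W i) p) (E p) = - g p (V i p) (nabla (V i) E p)"
      using compatible_const[OF Wvf[OF i] Wvf[OF i] vE p Wh] unfolding tens[OF i vE] Vp[OF i] .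
    have bT: "bracket E (V i) p \<in> tangent_space M p"
      by (rule vf_at[OF bracket_vector_fields[OF vE Vvf[OF i]] p])
    have nVT: "nabla E (V i) p \<in> tangent_space M p" "nabla (V i) E p \<in> tangent_space M p"
      using vf_at[OF nabla_vf p] vE Vvf[OF i] by blast+
    have "g p (nabla E (V i) p) (V i p) = - g p (V i p) (nabla E (V i) p)"
      by (rule compatible_const[OF vE Vvf[OF i] Vvf[OF i] p]) (rule on[OF i i])
    then have "g p (nabla E (V i) p) (V i p) = 0"
      using g_sym[OF p nVT(1) VT[OF i p]] by simp
    moreover have "g p (nabla E (V i) p) (V i p) =
        g p (nabla (V i) E p) (V i p) + g p (bracket E (V i) p) (V i p)"
      unfolding nabla_swap[OF vE Vvf[OF i]] by (rule g_add[OF p nVT(2) bT VT[OF i p]])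
    ultimately have 2: "g p (V i p) (nabla (V i) E p) = - g p (bracket E (V i) p) (V i p)"
      using g_sym[OF p nVT(2) VT[OF i p]] by simp
    have vE0: "g p (v i) (E p) = 0"
      using g_sym[OF p vertical_tangent[OF p vV] ET] horizontal_vertical[OF Eh[OF p] vV] by simp
    have "g p ((1/2) *\<^sub>R (?u i - v i)) (E p) = 1/2 * (g p (?u i) (E p) - g p (v i) (E p))"
      unfolding g_scale[OF p uvT[OF i] ET] g_diff[OF p uT[OF i] vertical_tangent[OF p vV] ET] ..
    also have "g p (?u i) (E p) = g p (nabla (W i) (W i) p) (E p) + g p (nabla (W i) (W i) p) (E p)"
      unfolding u by (rule g_add[OF p nT[OF i] nT[OF i] ET])
    finally have 3: "g p ((1/2) *\<^sub>R (?u i - v i)) (E p) =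
        1/2 * (g p (nabla (W i) (W i) p) (E p) + g p (nabla (W i) (W i) p) (E p) - g p (v i) (E p))" .
    show ?thesis unfolding 3 1 2 vE0 by simp
  qed
  have "g p S S = (\<Sum>i<n. g p ((1/2) *\<^sub>R (?u i - v i)) (E p))"
    unfolding E(2)[symmetric] unfolding E(2) S
    by (rule g_sum[OF p ST[unfolded S]]) (use hT horizontal_tangent in auto)
  also have "\<dots> = (\<Sum>i<n. g p (bracket E (V i) p) (V i p))"
    by (intro sum.cong refl summand) simp
  also have "\<dots> = 0"
    by (rule trace_ad_zero[OF ss E(1) p V on[OF _ _ p] expand])
  finally have "g p S S = 0" .
  then have "S = 0" using g_pos[OF p ST] by force
  then show "(\<Sum>i<n. vertical_sff M g nabla \<V> (W i) (W i) p) = 0" unfolding S_def .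
qed

end

theorem theorem1p6:
  fixes G :: "('a, 'b) monoid_scheme"
    and M :: "('a, 'e::euclidean_space) mfd"
    and g :: "'a metric"
    and nabla :: "'a vfield \<Rightarrow> 'a vfield \<Rightarrow> 'a vfield"
    and K :: "'a set"
    and N :: "('a, 'd::euclidean_space) mfd"
  assumes "riemannian_lie_group G M g"
    and "levi_civita M g nabla"
    and "lie_subgroup K N G M"
    and "semisimple_lie_algebra bracket (subgroup_lie_algebra N G M)"
    and "conformal_foliation M g nabla (generated_distribution N G M)"
    and "K \<lhd> G"
  shows "riemannian_foliation M g nabla (generated_distribution N G M) \<and>
         minimal_foliation M g nabla (generated_distribution N G M)"
proof -
  have R: "lie_group G M" "riemannian_metric M g" "left_invariant_metric G M g"
    using assms(1) unfolding riemannian_lie_group_def by blast+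
  interpret G: lie_grp G M by (rule lie_grp.intro[OF R(1)])
  have br: "bracket X Y \<in> vector_fields M" if "X \<in> vector_fields M" "Y \<in> vector_fields M" for X Y
  proof -
    have "nabla X Y - nabla Y X = bracket X Y"
      using assms(2) that unfolding levi_civita_def by blast
    moreover have "nabla X Y \<in> vector_fields M" "nabla Y X \<in> vector_fields M"
      using assms(2) that unfolding levi_civita_def affine_connection_def by blast+
    ultimately show ?thesis
      using real_vector.subspace_diff[OF G.subspace_vector_fields] by metis
  qed
  interpret lie_normal_metric G M K N g nabla
    by (intro lie_normal_metric.intro lie_normal_metric_axioms.intro lie_normal.intro
        lie_normal_axioms.intro lie_grp_bracket.intro lie_grp_bracket_axioms.intro lie_grp.intro
        R br assms(2,3,6))
  show ?thesis using riemannian[OF assms(5)] minimal[OF assms(4)] ..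
qed

end
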